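(* Let $X_1,X_2,\dots$ be i.i.d. with density $p$ as described in the context, $h\in\mathfrak{R}$, and let $a_n\to\infty$. Define $t=t(n)$ by $m(t)=a_n$ and assume $$\lim_{n\to\infty}\frac{\psi(t)^2}{\sqrt{n}\,\psi'(t)}=0 .$$ Fix $k\ge1$ and $y_1^k=(y_1,\dots,y_k)\in\mathbb{R}^k$. Let $p_{a_n}(y_1^k)=p(X_1^k=y_1^k\mid S_1^n=na_n)$ be the conditional density of $X_1^k=(X_1,\dots,X_k)$ given $S_1^n=X_1+\dots+X_n=na_n$, evaluated at $y_1^k$. Then, as $n\to\infty$, $$p_{a_n}(y_1^k)=g_{a_n}(y_1^k)\left(1+o\left(\frac1{\sqrt n}\right)\right),\qquad g_{a_n}(y_1^k)=\prod_{i=1}^{k}\pi^{a_n}(y_i).$$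
   Context: Density: $p$ is a uniformly bounded probability density, $p(x)=c\exp(-(g(x)-q(x)))$ for $x\in\mathbb{R}_+$ (and $p=0$ on negative reals), with $c>0$ a normalizing constant. The function $g$ is positive, $g(x)/x\to\infty$ as $x\to\infty$, and $h:=g'$. There is a constant $\vartheta>0$ such that for all large $x$, $\sup_{|v-x|<\vartheta x}|q(v)|\le 1/\sqrt{x h(x)}$. Regularity classes: $l\in R_0$ if $l(x)=\exp\left(\int_1^x\frac{\epsilon(u)}{u}du\right)$ for $x\ge1$, where $\epsilon$ is twice differentiable and $\epsilon(x)\to0$ as $x\to\infty$. For $\beta>0$, $h\in R_\beta$ if for $x$ large enough $h(x)=x^\beta l(x)$ with $l\in R_0$ whose function $\epsilon$ satisfies $\limsup_{x\to\infty}x|\epsilon'(x)|<\infty$ and $\limsup_{x\to\infty}x^2|\epsilon''(x)|<\infty$. A function $l\in R_0$ belongs to $\widetilde{R_0}$ if $l(x)\to\infty$ as $x\to\infty$, $\lim_{x\to\infty}\frac{x\epsilon'(x)}{\epsilon(x)}=0$, $\lim_{x\to\infty}\frac{x^2\epsilon''(x)}{\epsilon(x)}=0$, and $\liminf_{x\to\infty}x^\eta\epsilon(x)>0$ for some $\eta\in(0,1/4)$. $h\in R_\infty$ if $h$ is increasing and strictly monotone and its inverse $\psi$ belongs to $\widetilde{R_0}$. Here $\psi(u):=h^{\leftarrow}(u):=\inf\{x:h(x)\ge u\}$ (this notation is used for all $h$). $\mathfrak{R}:=R_\beta\cup R_\infty$ (any $\beta>0$). $\Phi(t)=\int_0^\infty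 e^{tx}p(x)\,dx$; $m(t)=\frac{d}{dt}\log\Phi(t)$. The tilted density is $\pi^{a}(x)=\frac{e^{tx}p(x)}{\Phi(t)}$ with $t$ the unique solution of $m(t)=a$.
   Formalization: The formal statement additionally assumes that h = g' is bounded above on every interval [0,A] (automatic if g is continuously differentiable or h is increasing); otherwise ψ can stay bounded for h in R_β and the claim can fail. *)

theory Defs
  imports "HOL-Probability.Probability" "HOL-Library.Landau_Symbols"
begin

text \<open>Here \<open>e1\<close> and \<open>e2\<close> are the first and second derivative of \<open>e\<close> on \<open>[1, \<infinity>)\<close>
  (one-sided at \<open>1\<close>).\<close>

definition R0_rep ::
  "(real \<Rightarrow> real) \<Rightarrow> (real \<Rightarrow> real) \<Rightarrow> (real \<Rightarrow> real) \<Rightarrow> (real \<Rightarrow> real) \<Rightarrow> bool" where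
  "R0_rep l e e1 e2 \<longleftrightarrow>
     (\<forall>x\<ge>1. (e has_real_derivative e1 x) (at x within {1..})) \<and>
     (\<forall>x\<ge>1. (e1 has_real_derivative e2 x) (at x within {1..})) \<and>
     (e \<longlongrightarrow> 0) at_top \<and>
     (\<forall>x\<ge>1. l x = exp (integral {1..x} (\<lambda>u. e u / u)))"

definition R_beta :: "real \<Rightarrow> (real \<Rightarrow> real) set" where
  "R_beta \<beta> = {h. \<exists>l e e1 e2. R0_rep l e e1 e2 \<and>
     (\<forall>\<^sub>F x in at_top. h x = x powr \<beta> * l x) \<and>
     Limsup at_top (\<lambda>x. ereal (x * \<bar>e1 x\<bar>)) < \<infinity> \<and>
     Limsup at_top (\<lambda>x. ereal (x\<^sup>2 * \<bar>e2 x\<bar>)) < \<infinity>}"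

definition R0_tilde :: "(real \<Rightarrow> real) set" where
  "R0_tilde = {l. \<exists>e e1 e2. R0_rep l e e1 e2 \<and>
     filterlim l at_top at_top \<and>
     ((\<lambda>x. x * e1 x / e x) \<longlongrightarrow> 0) at_top \<and>
     ((\<lambda>x. x\<^sup>2 * e2 x / e x) \<longlongrightarrow> 0) at_top \<and>
     (\<exists>\<eta>. 0 < \<eta> \<and> \<eta> < 1/4 \<and> Liminf at_top (\<lambda>x. ereal (x powr \<eta> * e x)) > 0)}"

text \<open>The functions \<open>h\<close> live on \<open>[0, \<infinity>)\<close>; their values on negative reals are irrelevant.\<close>

definition gen_inv :: "(real \<Rightarrow> real) \<Rightarrow> real \<Rightarrow> real" where
  "gen_inv h u = Inf {x. x \<ge> 0 \<and> h x \<ge> u}"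

definition R_infty :: "(real \<Rightarrow> real) set" where
  "R_infty = {h. strict_mono_on {0..} h \<and> gen_inv h \<in> R0_tilde}"

definition R_class :: "(real \<Rightarrow> real) set" where
  "R_class = (\<Union>\<beta>\<in>{0<..}. R_beta \<beta>) \<union> R_infty"

definition Phi :: "(real \<Rightarrow> real) \<Rightarrow> real \<Rightarrow> real" where
  "Phi p t = (LBINT x:{0..}. exp (t * x) * p x)"

definition mean_fun :: "(real \<Rightarrow> real) \<Rightarrow> real \<Rightarrow> real" where
  "mean_fun p t = deriv (\<lambda>s. ln (Phi p s)) t"

definition tilt_param :: "(real \<Rightarrow> real) \<Rightarrow> real \<Rightarrow> real" where
  "tilt_param p a = (THE t. mean_fun p t = a)"

definition tilted_density :: "(real \<Rightarrow> real) \<Rightarrow> real \<Rightarrow> real \<Rightarrow> real" where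
  "tilted_density p a x = exp (tilt_param p a * x) * p x / Phi p (tilt_param p a)"

text \<open>To evaluate the density of a real random variable at a point, a version has to be chosen:
  we take the continuous one, which is unique if it exists
  (lemma \<open>continuous_density_eqI\<close> below). Sums of at least two
  independent variables with a common bounded density have a continuous density.\<close>

definition continuous_density :: "'a measure \<Rightarrow> ('a \<Rightarrow> real) \<Rightarrow> real \<Rightarrow> real" where
  "continuous_density M Z = (THE f. continuous_on UNIV f \<and> (\<forall>x. 0 \<le> f x) \<and>
     distributed M lborel Z (\<lambda>x. ennreal (f x)))"

text \<open>The joint density of \<open>((X\<^sub>1, \<dots>, X\<^sub>k), X\<^sub>1 + \<dots> + X\<^sub>n)\<close> at \<open>(y, s)\<close>, for independent \<open>X\<^sub>i\<close> with
  common density \<open>p\<close>; see lemma \<open>distributed_joint_density\<close> below. As \<open>p\<close> need not be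
  continuous, the version is again fixed explicitly, by conditioning on
  \<open>(X\<^sub>1, \<dots>, X\<^sub>k) = y\<close>, given which the sum equals \<open>y\<^sub>1 + \<dots> + y\<^sub>k + X\<^sub>k\<^sub>+\<^sub>1 + \<dots> + X\<^sub>n\<close>.\<close>

definition joint_density ::
  "'a measure \<Rightarrow> (nat \<Rightarrow> 'a \<Rightarrow> real) \<Rightarrow> (real \<Rightarrow> real) \<Rightarrow> nat \<Rightarrow> nat \<Rightarrow> (nat \<Rightarrow> real) \<Rightarrow> real \<Rightarrow> real"
where
  "joint_density M X p k n y s =
     (\<Prod>i=1..k. p (y i)) *
     continuous_density M (\<lambda>\<omega>. \<Sum>i=k+1..n. X i \<omega>) (s - (\<Sum>i=1..k. y i))"

definition cond_density ::
  "'a measure \<Rightarrow> (nat \<Rightarrow> 'a \<Rightarrow> real) \<Rightarrow> (real \<Rightarrow> real) \<Rightarrow> nat \<Rightarrow> nat \<Rightarrow> (nat \<Rightarrow> real) \<Rightarrow> real \<Rightarrow> real"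
where
  "cond_density M X p k n y s =
     joint_density M X p k n y s / continuous_density M (\<lambda>\<omega>. \<Sum>i=1..n. X i \<omega>) s"

lemma continuous_density_eqI:
  assumes "prob_space M"
    and f: "continuous_on UNIV f" "\<And>x. 0 \<le> f x" "distributed M lborel Z (\<lambda>x. ennreal (f x))"
  shows "continuous_density M Z = f"
  unfolding continuous_density_def
proof (rule the_equality)
  interpret prob_space M by fact
  fix f' assume f': "continuous_on UNIV f' \<and> (\<forall>x. 0 \<le> f' x) \<and> distributed M lborel Z (\<lambda>x. ennreal (f' x))"
  have "AE x in lborel. ennreal (f' x) = ennreal (f x)"
    using f' f by (intro distributed_unique) auto
  then have "AE x in lborel. x \<notin> {x. f' x \<noteq> f x}"
    by eventually_elim (use f' f in auto)
  moreover have op: "open {x. f' x \<noteq> f x}"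
    using f' f by (intro open_Collect_neq) auto
  ultimately have "{x. f' x \<noteq> f x} \<in> null_sets lborel"
    by (subst (asm) AE_iff_null_sets[symmetric]) auto
  then have "negligible {x. f' x \<noteq> f x}"
    using negligible_iff_null_sets null_sets_completionI by blast
  with op have "{x. f' x \<noteq> f x} = {}"
    using open_not_negligible by blast
  then show "f' = f" by auto
qed (use f in auto)

lemma distributed_shear:
  fixes W :: "'a \<Rightarrow> 'b" and Z :: "'a \<Rightarrow> real"
  assumes N: "sigma_finite_measure N"
    and D: "distributed M (N \<Otimes>\<^sub>M lborel) (\<lambda>\<omega>. (W \<omega>, Z \<omega>)) F"
    and \<sigma>[measurable]: "\<sigma> \<in> borel_measurable N"
  shows "distributed M (N \<Otimes>\<^sub>M lborel) (\<lambda>\<omega>. (W \<omega>, Z \<omega> + \<sigma> (W \<omega>))) (\<lambda>(y, s). F (y, s - \<sigma> y))"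
proof -
  let ?L = "N \<Otimes>\<^sub>M (lborel :: real measure)"
  let ?T = "\<lambda>(y, z). (y, z + \<sigma> y)"
  have [measurable]: "F \<in> borel_measurable ?L" and WZ[measurable]: "(\<lambda>\<omega>. (W \<omega>, Z \<omega>)) \<in> measurable M ?L"
    and eq: "distr M ?L (\<lambda>\<omega>. (W \<omega>, Z \<omega>)) = density ?L F"
    using D by (auto simp: distributed_def)
  have T[measurable]: "?T \<in> measurable ?L ?L" by measurable
  have "distr M ?L (\<lambda>\<omega>. ?T (W \<omega>, Z \<omega>)) = distr (density ?L F) ?L ?T"
    unfolding eq[symmetric] by (subst distr_distr) (auto simp: comp_def)
  also have "\<dots> = density ?L (\<lambda>(y, s). F (y, s - \<sigma> y))"
  proof (rule measure_eqI)
    fix A assume A: "A \<in> sets (distr (density ?L F) ?L ?T)"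
    then have [measurable]: "A \<in> sets ?L" by simp
    have "emeasure (distr (density ?L F) ?L ?T) A = (\<integral>\<^sup>+ w. indicator A w \<partial>distr (density ?L F) ?L ?T)"
      using A by (rule nn_integral_indicator[symmetric])
    also have "\<dots> = (\<integral>\<^sup>+ w. indicator A (?T w) \<partial>density ?L F)"
      by (rule nn_integral_distr) auto
    also have "\<dots> = (\<integral>\<^sup>+ w. F w * indicator A (?T w) \<partial>?L)"
      by (rule nn_integral_density) auto
    also have "\<dots> = (\<integral>\<^sup>+ y. (\<integral>\<^sup>+ z. F (y, z) * indicator A (y, z + \<sigma> y) \<partial>lborel) \<partial>N)"
      by (subst lborel.nn_integral_fst[symmetric]) auto
    also have "\<dots> = (\<integral>\<^sup>+ y. (\<integral>\<^sup>+ s. F (y, s - \<sigma> y) * indicator A (y, s) \<partial>lborel) \<partial>N)"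
    proof (rule nn_integral_cong)
      fix y assume [measurable]: "y \<in> space N"
      show "(\<integral>\<^sup>+ z. F (y, z) * indicator A (y, z + \<sigma> y) \<partial>lborel)
          = (\<integral>\<^sup>+ s. F (y, s - \<sigma> y) * indicator A (y, s) \<partial>lborel)"
        by (subst nn_integral_real_affine[where c=1 and t="- \<sigma> y"]) (auto simp: algebra_simps)
    qed
    also have "\<dots> = (\<integral>\<^sup>+ w. (case w of (y, s) \<Rightarrow> F (y, s - \<sigma> y)) * indicator A w \<partial>?L)"
      by (subst lborel.nn_integral_fst[symmetric]) auto
    also have "\<dots> = emeasure (density ?L (\<lambda>(y, s). F (y, s - \<sigma> y))) A"
      by (rule emeasure_density[symmetric]) measurable
    finally show "emeasure (distr (density ?L F) ?L ?T) A
      = emeasure (density ?L (\<lambda>(y, s). F (y, s - \<sigma> y))) A" .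
  qed simp
  finally have "distr M ?L (\<lambda>\<omega>. ?T (W \<omega>, Z \<omega>)) = density ?L (\<lambda>(y, s). F (y, s - \<sigma> y))" .
  moreover have "(\<lambda>\<omega>. ?T (W \<omega>, Z \<omega>)) \<in> measurable M ?L"
    by (rule measurable_compose[OF WZ T])
  ultimately show ?thesis by (simp add: distributed_def)
qed

lemma (in prob_space) distributed_PiM_iid:
  fixes X :: "nat \<Rightarrow> 'a \<Rightarrow> real"
  assumes I: "finite I" "I \<noteq> {}" and ind: "indep_vars (\<lambda>_. borel) X I"
    and D: "\<And>i. i \<in> I \<Longrightarrow> distributed M lborel (X i) (\<lambda>x. ennreal (p x))"
    and p: "\<And>x. 0 \<le> p x"
  shows "distributed M (PiM I (\<lambda>_. lborel)) (\<lambda>\<omega>. \<lambda>i\<in>I. X i \<omega>) (\<lambda>y. ennreal (\<Prod>i\<in>I. p (y i)))"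
proof -
  interpret L: product_sigma_finite "\<lambda>_::nat. lborel :: real measure" by standard
  have pm[measurable]: "(\<lambda>x. ennreal (p x)) \<in> borel_measurable borel"
    using D I by (auto simp: distributed_def)
  have X[measurable]: "X i \<in> borel_measurable M" if "i \<in> I" for i
    using D[OF that] by (auto simp: distributed_def)
  have d: "distr M borel (X i) = density lborel (\<lambda>x. ennreal (p x))" if "i \<in> I" for i
    using D[OF that] by (simp add: distributed_def cong: distr_cong)
  have pr: "prob_space (density lborel (\<lambda>x. ennreal (p x)))"
    using I d X by (metis ex_in_conv prob_space_distr)
  interpret P: product_sigma_finite "\<lambda>_::nat. density lborel (\<lambda>x. ennreal (p x))"
    using pr by (simp add: product_sigma_finite_def prob_space_imp_sigma_finite)
  have S: "sets (PiM I (\<lambda>_. lborel :: real measure)) = sets (PiM I (\<lambda>_. borel))"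
    by (intro sets_PiM_cong) auto
  have "distr M (PiM I (\<lambda>_. lborel)) (\<lambda>\<omega>. \<lambda>i\<in>I. X i \<omega>) = distr M (PiM I (\<lambda>_. borel)) (\<lambda>\<omega>. \<lambda>i\<in>I. X i \<omega>)"
    using S by (intro distr_cong) auto
  also have "\<dots> = PiM I (\<lambda>i. distr M borel (X i))"
    using ind X I by (subst (asm) indep_vars_iff_distr_eq_PiM') auto
  also have "\<dots> = PiM I (\<lambda>_. density lborel (\<lambda>x. ennreal (p x)))"
    using d by (intro PiM_cong) auto
  also have "\<dots> = density (PiM I (\<lambda>_. lborel)) (\<lambda>y. \<Prod>i\<in>I. ennreal (p (y i)))"
  proof (rule P.PiM_eqI[OF I(1), symmetric])
    show "sets (density (PiM I (\<lambda>_. lborel)) (\<lambda>y. \<Prod>i\<in>I. ennreal (p (y i)))) =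
       sets (PiM I (\<lambda>_. density lborel (\<lambda>x. ennreal (p x))))"
      by (auto intro!: sets_PiM_cong)
    fix A assume A: "\<And>i. i \<in> I \<Longrightarrow> A i \<in> sets (density lborel (\<lambda>x. ennreal (p x)))"
    then have [measurable]: "A i \<in> sets borel" if "i \<in> I" for i using that by auto
    have "emeasure (density (PiM I (\<lambda>_. lborel)) (\<lambda>y. \<Prod>i\<in>I. ennreal (p (y i)))) (Pi\<^sub>E I A)
      = (\<integral>\<^sup>+ y. (\<Prod>i\<in>I. ennreal (p (y i))) * indicator (Pi\<^sub>E I A) y \<partial>PiM I (\<lambda>_. lborel))"
      using I by (intro emeasure_density) (auto intro!: sets_PiM_I_finite)
    also have "\<dots> = (\<integral>\<^sup>+ y. (\<Prod>i\<in>I. ennreal (p (y i)) * indicator (A i) (y i)) \<partial>PiM I (\<lambda>_. lborel))"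
    proof (rule nn_integral_cong)
      fix y assume "y \<in> space (PiM I (\<lambda>_. lborel :: real measure))"
      then have y: "y \<in> Pi\<^sub>E I (\<lambda>_. UNIV)" by (simp add: space_PiM)
      have "indicator (Pi\<^sub>E I A) y = (\<Prod>i\<in>I. indicator (A i) (y i) :: ennreal)"
      proof (cases "\<forall>i\<in>I. y i \<in> A i")
        case True then show ?thesis using y by (auto simp: PiE_iff)
      next
        case False then show ?thesis using y I by (auto simp: PiE_iff indicator_def)
      qed
      then show "(\<Prod>i\<in>I. ennreal (p (y i))) * indicator (Pi\<^sub>E I A) y
        = (\<Prod>i\<in>I. ennreal (p (y i)) * indicator (A i) (y i))"
        by (simp add: prod.distrib)
    qed
    also have "\<dots> = (\<Prod>i\<in>I. \<integral>\<^sup>+ x. ennreal (p x) * indicator (A i) x \<partial>lborel)"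
      using I by (intro L.product_nn_integral_prod) auto
    also have "\<dots> = (\<Prod>i\<in>I. emeasure (density lborel (\<lambda>x. ennreal (p x))) (A i))"
      by (intro prod.cong) (auto simp: emeasure_density)
    finally show "emeasure (density (PiM I (\<lambda>_. lborel)) (\<lambda>y. \<Prod>i\<in>I. ennreal (p (y i)))) (Pi\<^sub>E I A)
      = (\<Prod>i\<in>I. emeasure (density lborel (\<lambda>x. ennreal (p x))) (A i))" .
  qed
  also have "(\<lambda>y. \<Prod>i\<in>I. ennreal (p (y i))) = (\<lambda>y. ennreal (\<Prod>i\<in>I. p (y i)))"
    using p by (simp add: prod_ennreal)
  finally have "distr M (PiM I (\<lambda>_. lborel)) (\<lambda>\<omega>. \<lambda>i\<in>I. X i \<omega>)
    = density (PiM I (\<lambda>_. lborel)) (\<lambda>y. ennreal (\<Prod>i\<in>I. p (y i)))" .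
  moreover have "(\<lambda>\<omega>. \<lambda>i\<in>I. X i \<omega>) \<in> measurable M (PiM I (\<lambda>_. lborel))"
    by (rule measurable_restrict) auto
  moreover have "(\<lambda>y. \<Prod>i\<in>I. ennreal (p (y i))) \<in> borel_measurable (PiM I (\<lambda>_. lborel))"
    by measurable
  then have "(\<lambda>y. ennreal (\<Prod>i\<in>I. p (y i))) \<in> borel_measurable (PiM I (\<lambda>_. lborel))"
    using p by (simp add: prod_ennreal)
  ultimately show ?thesis by (simp add: distributed_def)
qed

lemma distributed_joint_density:
  fixes X :: "nat \<Rightarrow> 'a \<Rightarrow> real"
  assumes M: "prob_space M" and ind: "prob_space.indep_vars M (\<lambda>_. borel) X {1..}"
    and D: "\<And>i. i \<ge> 1 \<Longrightarrow> distributed M lborel (X i) (\<lambda>x. ennreal (p x))"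
    and p: "\<And>x. 0 \<le> p x" and k: "1 \<le> k" "k < n"
    and f: "continuous_on UNIV f" "\<And>x. 0 \<le> f x"
      "distributed M lborel (\<lambda>\<omega>. \<Sum>i=k+1..n. X i \<omega>) (\<lambda>x. ennreal (f x))"
  shows "distributed M (PiM {1..k} (\<lambda>_. lborel) \<Otimes>\<^sub>M lborel)
           (\<lambda>\<omega>. (\<lambda>i\<in>{1..k}. X i \<omega>, \<Sum>i=1..n. X i \<omega>))
           (\<lambda>(y, s). ennreal (joint_density M X p k n y s))"
proof -
  interpret prob_space M by fact
  interpret L: product_sigma_finite "\<lambda>_::nat. lborel :: real measure" by standard
  let ?N = "PiM {1..k} (\<lambda>_. lborel :: real measure)"
  let ?W = "\<lambda>\<omega>. \<lambda>i\<in>{1..k}. X i \<omega>" and ?Z = "\<lambda>\<omega>. \<Sum>i=k+1..n. X i \<omega>"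
  have N: "sigma_finite_measure ?N" by (rule L.sigma_finite) simp
  have W: "distributed M ?N ?W (\<lambda>y. ennreal (\<Prod>i=1..k. p (y i)))"
    using D p k by (intro distributed_PiM_iid indep_vars_subset[OF ind]) auto
  let ?A = "PiM {1..k} (\<lambda>_. borel :: real measure)" and ?B = "PiM {k+1..n} (\<lambda>_. borel :: real measure)"
  let ?V = "\<lambda>\<omega>. \<lambda>i\<in>{k+1..n}. X i \<omega>"
  have "indep_var ?A ?W ?B ?V"
    by (rule indep_var_restrict[OF ind]) auto
  then have eq: "distr M ?A ?W \<Otimes>\<^sub>M distr M ?B ?V = distr M (?A \<Otimes>\<^sub>M ?B) (\<lambda>\<omega>. (?W \<omega>, ?V \<omega>))"
    and W'[measurable]: "?W \<in> measurable M ?A" and V[measurable]: "?V \<in> measurable M ?B"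
    unfolding indep_var_distribution_eq by blast+
  have id[measurable]: "(\<lambda>w. w) \<in> measurable ?A ?N"
    by (intro measurable_ident_sets sets_PiM_cong) auto
  have sum[measurable]: "(\<lambda>w. \<Sum>i=k+1..n. w i) \<in> measurable ?B (lborel :: real measure)"
    unfolding measurable_lborel1 by (rule borel_measurable_sum) (rule measurable_component_singleton)
  have ZV: "(\<Sum>i=k+1..n. ?V \<omega> i) = ?Z \<omega>" for \<omega> by (intro sum.cong) auto
  have "sigma_finite_measure (distr (distr M ?B ?V) lborel (\<lambda>w. \<Sum>i=k+1..n. w i))"
    using prob_space.prob_space_distr[OF prob_space_distr[OF V], of "\<lambda>w. \<Sum>i=k+1..n. w i" lborel] sum
    by (intro prob_space_imp_sigma_finite) (simp del: Suc_eq_plus1_left add: measurable_distr_eq1)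
  then have pd: "distr (distr M ?A ?W) ?N (\<lambda>w. w) \<Otimes>\<^sub>M distr (distr M ?B ?V) lborel (\<lambda>w. \<Sum>i=k+1..n. w i)
      = distr (distr M ?A ?W \<Otimes>\<^sub>M distr M ?B ?V) (?N \<Otimes>\<^sub>M lborel) (\<lambda>(w, v). (w, \<Sum>i=k+1..n. v i))"
    by (intro pair_measure_distr) auto
  have d1: "distr (distr M ?A ?W) ?N (\<lambda>w. w) = distr M ?N ?W"
    by (subst distr_distr[OF id W']) (simp only: comp_def)
  have d2: "distr (distr M ?B ?V) lborel (\<lambda>w. \<Sum>i=k+1..n. w i) = distr M lborel (\<lambda>\<omega>. \<Sum>i=k+1..n. ?V \<omega> i)"
    by (subst distr_distr[OF sum V]) (simp only: comp_def)
  have d3: "distr (distr M (?A \<Otimes>\<^sub>M ?B) (\<lambda>\<omega>. (?W \<omega>, ?V \<omega>))) (?N \<Otimes>\<^sub>M lborel) (\<lambda>(w, v). (w, \<Sum>i=k+1..n. v i))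
      = distr M (?N \<Otimes>\<^sub>M lborel) (\<lambda>\<omega>. (?W \<omega>, \<Sum>i=k+1..n. ?V \<omega> i))"
  proof (subst distr_distr)
    show "(\<lambda>(w, v). (w, \<Sum>i=k+1..n. v i)) \<in> measurable (?A \<Otimes>\<^sub>M ?B) (?N \<Otimes>\<^sub>M (lborel :: real measure))"
      by (rule measurable_split_conv[THEN iffD2]) (intro measurable_Pair measurable_compose[OF measurable_fst id] measurable_compose[OF measurable_snd sum])
    show "(\<lambda>\<omega>. (?W \<omega>, ?V \<omega>)) \<in> measurable M (?A \<Otimes>\<^sub>M ?B)" by measurable
  qed (simp only: comp_def prod.case)
  have "distr M ?N ?W \<Otimes>\<^sub>M distr M lborel ?Z = distr M (?N \<Otimes>\<^sub>M lborel) (\<lambda>\<omega>. (?W \<omega>, ?Z \<omega>))"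
    using pd by (simp only: eq d1 d2 d3 ZV)
  then have "distributed M (?N \<Otimes>\<^sub>M lborel) (\<lambda>\<omega>. (?W \<omega>, ?Z \<omega>))
      (\<lambda>(y, z). ennreal (\<Prod>i=1..k. p (y i)) * ennreal (f z))"
    using N W f by (intro distributed_joint_indep') (auto intro: sigma_finite_lborel)
  moreover have "(\<lambda>y. \<Sum>i=1..k. y i) \<in> borel_measurable ?N" by measurable
  ultimately have "distributed M (?N \<Otimes>\<^sub>M lborel) (\<lambda>\<omega>. (?W \<omega>, ?Z \<omega> + (\<Sum>i=1..k. ?W \<omega> i)))
      (\<lambda>(y, s). (\<lambda>(y, z). ennreal (\<Prod>i=1..k. p (y i)) * ennreal (f z)) (y, s - (\<Sum>i=1..k. y i)))"
    by (rule distributed_shear[OF N])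
  moreover have "?Z \<omega> + (\<Sum>i=1..k. ?W \<omega> i) = (\<Sum>i=1..n. X i \<omega>)" for \<omega>
  proof -
    have "{1..n} = {1..k} \<union> {k+1..n}" using k by auto
    then show ?thesis by (simp add: sum.union_disjoint add.commute)
  qed
  moreover have "continuous_density M ?Z = f"
    by (rule continuous_density_eqI[OF M f])
  then have "ennreal (\<Prod>i=1..k. p (y i)) * ennreal (f (s - (\<Sum>i=1..k. y i)))
      = ennreal (joint_density M X p k n y s)" for y s
    by (simp add: joint_density_def ennreal_mult' p f prod_nonneg)
  ultimately show ?thesis by simp
qed

end

theory Submission
  imports Defs
begin

text \<open>Let \<open>\<Phi>\<close> be \<open>Phi p\<close>. Tilting by \<open>exp (t * x)\<close> turns the density of \<open>N\<close> summands into
  \<open>\<Phi>(t)^N * exp (- t * x) * F\<^sub>N(x)\<close>, where \<open>F\<^sub>N\<close> is the density of the sum of \<open>N\<close> independent variables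
  with the tilted density. Hence \<open>p\<^sub>a(y) / g\<^sub>a(y) = F\<^sub>n\<^sub>-\<^sub>k(n * a - y\<^sub>1 - \<dots> - y\<^sub>k) / F\<^sub>n(n * a)\<close>, and both densities
  are needed up to a relative error \<open>o(1 / sqrt n)\<close>, uniformly as \<open>t \<rightarrow> \<infinity>\<close>.

  The exponent \<open>t * x - g x\<close> is concave near its maximum \<open>\<psi>(t)\<close>, and regular variation makes it
  quadratic at scale \<open>sqrt (\<psi>'(t))\<close>; so the standardized tilted density converges pointwise to the standard
  normal one with an exponentially decaying majorant. In particular the distance
  \<open>\<kappa> = \<integral> (1 + |x|^3) |f - \<phi>|\<close> between the two tends to \<open>0\<close>. As \<open>f\<close> and \<open>\<phi>\<close> have the same moments up
  to order \<open>2\<close>, their characteristic functions differ by at most \<open>\<kappa> * |v|^3\<close>, and Fourier inversion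
  gives the local limit theorem with error \<open>O(\<kappa> / sqrt N)\<close>: no Edgeworth term is needed.\<close>

section \<open>Fourier inversion for densities\<close>

text \<open>The tilted law changes with \<open>n\<close>, so the sums form a triangular array and
  all estimates are uniform along a sequence \<open>T\<close> tending to infinity. The
  characteristic function of a bounded density need not be integrable, but its squared modulus is;
  hence every power \<open>N \<ge> 2\<close> can be inverted although \<open>p\<close> may be
  discontinuous. Away from the origin, closeness to the normal law
  (\<open>\<kappa> \<le> 1 / 8\<close>) already bounds the modulus of the standardized
  characteristic function by \<open>3 / 4\<close>, so its \<open>N\<close>-th power is exponentially
  small there, uniformly in \<open>n\<close>. The growth condition is the price of fixing
  \<open>k\<close> summands. With \<open>Y\<close> the sum of the \<open>y i\<close>, the density of
  the other \<open>n - k\<close> summands is evaluated at distance \<open>k * a n - Y\<close> from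
  its mean; if \<open>s\<close> is the standard deviation of one tilted variable, the normal factor
  there is \<open>1 + O((k * a n - Y)^2 / (n * s^2))\<close>. The Laplace analysis yields
  \<open>a n ~ \<psi>(t)\<close> and \<open>s^2 ~ \<psi>'(t)\<close>, so that
  \<open>\<psi>(t)^2 / (sqrt n * \<psi>'(t)) \<rightarrow> 0\<close> is what turns this correction
  into \<open>o(1 / sqrt n)\<close>.\<close>

lemma gaussian_fourier:
  fixes e z :: real
  assumes e: "e > 0"
  shows "(CLBINT u. iexp (u * z) * exp (- (e * u)\<^sup>2 / 2)) = 2 * pi * normal_density 0 e z"
proof -
  \<comment> \<open>Substituting \<open>x = e * u\<close> in the characteristic function of the
    standard normal law at \<open>z / e\<close> produces the wanted integral.\<close>
  have "char std_normal_distribution (z / e) = (CLBINT x. std_normal_density x *\<^sub>R iexp (z / e * x))"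
    unfolding char_def by (subst integral_density) auto
  also have "\<dots> = \<bar>e\<bar> *\<^sub>R (CLBINT u. std_normal_density (0 + e * u) *\<^sub>R iexp (z / e * (0 + e * u)))"
    using e by (intro lborel_integral_real_affine) auto
  also have "(\<lambda>u. std_normal_density (0 + e * u) *\<^sub>R iexp (z / e * (0 + e * u)))
      = (\<lambda>u. (1 / sqrt (2 * pi)) *\<^sub>R (iexp (u * z) * exp (- (e * u)\<^sup>2 / 2)))"
    using e by (auto simp: std_normal_density_def scaleR_conv_of_real mult_ac fun_eq_iff)
  finally have eq: "char std_normal_distribution (z / e)
      = (e / sqrt (2 * pi)) *\<^sub>R (CLBINT u. iexp (u * z) * exp (- (e * u)\<^sup>2 / 2))"
    using e by simp
  have "(CLBINT u. iexp (u * z) * exp (- (e * u)\<^sup>2 / 2))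
      = (sqrt (2 * pi) / e) *\<^sub>R char std_normal_distribution (z / e)"
    unfolding eq using e by simp
  also have "\<dots> = of_real (sqrt (2 * pi) / e * exp (- (z / e)\<^sup>2 / 2))"
    unfolding char_std_normal_distribution by (simp add: scaleR_conv_of_real)
  also have "sqrt (2 * pi) / e * exp (- (z / e)\<^sup>2 / 2) = 2 * pi * normal_density 0 e z"
    using e by (simp add: normal_density_def real_sqrt_mult field_simps power_divide)
  finally show ?thesis .
qed

lemma integrable_gaussian:
  fixes e :: real
  assumes "e > 0"
  shows "integrable lborel (\<lambda>u. exp (- (e * u)\<^sup>2 / 2))"
proof -
  have "integrable lborel (\<lambda>u. sqrt (2 * pi * (1/e)\<^sup>2) * normal_density 0 (1/e) u)"
    using assms by (intro integrable_mult_right integrable_normal_density) auto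
  also have "(\<lambda>u. sqrt (2 * pi * (1/e)\<^sup>2) * normal_density 0 (1/e) u) = (\<lambda>u. exp (- (e * u)\<^sup>2 / 2))"
    using assms by (auto simp: normal_density_def fun_eq_iff power_divide field_simps)
  finally show ?thesis .
qed

text \<open>The Gaussian factor makes the double integral absolutely convergent, so Fubini applies
  even if \<open>char M\<close> is not integrable. The right-hand side is \<open>2 * pi\<close>
  times the density at \<open>x\<close> of \<open>M\<close> convolved with a centred normal law of
  deviation \<open>e\<close>. Letting \<open>e\<close> tend to \<open>0\<close> later gives
  nonnegativity of inverted densities, square integrability of characteristic functions and absence
  of atoms.\<close>

lemma (in real_distribution) fourier_gaussian_char:
  assumes e: "e > 0"
  shows "(CLBINT u. iexp (- (u * x)) * char M u * exp (- (e * u)\<^sup>2 / 2))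
    = of_real (2 * pi * (\<integral>z. normal_density 0 e (z - x) \<partial>M))"
proof -
  interpret P: pair_sigma_finite lborel M ..
  have int: "integrable (lborel \<Otimes>\<^sub>M M) (\<lambda>(u, z). iexp (u * (z - x)) * exp (- (e * u)\<^sup>2 / 2))"
  proof (rule P.Fubini_integrable)
    show "integrable lborel (\<lambda>u. \<integral>z. norm (case (u, z) of (u, z) \<Rightarrow> iexp (u * (z - x)) * complex_of_real (exp (- (e * u)\<^sup>2 / 2))) \<partial>M)"
      using integrable_gaussian[OF e] prob_space by (simp add: norm_mult)
    show "AE u in lborel. integrable M (\<lambda>z. case (u, z) of (u, z) \<Rightarrow> iexp (u * (z - x)) * complex_of_real (exp (- (e * u)\<^sup>2 / 2)))"
      by (auto intro!: AE_I2 integrable_mult_left integrable_iexp)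
  qed measurable
  have "(CLBINT u. iexp (- (u * x)) * char M u * exp (- (e * u)\<^sup>2 / 2))
      = (CLBINT u. (CLINT z | M. iexp (u * (z - x)) * exp (- (e * u)\<^sup>2 / 2)))"
  proof (intro Bochner_Integration.integral_cong refl)
    fix u
    have "iexp (- (u * x)) * char M u * exp (- (e * u)\<^sup>2 / 2)
        = (CLINT z | M. iexp (- (u * x)) * exp (- (e * u)\<^sup>2 / 2) * iexp (u * z))"
      unfolding char_def by simp
    also have "\<dots> = (CLINT z | M. iexp (u * (z - x)) * exp (- (e * u)\<^sup>2 / 2))"
      by (intro Bochner_Integration.integral_cong refl) (simp add: algebra_simps exp_add[symmetric] exp_diff exp_minus field_simps)
    finally show "iexp (- (u * x)) * char M u * exp (- (e * u)\<^sup>2 / 2)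
      = (CLINT z | M. iexp (u * (z - x)) * exp (- (e * u)\<^sup>2 / 2))" .
  qed
  also have "\<dots> = (CLINT z | M. (CLBINT u. iexp (u * (z - x)) * exp (- (e * u)\<^sup>2 / 2)))"
    by (rule P.Fubini_integral[OF int, symmetric])
  also have "\<dots> = (CLINT z | M. of_real (2 * pi * normal_density 0 e (z - x)))"
    by (simp only: gaussian_fourier[OF e])
  also have "\<dots> = of_real (2 * pi * (\<integral>z. normal_density 0 e (z - x) \<partial>M))"
    by (subst integral_complex_of_real) simp
  finally show ?thesis .
qed

text \<open>The right-hand side is the kernel in Levy's inversion formula. Its form as an integral
  over \<open>{a..b}\<close> bounds it by \<open>b - a\<close> and lets Fubini convert Levy's
  formula into the integral of a density.\<close>

lemma integral_iexp_Icc: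
  fixes a b t :: real
  assumes "a \<le> b" "t \<noteq> 0"
  shows "(CLBINT x. indicator {a..b} x *\<^sub>R iexp (- (t * x))) = (iexp (- (t * a)) - iexp (- (t * b))) / (\<i> * t)"
proof -
  have "(CLBINT x. indicator {a..b} x *\<^sub>R iexp (- (t * x)))
      = iexp (- (t * b)) / (- \<i> * t) - iexp (- (t * a)) / (- \<i> * t)"
  proof (rule integral_FTC_Icc[OF assms(1)])
    fix x
    have "((\<lambda>x. exp (- (\<i> * t * x)) / (- \<i> * t)) has_vector_derivative exp (- (\<i> * t * x))) (at x within {a..b})"
      using assms by (auto intro!: derivative_eq_intros has_vector_derivative_real_field)
    then show "((\<lambda>x. iexp (- (t * x)) / (- \<i> * t)) has_vector_derivative iexp (- (t * x))) (at x within {a..b})"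
      by (simp add: mult_ac)
  qed (auto intro!: continuous_intros)
  then show ?thesis using assms by (simp add: field_simps)
qed

abbreviation lborel_density :: "(real \<Rightarrow> real) \<Rightarrow> real measure" where
  "lborel_density f \<equiv> density lborel (\<lambda>x. ennreal (f x))"

text \<open>Inverse Fourier transform, the candidate for the density with characteristic function
  \<open>\<phi>\<close>. Taking \<open>Re\<close> gives a real function before the integral is known
  to be real.\<close>

definition fourier_density :: "(real \<Rightarrow> complex) \<Rightarrow> real \<Rightarrow> real" where
  "fourier_density \<phi> x = Re (CLBINT u. iexp (- (u * x)) * \<phi> u) / (2 * pi)"

lemma continuous_fourier_transform:
  fixes \<phi> :: "real \<Rightarrow> complex"
  assumes \<phi>: "integrable lborel \<phi>"
  shows "continuous_on A (\<lambda>x. CLBINT u. iexp (- (u * x)) * \<phi> u)"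
proof -
  have "isCont (\<lambda>x. CLBINT u. iexp (- (u * x)) * \<phi> u) x" for x
    unfolding continuous_at_sequentially comp_def
  proof safe
    fix X assume X: "X \<longlonglongrightarrow> x"
    have [measurable]: "\<phi> \<in> borel_measurable borel" using \<phi> by auto
    show "(\<lambda>n. CLBINT u. iexp (- (u * X n)) * \<phi> u) \<longlonglongrightarrow> (CLBINT u. iexp (- (u * x)) * \<phi> u)"
      by (rule integral_dominated_convergence[where w="\<lambda>u. norm (\<phi> u)"])
         (use \<phi> in \<open>auto intro!: tendsto_intros X simp: norm_mult\<close>)
  qed
  then show ?thesis
    by (intro continuous_at_imp_continuous_on) auto
qed

lemma continuous_fourier_density:
  assumes "integrable lborel \<phi>"
  shows "continuous_on A (fourier_density \<phi>)"
  unfolding fourier_density_def[abs_def]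
  by (intro continuous_intros continuous_fourier_transform assms) auto

text \<open>The inversion integral is the limit of its Gaussian-damped versions, and each of those
  is an average of normal densities.\<close>

lemma (in real_distribution) fourier_density_nonneg:
  assumes int: "integrable lborel (char M)"
  shows "0 \<le> fourier_density (char M) x"
proof -
  let ?e = "\<lambda>n::nat. 1 / real (Suc n)"
  let ?J = "\<lambda>n. CLBINT u. iexp (- (u * x)) * char M u * exp (- (?e n * u)\<^sup>2 / 2)"
  have "?J \<longlonglongrightarrow> (CLBINT u. iexp (- (u * x)) * char M u)"
  proof (rule integral_dominated_convergence[where w="\<lambda>u. norm (char M u)"])
    show "AE u in lborel. (\<lambda>n. iexp (- (u * x)) * char M u * exp (- (?e n * u)\<^sup>2 / 2)) \<longlonglongrightarrow> iexp (- (u * x)) * char M u"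
    proof (rule AE_I2)
      fix u
      have "?e \<longlonglongrightarrow> 0" by (rule LIMSEQ_Suc) (rule lim_1_over_n)
      then have "(\<lambda>n. iexp (- (u * x)) * char M u * exp (- (?e n * u)\<^sup>2 / 2)) \<longlonglongrightarrow> iexp (- (u * x)) * char M u * exp (- (0 * u)\<^sup>2 / 2)"
        by (intro tendsto_intros) auto
      then show "(\<lambda>n. iexp (- (u * x)) * char M u * exp (- (?e n * u)\<^sup>2 / 2)) \<longlonglongrightarrow> iexp (- (u * x)) * char M u"
        by simp
    qed
    show "AE u in lborel. norm (iexp (- (u * x)) * char M u * exp (- (?e n * u)\<^sup>2 / 2)) \<le> norm (char M u)" for n
      by (rule AE_I2) (auto simp: norm_mult intro!: mult_left_le)
  qed (use int in auto)
  then have "(\<lambda>n. Re (?J n)) \<longlonglongrightarrow> Re (CLBINT u. iexp (- (u * x)) * char M u)"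
    by (rule tendsto_Re)
  moreover have "0 \<le> Re (?J n)" for n
    by (subst fourier_gaussian_char) (auto simp: Bochner_Integration.integral_nonneg)
  ultimately have "0 \<le> Re (CLBINT u. iexp (- (u * x)) * char M u)"
    by (intro LIMSEQ_le_const) auto
  then show ?thesis by (simp add: fourier_density_def)
qed

text \<open>Levy's formula, valid at endpoints without mass, gives the measure of an interval as a
  limit of truncated integrals. Integrability of \<open>char M\<close> removes the truncation,
  Fubini exposes the density, and half-open intervals generate the Borel sets.\<close>

theorem (in real_distribution) fourier_inversion:
  assumes int: "integrable lborel (char M)"
    and atoms: "\<And>x. measure M {x} = 0"
  shows "M = density lborel (\<lambda>x. ennreal (fourier_density (char M) x))"
proof -
  let ?f = "fourier_density (char M)"
  have nn: "0 \<le> ?f x" for x by (rule fourier_density_nonneg[OF int])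
  note cont = continuous_fourier_density[OF int]
  have [measurable]: "?f \<in> borel_measurable borel"
    using cont by (rule borel_measurable_continuous_onI)
  have Ioc: "measure M {a<..b} = (LBINT x. indicator {a..b} x *\<^sub>R ?f x)" if ab: "a \<le> b" for a b
  proof -
    define F where "F = (\<lambda>t::real. (iexp (-(t * a)) - iexp (-(t * b))) / (\<i> * t))"
    have F: "norm (F t) \<le> b - a" for t
    proof (cases "t = 0")
      case False
      then have "norm (F t) = norm (CLBINT x. indicator {a..b} x *\<^sub>R iexp (- (t * x)))"
        using integral_iexp_Icc[OF ab] by (simp add: F_def)
      also have "\<dots> \<le> (LBINT x. norm (indicator {a..b} x *\<^sub>R iexp (- (t * x))))"
        by (rule integral_norm_bound)
      also have "\<dots> = b - a" using ab by simp
      finally show ?thesis .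
    qed (use ab in \<open>auto simp: F_def\<close>)
    have [measurable]: "F \<in> borel_measurable borel" unfolding F_def by measurable
    have bound: "integrable lborel (\<lambda>t. (b - a) * norm (char M t))" using int by auto
    have "(\<lambda>T::nat. CLBINT t. indicator {-T<..<T} t *\<^sub>R (F t * char M t)) \<longlonglongrightarrow> (CLBINT t. F t * char M t)"
    proof (rule integral_dominated_convergence[OF _ _ bound])
      show "AE t in lborel. (\<lambda>T::nat. indicator {-T<..<T} t *\<^sub>R (F t * char M t)) \<longlonglongrightarrow> F t * char M t"
      proof (rule AE_I2)
        fix t :: real
        obtain n :: nat where n: "\<bar>t\<bar> < n" using reals_Archimedean2 by blast
        have "\<forall>\<^sub>F T::nat in sequentially. indicator {-T<..<T} t *\<^sub>R (F t * char M t) = F t * char M t"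
          using eventually_ge_at_top[of n] by eventually_elim (use n in \<open>auto simp: indicator_def\<close>)
        then show "(\<lambda>T::nat. indicator {-T<..<T} t *\<^sub>R (F t * char M t)) \<longlonglongrightarrow> F t * char M t"
          by (rule tendsto_eventually)
      qed
      show "AE t in lborel. norm (indicator {-real T<..<real T} t *\<^sub>R (F t * char M t)) \<le> (b - a) * norm (char M t)" for T :: nat
        using F ab by (auto simp: norm_mult indicator_def intro!: AE_I2 mult_right_mono)
    qed measurable
    moreover have "(CLBINT t=-real T..real T. F t * char M t) = (CLBINT t. indicator {-real T<..<real T} t *\<^sub>R (F t * char M t))" for T :: nat
      by (simp add: interval_lebesgue_integral_def set_lebesgue_integral_def)
    ultimately have "(\<lambda>T::nat. 1 / (2 * pi) * (CLBINT t=-real T..real T. F t * char M t)) \<longlonglongrightarrow> 1 / (2 * pi) * (CLBINT t. F t * char M t)"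
      by (intro tendsto_intros) simp
    moreover have "(\<lambda>T::nat. 1 / (2 * pi) * (CLBINT t=-real T..real T. F t * char M t)) \<longlonglongrightarrow> measure M {a<..b}"
      using Levy_Inversion[OF ab atoms atoms] by (simp add: F_def)
    ultimately have eq: "complex_of_real (measure M {a<..b}) = 1 / (2 * pi) * (CLBINT t. F t * char M t)"
      by (intro LIMSEQ_unique)
    let ?G = "\<lambda>t x. indicator {a..b} x *\<^sub>R (iexp (- (t * x)) * char M t)"
    have inn: "(CLBINT x. ?G t x) = (CLBINT x. indicator {a..b} x *\<^sub>R iexp (- (t * x))) * char M t" for t
      by (subst integral_mult_left_zero[symmetric]) simp
    let ?c = "\<lambda>x. CLBINT t. iexp (- (t * x)) * char M t"
    have "(CLBINT t. F t * char M t) = (CLBINT t. CLBINT x. ?G t x)"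
    \<comment> \<open>The integrands may differ at \<open>t = 0\<close>: there division by zero
      gives \<open>F\<close> the value \<open>0\<close>, while the interval integral is
      \<open>b - a\<close>.\<close>
    proof (rule integral_cong_AE)
      show "AE t in lborel. F t * char M t = (CLBINT x. ?G t x)"
        using AE_lborel_singleton[of 0]
      proof eventually_elim
        case (elim t)
        show ?case unfolding inn integral_iexp_Icc[OF ab elim] F_def ..
      qed
    qed (measurable)
    also have "\<dots> = (CLBINT x. CLBINT t. ?G t x)"
    proof (rule lborel_pair.Fubini_integral[symmetric], rule lborel_pair.Fubini_integrable)
      show "integrable lborel (\<lambda>t. \<integral>x. norm (case (t, x) of (t, x) \<Rightarrow> ?G t x) \<partial>lborel)"
        using int ab by (simp add: norm_mult)
      have "integrable lborel (\<lambda>x. ?G t x)" for t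
      proof -
        have "integrable lborel (\<lambda>x. indicator {a..b} x *\<^sub>R (iexp (- (t * x)) * char M t))"
          by (intro borel_integrable_compact) (auto intro!: continuous_intros)
        then show ?thesis .
      qed
      then show "AE t in lborel. integrable lborel (\<lambda>x. case (t, x) of (t, x) \<Rightarrow> ?G t x)"
        by simp
    qed measurable
    also have "\<dots> = (CLBINT x. indicator {a..b} x *\<^sub>R ?c x)"
      by simp
    finally have "complex_of_real (measure M {a<..b})
        = complex_of_real (1 / (2 * pi)) * (CLBINT x. indicator {a..b} x *\<^sub>R ?c x)"
      unfolding eq by simp
    from arg_cong[OF this, of Re] have "measure M {a<..b}
        = Re (complex_of_real (1 / (2 * pi)) * (CLBINT x. indicator {a..b} x *\<^sub>R ?c x))"
      by (simp only: Re_complex_of_real)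
    also have "\<dots> = Re (CLBINT x. indicator {a..b} x *\<^sub>R ?c x) / (2 * pi)"
      unfolding times_complex.simps by simp
    also have "Re (CLBINT x. indicator {a..b} x *\<^sub>R ?c x)
       = (LBINT x. indicator {a..b} x *\<^sub>R Re (?c x))"
    proof (subst integral_Re[symmetric])
      show "integrable lborel (\<lambda>x. indicator {a..b} x *\<^sub>R ?c x)"
        by (intro borel_integrable_compact continuous_fourier_transform[OF int]) simp
    qed simp
    also have "\<dots> / (2 * pi) = (LBINT x. indicator {a..b} x *\<^sub>R ?f x)"
      unfolding fourier_density_def by (simp add: integral_divide_zero[symmetric] del: integral_divide_zero)
    finally show ?thesis .
  qed
  have em: "emeasure M {a<..b} = emeasure (density lborel ?f) {a<..b}" for a b
  proof (cases "a \<le> b")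
    case True
    have "integrable lborel (\<lambda>x. indicator {a..b} x *\<^sub>R ?f x)"
      by (rule borel_integrable_compact) (auto intro: cont)
    then have "ennreal (LBINT x. indicator {a..b} x *\<^sub>R ?f x) = (\<integral>\<^sup>+x. indicator {a..b} x *\<^sub>R ?f x \<partial>lborel)"
      by (intro nn_integral_eq_integral[symmetric]) (auto simp: nn)
    also have "\<dots> = emeasure (density lborel ?f) {a<..b}"
      by (subst emeasure_density, simp, simp, rule nn_integral_cong_AE, use AE_lborel_singleton[of a] in eventually_elim)
         (auto simp: indicator_def)
    finally show ?thesis using Ioc[OF True] by (simp add: emeasure_eq_measure)
  qed simp
  show ?thesis
  proof (rule measure_eqI_generator_eq[where \<Omega>=UNIV and E="range (\<lambda>(a, b). {a<..b::real})" and A="\<lambda>n::nat. {- real n <.. real n}"])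
    show "Int_stable (range (\<lambda>(a, b). {a<..b::real}))"
    proof (rule Int_stableI)
      fix A B assume "A \<in> range (\<lambda>(a, b). {a<..b::real})" "B \<in> range (\<lambda>(a, b). {a<..b::real})"
      then obtain a b c d where "A = {a<..b}" "B = {c<..d}" by auto
      then have "A \<inter> B = (\<lambda>(a, b). {a<..b}) (max a c, min b d)" by auto
      then show "A \<inter> B \<in> range (\<lambda>(a, b). {a<..b::real})" by (rule range_eqI)
    qed
    show "sets M = sigma_sets UNIV (range (\<lambda>(a, b). {a<..b::real}))"
      by (simp add: borel_sigma_sets_Ioc)
    then show "sets (density lborel ?f) = sigma_sets UNIV (range (\<lambda>(a, b). {a<..b::real}))"
      by simp
    show "(\<Union>n::nat. {- real n <.. real n}) = UNIV"
    proof (auto)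
      fix x :: real
      obtain n :: nat where "\<bar>x\<bar> < n" using reals_Archimedean2 by blast
      then show "\<exists>n::nat. - real n < x \<and> x \<le> real n" by (intro exI[of _ n]) auto
    qed
    show "emeasure M {- real n <.. real n} \<noteq> \<infinity>" for n :: nat by simp
    show "emeasure M X = emeasure (density lborel ?f) X" if "X \<in> range (\<lambda>(a, b). {a<..b::real})" for X
      using that em by auto
  qed auto
qed

text \<open>Symmetrization: the difference of two independent copies has a nonnegative
  characteristic function, so integrals of \<open>|char M|^2\<close> can be controlled through a
  probability law.\<close>

lemma (in real_distribution) char_difference:
  "char (distr (M \<Otimes>\<^sub>M M) borel (\<lambda>(x, y). x - y)) u = of_real ((norm (char M u))\<^sup>2)"
proof -
  interpret P: pair_prob_space M M ..
  have "char (distr (M \<Otimes>\<^sub>M M) borel (\<lambda>(x, y). x - y)) u = (CLINT w | (M \<Otimes>\<^sub>M M). iexp (u * fst w) * iexp (- u * snd w))"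
    unfolding char_def by (subst integral_distr) (auto simp: split_beta algebra_simps exp_diff exp_minus field_simps)
  also have "\<dots> = (CLINT x | M. (CLINT y | M. iexp (u * x) * iexp (- u * y)))"
  proof (subst P.integral_fst'[symmetric])
    show "integrable (M \<Otimes>\<^sub>M M) (\<lambda>w. iexp (u * fst w) * iexp (- u * snd w))"
      by (rule P.integrable_const_bound[of _ 1]) (auto simp: norm_mult)
  qed simp
  also have "\<dots> = char M u * char M (- u)"
    unfolding char_def by simp
  also have "char M (- u) = cnj (char M u)"
    unfolding char_def by (simp add: exp_cnj flip: Bochner_Integration.integral_cnj)
  finally show ?thesis by (simp only: complex_norm_square)
qed

text \<open>One half of Plancherel's identity. Gaussian-smoothed inversion at \<open>0\<close>,
  applied to the difference of two independent copies, expresses the damped integral as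
  \<open>2 * pi\<close> times an expected normal density; this is at most \<open>2 * pi * C\<close>,
  because one copy can be integrated first against a density bounded by \<open>C\<close>. Fatou's
  lemma then removes the damping.\<close>

lemma
  fixes f :: "real \<Rightarrow> real"
  assumes D: "real_distribution (lborel_density f)"
    and [measurable]: "f \<in> borel_measurable borel"
    and f: "\<And>x. 0 \<le> f x" "\<And>x. f x \<le> C"
  defines "\<phi> \<equiv> char (lborel_density f)"
  shows integrable_norm_char_square: "integrable lborel (\<lambda>u. (norm (\<phi> u))\<^sup>2)"
    and integral_norm_char_square_le: "(\<integral>u. (norm (\<phi> u))\<^sup>2 \<partial>lborel) \<le> 2 * pi * C"
proof -
  let ?M = "lborel_density f"
  interpret real_distribution ?M by fact
  interpret P: pair_prob_space ?M ?M ..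
  let ?N = "distr (?M \<Otimes>\<^sub>M ?M) borel (\<lambda>(x, y). x - y)"
  interpret N: real_distribution ?N
    by (intro real_distribution.intro real_distribution_axioms.intro P.prob_space_distr) auto
  let ?e = "\<lambda>n::nat. 1 / real (Suc n)"
  let ?g = "\<lambda>n u. (norm (\<phi> u))\<^sup>2 * exp (- (?e n * u)\<^sup>2 / 2)"
  have [measurable]: "\<phi> \<in> borel_measurable borel" unfolding \<phi>_def by measurable
  have "norm (\<phi> u) \<le> 1" for u unfolding \<phi>_def by (rule cmod_char_le_1)
  then have \<phi>1: "(norm (\<phi> u))\<^sup>2 \<le> 1" for u by (simp add: power_le_one)
  have ig: "integrable lborel (?g n)" for n
    by (rule Bochner_Integration.integrable_bound[OF integrable_gaussian[of "?e n"]])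
       (auto simp: \<phi>1 intro!: mult_left_le_one_le)
  have le: "(\<integral>u. ?g n u \<partial>lborel) \<le> 2 * pi * C" for n
  proof -
    have "(\<integral>z. normal_density 0 (?e n) z \<partial>?N) = (\<integral>w. normal_density 0 (?e n) (fst w - snd w) \<partial>(?M \<Otimes>\<^sub>M ?M))"
      by (subst integral_distr) (auto simp: split_beta)
    also have "\<dots> = (\<integral>y. (\<integral>x. normal_density 0 (?e n) (x - y) \<partial>?M) \<partial>?M)"
    proof -
      have "integrable (?M \<Otimes>\<^sub>M ?M) (\<lambda>(x, y). normal_density 0 (?e n) (x - y))"
        by (rule P.integrable_const_bound[of _ "1 / sqrt (2 * pi * (?e n)\<^sup>2)"])
           (auto simp: normal_density_def intro!: AE_I2 divide_right_mono)
      from P.integral_snd[OF this] show ?thesis by (simp add: case_prod_unfold)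
    qed
    also have "\<dots> \<le> (\<integral>y. C \<partial>?M)"
    proof (rule integral_mono')
      fix y
      have "(\<integral>x. normal_density 0 (?e n) (x - y) \<partial>?M) = (\<integral>x. f x * normal_density 0 (?e n) (x - y) \<partial>lborel)"
        by (subst integral_density) (auto simp: f)
      also have "\<dots> \<le> (\<integral>x. C * normal_density y (?e n) x \<partial>lborel)"
      proof (rule integral_mono')
        show "integrable lborel (\<lambda>x. C * normal_density y (?e n) x)" by (auto intro!: integrable_normal_density)
        show "f x * normal_density 0 (?e n) (x - y) \<le> C * normal_density y (?e n) x" for x
          using f(2)[of x] by (auto simp: normal_density_def intro!: divide_right_mono mult_right_mono)
        show "0 \<le> C * normal_density y (?e n) x" for x
          using f(1)[of x] f(2)[of x] by auto
      qed
      also have "\<dots> = C" by (subst integral_mult_right_zero) (simp add: integral_normal_density)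
      finally show "(\<integral>x. normal_density 0 (?e n) (x - y) \<partial>?M) \<le> C" .
      show "0 \<le> C" using f(1)[of 0] f(2)[of 0] by auto
    qed simp
    also have "\<dots> = C" using prob_space by simp
    finally have "(\<integral>z. normal_density 0 (?e n) z \<partial>?N) \<le> C" .
    moreover have "(CLBINT u. char ?N u * exp (- (?e n * u)\<^sup>2 / 2)) = of_real (\<integral>u. ?g n u \<partial>lborel)"
      unfolding char_difference \<phi>_def by (subst integral_complex_of_real[symmetric]) simp
    ultimately show ?thesis
      using N.fourier_gaussian_char[of "?e n" 0] by (simp flip: of_real_mult)
  qed
  have mono: "mono (\<lambda>n. ?g n u)" for u
    by (auto simp: mono_iff_le_Suc power_divide intro!: mult_left_mono divide_left_mono power_mono)
  have lim: "(\<lambda>n. ?g n u) \<longlonglongrightarrow> (norm (\<phi> u))\<^sup>2" for u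
  proof -
    have "?e \<longlonglongrightarrow> 0" by (rule LIMSEQ_Suc) (rule lim_1_over_n)
    then have "(\<lambda>n. ?g n u) \<longlonglongrightarrow> (norm (\<phi> u))\<^sup>2 * exp (- (0 * u)\<^sup>2 / 2)"
      by (intro tendsto_intros) auto
    then show ?thesis by simp
  qed
  have "(\<integral>\<^sup>+u. (norm (\<phi> u))\<^sup>2 \<partial>lborel) = (\<integral>\<^sup>+u. liminf (\<lambda>n. ennreal (?g n u)) \<partial>lborel)"
    by (intro nn_integral_cong lim_imp_Liminf[symmetric] tendsto_ennrealI lim) simp
  also have "\<dots> \<le> liminf (\<lambda>n. \<integral>\<^sup>+u. ?g n u \<partial>lborel)"
    by (rule nn_integral_liminf) measurable
  also have "\<dots> \<le> liminf (\<lambda>n::nat. ennreal (2 * pi * C))"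
    using le ig by (intro Liminf_mono eventuallyI) (auto simp: nn_integral_eq_integral ennreal_leI)
  also have "\<dots> = ennreal (2 * pi * C)" by (simp add: Liminf_const)
  finally have fin: "(\<integral>\<^sup>+u. (norm (\<phi> u))\<^sup>2 \<partial>lborel) \<le> ennreal (2 * pi * C)" .
  show i: "integrable lborel (\<lambda>u. (norm (\<phi> u))\<^sup>2)"
    by (rule integrableI_bounded) (use fin in \<open>auto simp: less_top[symmetric] top_unique\<close>)
  have "0 \<le> C" using f(1)[of 0] f(2)[of 0] by auto
  then show "(\<integral>u. (norm (\<phi> u))\<^sup>2 \<partial>lborel) \<le> 2 * pi * C"
    using fin i by (subst (asm) nn_integral_eq_integral) auto
qed

section \<open>A local limit theorem with quantitative error\<close>

text \<open>Factoring out \<open>a - b\<close> leaves \<open>n\<close> products of modulus at most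
  \<open>r ^ (n - 1)\<close>. A small common bound \<open>r\<close> keeps the decay of the powers,
  which a plain factor \<open>n\<close> would lose.\<close>

lemma norm_power_diff_le:
  fixes a b :: complex
  assumes "norm a \<le> r" "norm b \<le> r"
  shows "norm (a ^ n - b ^ n) \<le> real n * r ^ (n - 1) * norm (a - b)"
proof (cases n)
  case (Suc m)
  have r: "0 \<le> r" using assms norm_ge_zero order_trans by blast
  have "norm (a ^ n - b ^ n) = norm (a - b) * norm (\<Sum>i<n. b ^ (n - Suc i) * a ^ i)"
    by (simp add: power_diff_sumr2 norm_mult)
  moreover have "norm (\<Sum>i<n. b ^ (n - Suc i) * a ^ i) \<le> (\<Sum>i<n. r ^ (n - 1))"
  proof (rule sum_norm_le)
    fix i assume "i \<in> {..<n}"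
    then have "r ^ (n - Suc i) * r ^ i = r ^ (n - 1)" by (simp flip: power_add)
    moreover have "norm (b ^ (n - Suc i) * a ^ i) \<le> r ^ (n - Suc i) * r ^ i"
      using assms r by (auto simp: norm_mult norm_power intro!: mult_mono power_mono)
    ultimately show "norm (b ^ (n - Suc i) * a ^ i) \<le> r ^ (n - 1)" by simp
  qed
  ultimately have "norm (a ^ n - b ^ n) \<le> norm (a - b) * (\<Sum>i<n. r ^ (n - 1))"
    by (simp add: mult_left_mono)
  then show ?thesis by (simp add: mult_ac)
qed simp

text \<open>Since \<open>f\<close> has the same moments of order at most \<open>2\<close> as the normal density, the Taylor
  polynomial of order \<open>2\<close> of \<open>iexp\<close> cancels in the difference of the characteristic functions.\<close>

lemma
  fixes f :: "real \<Rightarrow> real"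
  assumes [measurable]: "f \<in> borel_measurable borel" and f: "\<And>x. 0 \<le> f x"
    and f0: "has_bochner_integral lborel f 1"
    and f1: "has_bochner_integral lborel (\<lambda>x. f x * x) 0"
    and f2: "has_bochner_integral lborel (\<lambda>x. f x * x\<^sup>2) 1"
    and int: "integrable lborel (\<lambda>x. (1 + \<bar>x\<bar> ^ 3) * \<bar>f x - std_normal_density x\<bar>)"
  defines "\<kappa> \<equiv> \<integral>x. (1 + \<bar>x\<bar> ^ 3) * \<bar>f x - std_normal_density x\<bar> \<partial>lborel"
  shows char_diff_normal_le: "norm (char (lborel_density f) v - exp (- v\<^sup>2 / 2)) \<le> \<kappa>"
    and char_diff_normal_le_cube: "norm (char (lborel_density f) v - exp (- v\<^sup>2 / 2)) \<le> \<kappa> * \<bar>v\<bar> ^ 3"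
proof -
  let ?d = "\<lambda>x. f x - std_normal_density x"
  have d0: "has_bochner_integral lborel ?d 0"
    using has_bochner_integral_diff[OF f0 std_normal_moment_even[of 0]] by simp
  have d1: "has_bochner_integral lborel (\<lambda>x. ?d x * x) 0"
    using has_bochner_integral_diff[OF f1 std_normal_moment_odd[of 0]] by (simp add: algebra_simps)
  have d2: "has_bochner_integral lborel (\<lambda>x. ?d x * x\<^sup>2) 0"
    using has_bochner_integral_diff[OF f2 std_normal_moment_even[of 1]] by (simp add: left_diff_distrib)
  have ig: "integrable lborel (\<lambda>x. g x *\<^sub>R iexp (v * x))" if "integrable lborel g" for g :: "real \<Rightarrow> real"
    by (rule Bochner_Integration.integrable_bound[OF that]) (use that in auto)
  have eq: "char (lborel_density f) v - exp (- v\<^sup>2 / 2) = (CLBINT x. ?d x *\<^sub>R iexp (v * x))"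
  proof -
    have "char (lborel_density f) v = (CLBINT x. f x *\<^sub>R iexp (v * x))"
      unfolding char_def using f by (subst integral_density) auto
    moreover have "complex_of_real (exp (- v\<^sup>2 / 2)) = (CLBINT x. std_normal_density x *\<^sub>R iexp (v * x))"
      unfolding char_std_normal_distribution[THEN fun_cong, of v, symmetric]
      unfolding char_def by (subst integral_density) auto
    ultimately show ?thesis
      using Bochner_Integration.integral_diff[OF ig[of f] ig[of std_normal_density]] f0
      by (simp only: scaleR_diff_left has_bochner_integral_iff integrable_normal_density zero_less_one)
  qed
  have id: "integrable lborel (\<lambda>x. ?d x *\<^sub>R iexp (v * x))" using d0 by (intro ig) (simp add: has_bochner_integral_iff)
  \<comment> \<open>The two terms of the weight serve the two bounds:
    \<open>\<bar>x\<bar> ^ 3\<close> absorbs the Taylor remainder, which matters for small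
    \<open>v\<close>, and \<open>1\<close> the trivial estimate, which matters for large
    \<open>v\<close>.\<close>
  have cub: "\<bar>x\<bar> ^ 3 * \<bar>?d x\<bar> \<le> (1 + \<bar>x\<bar> ^ 3) * \<bar>?d x\<bar>" "\<bar>?d x\<bar> \<le> (1 + \<bar>x\<bar> ^ 3) * \<bar>?d x\<bar>" for x
    by (auto simp: algebra_simps)
  show "norm (char (lborel_density f) v - exp (- v\<^sup>2 / 2)) \<le> \<kappa>"
    unfolding eq \<kappa>_def by (intro Bochner_Integration.integral_norm_bound_integral id int) (use cub(2) in auto)
  let ?T = "\<lambda>x. (\<Sum>k\<le>2. (\<i> * complex_of_real (v * x)) ^ k / fact k)"
  have "has_bochner_integral lborel (\<lambda>x. complex_of_real (?d x) + (\<i> * v) * complex_of_real (?d x * x) - (v\<^sup>2 / 2) * complex_of_real (?d x * x\<^sup>2)) (complex_of_real 0 + (\<i> * v) * complex_of_real 0 - complex_of_real (v\<^sup>2 / 2) * complex_of_real 0)"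
    by (intro has_bochner_integral_add has_bochner_integral_diff has_bochner_integral_mult_right has_bochner_integral_of_real d0 d1 d2)
  also have "(\<lambda>x. complex_of_real (?d x) + (\<i> * v) * complex_of_real (?d x * x) - (v\<^sup>2 / 2) * complex_of_real (?d x * x\<^sup>2)) = (\<lambda>x. ?d x *\<^sub>R ?T x)"
    by (auto simp: fun_eq_iff numeral_2_eq_2 scaleR_conv_of_real power2_eq_square field_simps)
  finally have T: "has_bochner_integral lborel (\<lambda>x. ?d x *\<^sub>R ?T x) 0" by simp
  have "norm (CLBINT x. ?d x *\<^sub>R iexp (v * x)) = norm (CLBINT x. ?d x *\<^sub>R iexp (v * x) - ?d x *\<^sub>R ?T x)"
    using T id by (simp add: Bochner_Integration.integral_diff has_bochner_integral_iff)
  also have "\<dots> \<le> (\<integral>x. (1 + \<bar>x\<bar> ^ 3) * \<bar>?d x\<bar> * \<bar>v\<bar> ^ 3 \<partial>lborel)"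
  proof (intro Bochner_Integration.integral_norm_bound_integral)
    fix x
    have "norm (?d x *\<^sub>R iexp (v * x) - ?d x *\<^sub>R ?T x) = \<bar>?d x\<bar> * norm (iexp (v * x) - ?T x)"
      by (simp only: scaleR_diff_right[symmetric] norm_scaleR)
    also have "\<dots> \<le> \<bar>?d x\<bar> * (\<bar>v * x\<bar> ^ 3 / 6)"
      using iexp_approx1[of "v * x" 2] by (intro mult_left_mono) (auto simp: numeral_eq_Suc)
    also have "\<dots> \<le> \<bar>?d x\<bar> * (\<bar>v * x\<bar> ^ 3)"
      by (intro mult_left_mono) auto
    also have "\<dots> \<le> (1 + \<bar>x\<bar> ^ 3) * \<bar>?d x\<bar> * \<bar>v\<bar> ^ 3"
      using mult_right_mono[OF cub(1)[of x], of "\<bar>v\<bar> ^ 3"] by (simp add: abs_mult power_mult_distrib mult_ac)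
    finally show "norm (?d x *\<^sub>R iexp (v * x) - ?d x *\<^sub>R ?T x) \<le> (1 + \<bar>x\<bar> ^ 3) * \<bar>?d x\<bar> * \<bar>v\<bar> ^ 3" .
  next
    show "integrable lborel (\<lambda>x. ?d x *\<^sub>R iexp (v * x) - ?d x *\<^sub>R ?T x)"
      by (intro Bochner_Integration.integrable_diff id integrable.intros[OF T])
    show "integrable lborel (\<lambda>x. (1 + \<bar>x\<bar> ^ 3) * \<bar>?d x\<bar> * \<bar>v\<bar> ^ 3)"
      by (intro integrable_mult_left int)
  qed
  finally show "norm (char (lborel_density f) v - exp (- v\<^sup>2 / 2)) \<le> \<kappa> * \<bar>v\<bar> ^ 3"
    unfolding eq \<kappa>_def integral_mult_left_zero .
qed

lemma integrable_cube_gaussian: "integrable lborel (\<lambda>w::real. \<bar>w\<bar> ^ 3 * exp (- w\<^sup>2 / 8))"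
proof -
  have "integrable lborel (\<lambda>w. sqrt (2 * pi * 2\<^sup>2) * (normal_density 0 2 w * \<bar>w - 0\<bar> ^ 3))"
    by (intro integrable_mult_right integrable_normal_moment_abs) simp
  then show ?thesis by (simp add: normal_density_def mult_ac)
qed

text \<open>What remains of the error over \<open>\<bar>v\<bar> \<le> 1\<close> after rescaling by
  \<open>sqrt N\<close>: the cube comes from the cubic bound on the difference of characteristic
  functions, and \<open>exp (- w^2 / 8)\<close> from the factor \<open>exp (- v^2 / 4)\<close>
  raised to a power of at least \<open>N / 2\<close>.\<close>

definition cube_gaussian :: real where
  "cube_gaussian = (\<integral>w. \<bar>w\<bar> ^ 3 * exp (- w\<^sup>2 / 8) \<partial>lborel)"

text \<open>Both densities are Fourier integrals of \<open>N\<close>-th powers, so their distance is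
  at most the integrated distance of the powers. For \<open>\<bar>v\<bar> \<le> 1\<close> both bases
  are at most \<open>exp (- v^2 / 4)\<close> in modulus and differ by
  \<open>\<kappa> * \<bar>v\<bar> ^ 3\<close>; rescaling yields the order
  \<open>\<kappa> * N / N^2\<close>. For \<open>\<bar>v\<bar> > 1\<close> both are at most
  \<open>3 / 4\<close>; two factors are kept for integrability, which brings in the bound
  \<open>C\<close>.\<close>

theorem local_limit_error:
  fixes f :: "real \<Rightarrow> real"
  assumes [measurable]: "f \<in> borel_measurable borel" and f: "\<And>x. 0 \<le> f x" "\<And>x. f x \<le> C"
    and f0: "has_bochner_integral lborel f 1"
    and f1: "has_bochner_integral lborel (\<lambda>x. f x * x) 0"
    and f2: "has_bochner_integral lborel (\<lambda>x. f x * x\<^sup>2) 1"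
    and int: "integrable lborel (\<lambda>x. (1 + \<bar>x\<bar> ^ 3) * \<bar>f x - std_normal_density x\<bar>)"
    and \<kappa>: "(\<integral>x. (1 + \<bar>x\<bar> ^ 3) * \<bar>f x - std_normal_density x\<bar> \<partial>lborel) = \<kappa>" "\<kappa> \<le> 1 / 8"
    and N: "N \<ge> 2"
  defines "\<phi> \<equiv> char (lborel_density f)"
  shows "\<bar>fourier_density (\<lambda>v. \<phi> v ^ N) y - normal_density 0 (sqrt N) y\<bar>
      \<le> \<kappa> * cube_gaussian / N + (3 / 4) ^ (N - 2) * (C + 1)"
proof -
  let ?M = "lborel_density f"
  have D: "real_distribution ?M"
  proof (intro real_distribution.intro real_distribution_axioms.intro prob_spaceI)
    show "emeasure ?M (space ?M) = 1"
      using f0 f by (simp add: emeasure_density nn_integral_eq_integral has_bochner_integral_iff)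
  qed simp
  interpret real_distribution ?M by fact
  have [measurable]: "\<phi> \<in> borel_measurable borel" unfolding \<phi>_def by measurable
  have \<phi>1: "norm (\<phi> v) \<le> 1" for v unfolding \<phi>_def by (rule cmod_char_le_1)
  have sq: "integrable lborel (\<lambda>v. (norm (\<phi> v))\<^sup>2)" "(\<integral>v. (norm (\<phi> v))\<^sup>2 \<partial>lborel) \<le> 2 * pi * C"
    unfolding \<phi>_def using integrable_norm_char_square[OF D] integral_norm_char_square_le[OF D] f by auto
  have int_pow: "integrable lborel (\<lambda>v. \<phi> v ^ N)"
    by (rule Bochner_Integration.integrable_bound[OF sq(1)])
       (use N \<phi>1 in \<open>auto simp: norm_power power_decreasing\<close>)
  define b :: "real \<Rightarrow> real" where "b v = exp (- v\<^sup>2 / 2)" for v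
  have d1: "norm (\<phi> v - b v) \<le> \<kappa>" and d3: "norm (\<phi> v - b v) \<le> \<kappa> * \<bar>v\<bar> ^ 3" for v
    using char_diff_normal_le[OF _ f(1) f0 f1 f2 int, of v] char_diff_normal_le_cube[OF _ f(1) f0 f1 f2 int, of v] \<kappa>
    by (auto simp: \<phi>_def b_def)
  have \<kappa>0: "0 \<le> \<kappa>" using d1 norm_ge_zero order_trans by blast
  have \<phi>le: "norm (\<phi> v) \<le> b v + norm (\<phi> v - b v)" for v
    using norm_triangle_sub[of "\<phi> v" "b v"] by (simp add: b_def)
  let ?h = "\<lambda>v. \<kappa> * N * (\<bar>v\<bar> ^ 3 * exp (- (sqrt N * v)\<^sup>2 / 8)) + (3 / 4) ^ (N - 2) * ((norm (\<phi> v))\<^sup>2 + exp (- (sqrt 2 * v)\<^sup>2 / 2))"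
  have pw: "norm (\<phi> v ^ N - b v ^ N) \<le> ?h v" for v
  proof (cases "\<bar>v\<bar> \<le> 1")
    case True
    \<comment> \<open>Half of the normal exponent: \<open>b v = exp (- 2 * w)\<close>, and the gap
      up to \<open>exp (- w)\<close> has to absorb the error
      \<open>\<kappa> * \<bar>v\<bar> ^ 3\<close>. This error is at most \<open>w / 2\<close>, and
      the gap is at least \<open>(1 - 2 * w) * w\<close>; these fit since
      \<open>w \<le> 1 / 4\<close>.\<close>
    define w where "w = v\<^sup>2 / 4"
    have w: "0 \<le> w" "w \<le> 1 / 4" using True by (auto simp: w_def abs_square_le_1)
    have "\<kappa> * \<bar>v\<bar> ^ 3 \<le> 1 / 8 * v\<^sup>2"
    proof (rule mult_mono)
      have "\<bar>v\<bar> ^ 3 \<le> \<bar>v\<bar> ^ 2" using True by (intro power_decreasing) auto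
      then show "\<bar>v\<bar> ^ 3 \<le> v\<^sup>2" by simp
    qed (use \<kappa> in auto)
    also have "\<dots> = 1 / 2 * w" by (simp add: w_def)
    also have "\<dots> \<le> (1 - 2 * w) * w" using w by (intro mult_right_mono) auto
    also have "\<dots> \<le> exp (- (2 * w)) * (exp w - 1)"
    proof (rule mult_mono)
      show "1 - 2 * w \<le> exp (- (2 * w))" using exp_ge_add_one_self[of "- (2 * w)"] by simp
      show "w \<le> exp w - 1" using exp_ge_add_one_self[of w] by linarith
    qed (use w in auto)
    also have "\<dots> = exp (- w) - b v" by (simp add: right_diff_distrib b_def w_def flip: exp_add)
    finally have "norm (\<phi> v) \<le> exp (- w)" using \<phi>le[of v] d3[of v] by linarith
    moreover have "norm (complex_of_real (b v)) \<le> exp (- w)" using w by (simp add: b_def w_def)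
    ultimately have "norm (\<phi> v ^ N - b v ^ N) \<le> N * exp (- w) ^ (N - 1) * norm (\<phi> v - b v)"
      unfolding of_real_power by (rule norm_power_diff_le)
    also have "\<dots> \<le> N * exp (- (sqrt N * v)\<^sup>2 / 8) * (\<kappa> * \<bar>v\<bar> ^ 3)"
    proof (intro mult_mono d3 mult_left_mono)
      \<comment> \<open>\<open>N - 1 \<ge> N / 2\<close> because \<open>N \<ge> 2\<close>; this is
        where the \<open>8\<close> in the exponent arises.\<close>
      have "real N / 2 * w \<le> real (N - 1) * w" using N w by (intro mult_right_mono) auto
      then show "exp (- w) ^ (N - 1) \<le> exp (- (sqrt N * v)\<^sup>2 / 8)"
        by (simp add: exp_of_nat_mult[symmetric] power_mult_distrib w_def)
    qed auto
    also have "\<dots> \<le> ?h v" by (simp add: mult_ac)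
    finally show ?thesis .
  next
    case False
    then have "1 \<le> v\<^sup>2" by (metis abs_le_square_iff abs_one linorder_linear one_power2)
    \<comment> \<open>From \<open>exp (1 / 2) \<ge> 1 + 1 / 2 + 1 / 8\<close> follows
      \<open>b v \<le> 8 / 13 \<le> 5 / 8\<close>; adding \<open>\<kappa> \<le> 1 / 8\<close> gives
      \<open>3 / 4\<close> for \<open>\<phi>\<close>.\<close>
    then have "b v \<le> exp (- (1 / 2))" by (simp add: b_def)
    also have "exp (- (1 / 2)) \<le> 5 / (8::real)"
      using exp_lower_Taylor_quadratic[of "1 / 2 :: real"] by (simp add: exp_minus field_simps power2_eq_square)
    finally have b58: "b v \<le> 5 / 8" .
    then have \<phi>34: "norm (\<phi> v) \<le> 3 / 4" using \<phi>le[of v] d1[of v] \<kappa>(2) by linarith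
    have p: "r ^ N \<le> (3 / 4) ^ (N - 2) * r\<^sup>2" if "0 \<le> r" "r \<le> 3 / 4" for r :: real
    proof -
      have "r ^ N = r ^ (N - 2) * r\<^sup>2" using N power_add[of r "N - 2" 2] by (simp only: le_add_diff_inverse2)
      also have "\<dots> \<le> (3 / 4) ^ (N - 2) * r\<^sup>2" using that by (intro mult_right_mono power_mono) auto
      finally show ?thesis .
    qed
    have b0: "0 \<le> b v" by (simp add: b_def)
    have "norm (\<phi> v ^ N - b v ^ N) \<le> norm (\<phi> v) ^ N + b v ^ N"
      using norm_triangle_ineq4[of "\<phi> v ^ N" "complex_of_real (b v) ^ N"] b0 by (simp add: norm_power)
    also have "\<dots> \<le> (3 / 4) ^ (N - 2) * ((norm (\<phi> v))\<^sup>2 + (b v)\<^sup>2)"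
      using p[of "norm (\<phi> v)"] p[of "b v"] \<phi>34 b58 b0 by (simp add: distrib_left)
    also have "(b v)\<^sup>2 = exp (- (sqrt 2 * v)\<^sup>2 / 2)"
      by (simp add: b_def power_mult_distrib power2_eq_square flip: exp_add)
    also have "(3 / 4) ^ (N - 2) * ((norm (\<phi> v))\<^sup>2 + exp (- (sqrt 2 * v)\<^sup>2 / 2)) \<le> ?h v"
      using \<kappa>0 by simp
    finally show ?thesis .
  qed
  have N0: "0 < sqrt (real N)" using N by simp
  let ?k = "\<lambda>w::real. \<bar>w\<bar> ^ 3 * exp (- w\<^sup>2 / 8)"
  have ksc: "?k (0 + sqrt N * v) = N * sqrt N * (\<bar>v\<bar> ^ 3 * exp (- (sqrt N * v)\<^sup>2 / 8))" for v
  proof -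
    have "sqrt N ^ 3 = N * sqrt N" by (simp add: power3_eq_cube)
    then show ?thesis using N0 by (simp add: abs_mult power_mult_distrib)
  qed
  have "integrable lborel (\<lambda>v. ?k (0 + sqrt N * v))"
    by (rule lborel_integrable_real_affine[OF integrable_cube_gaussian]) (use N0 in simp)
  then have ik: "integrable lborel (\<lambda>v. \<bar>v\<bar> ^ 3 * exp (- (sqrt N * v)\<^sup>2 / 8))"
    unfolding ksc using N by simp
  have "cube_gaussian = sqrt N * (\<integral>v. ?k (0 + sqrt N * v) \<partial>lborel)"
    unfolding cube_gaussian_def using N0 lborel_integral_real_affine[of "sqrt N" ?k 0] by simp
  also have "\<dots> = N * N * (\<integral>v. \<bar>v\<bar> ^ 3 * exp (- (sqrt N * v)\<^sup>2 / 8) \<partial>lborel)"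
  proof -
    have "sqrt N * (N * sqrt N * I) = (sqrt N * sqrt N) * N * I" for I by (simp only: mult_ac)
    then show ?thesis unfolding ksc by simp
  qed
  finally have kint: "(\<integral>v. \<bar>v\<bar> ^ 3 * exp (- (sqrt N * v)\<^sup>2 / 8) \<partial>lborel) = cube_gaussian / (N * N)"
    using N by (simp add: field_simps)
  \<comment> \<open>A crude bound, chosen so that the division by \<open>2 * pi\<close> in
    \<open>fourier_density\<close> leaves the factor \<open>C + 1\<close>.\<close>
  have g2: "(\<integral>v. exp (- (sqrt 2 * v)\<^sup>2 / 2) \<partial>lborel) \<le> 2 * pi"
  proof -
    have "complex_of_real (\<integral>v. exp (- (sqrt 2 * v)\<^sup>2 / 2) \<partial>lborel) = of_real (2 * pi * normal_density 0 (sqrt 2) 0)"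
      using gaussian_fourier[of "sqrt 2" 0] unfolding integral_complex_of_real[symmetric] by simp
    then have "(\<integral>v. exp (- (sqrt 2 * v)\<^sup>2 / 2) \<partial>lborel) = 2 * pi * normal_density 0 (sqrt 2) 0"
      by (simp only: of_real_eq_iff)
    also have "normal_density 0 (sqrt 2) 0 \<le> 1"
      using pi_ge_two by (simp add: normal_density_def)
    finally show ?thesis by simp
  qed
  have ih: "integrable lborel ?h"
    by (intro Bochner_Integration.integrable_add integrable_mult_right ik sq integrable_gaussian) simp
  have "(\<integral>v. ?h v \<partial>lborel) = \<kappa> * N * (cube_gaussian / (N * N))
      + (3 / 4) ^ (N - 2) * ((\<integral>v. (norm (\<phi> v))\<^sup>2 \<partial>lborel) + (\<integral>v. exp (- (sqrt 2 * v)\<^sup>2 / 2) \<partial>lborel))"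
  proof -
    have g: "integrable lborel (\<lambda>v. exp (- (sqrt 2 * v)\<^sup>2 / 2))" by (rule integrable_gaussian) simp
    show ?thesis
      unfolding kint[symmetric] Bochner_Integration.integral_add[OF sq(1) g, symmetric]
        integral_mult_right_zero[symmetric]
      by (intro Bochner_Integration.integral_add integrable_mult_right Bochner_Integration.integrable_add ik sq g)
  qed
  also have "\<dots> \<le> \<kappa> * N * (cube_gaussian / (N * N)) + (3 / 4) ^ (N - 2) * (2 * pi * C + 2 * pi)"
    using sq g2 by (intro add_left_mono mult_left_mono add_mono) auto
  finally have hle: "(\<integral>v. ?h v \<partial>lborel) \<le> \<kappa> * cube_gaussian / N + (3 / 4) ^ (N - 2) * (2 * pi * C + 2 * pi)"
    using N by simp
  have bN: "b v ^ N = exp (- (sqrt N * v)\<^sup>2 / 2)" for v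
    by (simp add: b_def exp_of_nat_mult[symmetric] power_mult_distrib)
  have ib: "integrable lborel (\<lambda>v. complex_of_real (b v ^ N))"
    unfolding bN by (rule integrable_of_real[OF integrable_gaussian[OF N0]])
  have nd: "normal_density 0 (sqrt N) y = fourier_density (\<lambda>v. complex_of_real (b v ^ N)) y"
    unfolding fourier_density_def bN using gaussian_fourier[OF N0, of "- y"] by (simp add: normal_density_def)
  have in1: "integrable lborel (\<lambda>v. iexp (- (v * y)) * \<phi> v)" if "integrable lborel \<phi>" for \<phi> :: "real \<Rightarrow> complex"
  proof (rule Bochner_Integration.integrable_bound[OF that])
    show "(\<lambda>v. iexp (- (v * y)) * \<phi> v) \<in> borel_measurable lborel"
      using that[THEN borel_measurable_integrable] by measurable
  qed (simp add: norm_mult)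
  have "fourier_density (\<lambda>v. \<phi> v ^ N) y - normal_density 0 (sqrt N) y
      = Re (CLBINT v. iexp (- (v * y)) * (\<phi> v ^ N - complex_of_real (b v ^ N))) / (2 * pi)"
    unfolding nd fourier_density_def
    unfolding right_diff_distrib Bochner_Integration.integral_diff[OF in1[OF int_pow] in1[OF ib]]
      minus_complex.sel diff_divide_distrib ..
  also have "\<bar>\<dots>\<bar> \<le> norm (CLBINT v. iexp (- (v * y)) * (\<phi> v ^ N - complex_of_real (b v ^ N))) / (2 * pi)"
    unfolding abs_divide by (intro frac_le abs_Re_le_cmod) auto
  also have "\<dots> \<le> (\<integral>v. ?h v \<partial>lborel) / (2 * pi)"
  proof (intro divide_right_mono Bochner_Integration.integral_norm_bound_integral ih)
    show "integrable lborel (\<lambda>v. iexp (- (v * y)) * (\<phi> v ^ N - complex_of_real (b v ^ N)))"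
      by (intro in1 Bochner_Integration.integrable_diff int_pow ib)
    show "norm (iexp (- (v * y)) * (\<phi> v ^ N - complex_of_real (b v ^ N))) \<le> ?h v" for v
      using pw[of v] by (simp add: norm_mult)
  qed simp
  also have "\<dots> \<le> (\<kappa> * cube_gaussian / N + (3 / 4) ^ (N - 2) * (2 * pi * C + 2 * pi)) / (2 * pi)"
    by (intro divide_right_mono hle) simp
  also have "\<dots> = \<kappa> * cube_gaussian / N / (2 * pi) + (3 / 4) ^ (N - 2) * (C + 1)"
    by (simp add: field_simps)
  also have "\<dots> \<le> \<kappa> * cube_gaussian / N + (3 / 4) ^ (N - 2) * (C + 1)"
  proof -
    have "0 \<le> \<kappa> * cube_gaussian / N"
      using \<kappa>0 by (simp add: cube_gaussian_def Bochner_Integration.integral_nonneg)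
    then have "\<kappa> * cube_gaussian / N / (2 * pi) \<le> \<kappa> * cube_gaussian / N / 1"
      using pi_ge_two by (intro divide_left_mono) auto
    then show ?thesis by simp
  qed
  finally show "\<bar>fourier_density (\<lambda>v. \<phi> v ^ N) y - normal_density 0 (sqrt N) y\<bar>
      \<le> \<kappa> * cube_gaussian / N + (3 / 4) ^ (N - 2) * (C + 1)" .
qed

section \<open>Sums of tilted variables\<close>

text \<open>An atom at \<open>x\<close> would make the Gaussian-smoothed density at \<open>x\<close>
  at least of order \<open>1 / e\<close>, whereas the damped inversion integral stays below the
  \<open>L^1\<close> norm of the characteristic function as \<open>e\<close> tends to
  \<open>0\<close>.\<close>

lemma (in real_distribution) no_atoms_of_integrable_char:
  assumes int: "integrable lborel (char M)"
  shows "measure M {x} = 0"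
proof -
  define K where "K = (\<integral>u. norm (char M u) \<partial>lborel) * sqrt (2 * pi) / (2 * pi)"
  have le: "measure M {x} \<le> K * e" if e: "e > 0" for e
  proof -
    have 1: "integrable M (\<lambda>z. normal_density 0 e (z - x))"
      by (rule integrable_const_bound[of _ "1 / sqrt (2 * pi * e\<^sup>2)"])
         (auto simp: normal_density_def intro!: AE_I2 divide_right_mono)
    have "measure M {x} / sqrt (2 * pi * e\<^sup>2) = (\<integral>z. indicator {x} z / sqrt (2 * pi * e\<^sup>2) \<partial>M)"
      by simp
    also have "\<dots> \<le> (\<integral>z. normal_density 0 e (z - x) \<partial>M)"
      by (rule integral_mono'[OF 1]) (auto simp: indicator_def normal_density_def)
    finally have "2 * pi * (measure M {x} / sqrt (2 * pi * e\<^sup>2)) \<le> 2 * pi * (\<integral>z. normal_density 0 e (z - x) \<partial>M)"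
      by (rule mult_left_mono) simp
    also have "\<dots> = norm (complex_of_real (2 * pi * (\<integral>z. normal_density 0 e (z - x) \<partial>M)))"
      by (simp only: norm_of_real) (simp add: Bochner_Integration.integral_nonneg)
    also have "\<dots> \<le> (\<integral>u. norm (iexp (- (u * x)) * char M u * exp (- (e * u)\<^sup>2 / 2)) \<partial>lborel)"
      unfolding fourier_gaussian_char[OF e, symmetric] by (rule integral_norm_bound)
    also have "\<dots> \<le> (\<integral>u. norm (char M u) \<partial>lborel)"
      by (rule integral_mono') (use int in \<open>auto simp: norm_mult intro!: mult_left_le\<close>)
    finally show ?thesis
      using e by (simp add: K_def real_sqrt_mult field_simps)
  qed
  have "((\<lambda>e. K * e) \<longlongrightarrow> K * 0) (at_right 0)"
    by (intro tendsto_intros)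
  then have "measure M {x} \<le> K * 0"
    by (rule tendsto_lowerbound) (auto simp: eventually_at_filter le intro!: always_eventually)
  then show ?thesis by (simp add: measure_le_0_iff)
qed

text \<open>Canonical realization of independent variables with law \<open>N\<close> as the
  coordinates of a product space. It provides variables with the tilted law, to which the general
  facts on sums and joint densities can be applied.\<close>

lemma
  fixes N :: "real measure" and I :: "nat set"
  assumes N: "real_distribution N" and I: "I \<noteq> {}"
  shows indep_vars_PiM_components: "prob_space.indep_vars (PiM I (\<lambda>_. N)) (\<lambda>_. borel) (\<lambda>i \<omega>. \<omega> i) I"
    and distr_PiM_borel_component: "\<And>i. i \<in> I \<Longrightarrow> distr (PiM I (\<lambda>_. N)) borel (\<lambda>\<omega>. \<omega> i) = N"
    and distr_PiM_restrict: "\<And>L. (\<And>i. i \<in> I \<Longrightarrow> sets (L i) = sets borel) \<Longrightarrow>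
      distr (PiM I (\<lambda>_. N)) (PiM I L) (\<lambda>\<omega>. \<lambda>i\<in>I. \<omega> i) = PiM I (\<lambda>_. N)"
proof -
  let ?P = "PiM I (\<lambda>_. N)"
  interpret R: real_distribution N by fact
  interpret P: product_prob_space "\<lambda>_. N" I
    by unfold_locales
  have m[measurable]: "(\<lambda>\<omega>. \<omega> i) \<in> measurable ?P borel" if "i \<in> I" for i
    using measurable_component_singleton[OF that, of "\<lambda>_. N"]
    by (subst measurable_cong_sets[OF refl R.events_eq_borel[symmetric]])
  show d: "distr ?P borel (\<lambda>\<omega>. \<omega> i) = N" if "i \<in> I" for i
    using P.PiM_component[OF that] by (simp cong: distr_cong)
  show id: "distr ?P (PiM I L) (\<lambda>\<omega>. \<lambda>i\<in>I. \<omega> i) = ?P" if "\<And>i. i \<in> I \<Longrightarrow> sets (L i) = sets borel" for L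
  proof -
    have "distr ?P (PiM I L) (\<lambda>\<omega>. \<lambda>i\<in>I. \<omega> i) = distr ?P ?P (\<lambda>\<omega>. \<omega>)"
    proof (rule distr_cong)
      show "sets (PiM I L) = sets ?P" using that by (intro sets_PiM_cong) auto
    qed (auto simp: space_PiM PiE_def extensional_restrict)
    then show ?thesis by simp
  qed
  show "P.indep_vars (\<lambda>_. borel) (\<lambda>i \<omega>. \<omega> i) I"
    using I by (subst P.indep_vars_iff_distr_eq_PiM') (auto simp: id d cong: PiM_cong)
qed

text \<open>With at least two summands the power of \<open>\<phi>\<close> is dominated by its
  integrable squared modulus, so the law of the sum can be inverted even if \<open>\<phi>\<close>
  itself is not integrable.\<close>

lemma
  fixes f :: "real \<Rightarrow> real" and I :: "nat set"
  assumes [measurable]: "f \<in> borel_measurable borel"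
    and f: "\<And>x. 0 \<le> f x" "\<And>x. f x \<le> C"
    and D: "real_distribution (lborel_density f)"
    and I: "finite I" "2 \<le> card I"
  defines "\<phi> \<equiv> char (lborel_density f)"
  shows integrable_char_power_card: "integrable lborel (\<lambda>u. \<phi> u ^ card I)"
    and fourier_density_char_power_nonneg: "\<And>x. 0 \<le> fourier_density (\<lambda>u. \<phi> u ^ card I) x"
    and distr_PiM_sum_eq_fourier_density:
      "distr (PiM I (\<lambda>_. lborel_density f)) borel (\<lambda>\<omega>. \<Sum>i\<in>I. \<omega> i)
      = density lborel (\<lambda>x. ennreal (fourier_density (\<lambda>u. \<phi> u ^ card I) x))"
proof -
  let ?M = "lborel_density f"
  let ?P = "PiM I (\<lambda>_. ?M)"
  have I0: "I \<noteq> {}" using I by auto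
  interpret R: real_distribution ?M by fact
  interpret P: prob_space ?P by (intro prob_space_PiM R.prob_space_axioms)
  note d = distr_PiM_borel_component[OF D I0] and ind = indep_vars_PiM_components[OF D I0]
  let ?S = "distr ?P borel (\<lambda>\<omega>. \<Sum>i\<in>I. \<omega> i)"
  have m[measurable]: "(\<lambda>\<omega>. \<omega> i) \<in> measurable ?P borel" if "i \<in> I" for i
    using measurable_component_singleton[OF that, of "\<lambda>_. ?M"] by simp
  interpret S: real_distribution ?S
    by (intro real_distribution.intro real_distribution_axioms.intro P.prob_space_distr) auto
  have char: "char ?S = (\<lambda>u. \<phi> u ^ card I)"
    using P.char_distr_sum[OF ind] by (simp add: fun_eq_iff d \<phi>_def)
  have [measurable]: "\<phi> \<in> borel_measurable borel" unfolding \<phi>_def by measurable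
  have sq: "integrable lborel (\<lambda>v. (norm (\<phi> v))\<^sup>2)"
    unfolding \<phi>_def using integrable_norm_char_square[OF D] f by auto
  show int: "integrable lborel (\<lambda>u. \<phi> u ^ card I)"
  proof (rule Bochner_Integration.integrable_bound[OF sq])
    have "norm (\<phi> u) \<le> 1" for u unfolding \<phi>_def by (rule R.cmod_char_le_1)
    then show "AE u in lborel. norm (\<phi> u ^ card I) \<le> norm ((norm (\<phi> u))\<^sup>2)"
      using I by (auto simp: norm_power power_decreasing)
  qed simp
  show "0 \<le> fourier_density (\<lambda>u. \<phi> u ^ card I) x" for x
    using S.fourier_density_nonneg[of x] int by (simp add: char)
  show "?S = density lborel (\<lambda>x. ennreal (fourier_density (\<lambda>u. \<phi> u ^ card I) x))"
    using S.fourier_inversion S.no_atoms_of_integrable_char int by (simp add: char)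
qed

lemma PiM_density_lborel:
  fixes f :: "real \<Rightarrow> real" and I :: "nat set"
  assumes [measurable]: "f \<in> borel_measurable borel" and f: "\<And>x. 0 \<le> f x"
    and D: "real_distribution (lborel_density f)"
    and I: "finite I" "I \<noteq> {}"
  shows "PiM I (\<lambda>_. lborel_density f)
    = density (PiM I (\<lambda>_. lborel)) (\<lambda>y. ennreal (\<Prod>i\<in>I. f (y i)))"
proof -
  let ?M = "lborel_density f"
  let ?P = "PiM I (\<lambda>_. ?M)"
  interpret R: real_distribution ?M by fact
  interpret P: prob_space ?P by (intro prob_space_PiM R.prob_space_axioms)
  have m[measurable]: "(\<lambda>\<omega>. \<omega> i) \<in> measurable ?P borel" if "i \<in> I" for i
    using measurable_component_singleton[OF that, of "\<lambda>_. ?M"] by simp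
  have "distributed ?P (PiM I (\<lambda>_. lborel)) (\<lambda>\<omega>. \<lambda>i\<in>I. \<omega> i) (\<lambda>y. ennreal (\<Prod>i\<in>I. f (y i)))"
    using I f distr_PiM_borel_component[OF D I(2)]
    by (intro P.distributed_PiM_iid indep_vars_PiM_components[OF D]) (auto simp: distributed_def cong: distr_cong)
  then show ?thesis
    using distr_PiM_restrict[OF D I(2), of "\<lambda>_. lborel"] by (simp add: distributed_def)
qed

text \<open>Exponential change of measure: the factor \<open>exp (t * (\<Sum>i\<in>I. y i))\<close> by which the product of the
  tilted densities differs from that of the original ones depends on the sum only.\<close>

lemma (in prob_space) distributed_sum_iid_tilted:
  fixes X :: "nat \<Rightarrow> 'a \<Rightarrow> real" and p f :: "real \<Rightarrow> real" and I :: "nat set"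
  assumes ind: "indep_vars (\<lambda>_. borel) X I"
    and X: "\<And>i. i \<in> I \<Longrightarrow> distributed M lborel (X i) (\<lambda>x. ennreal (p x))"
    and [measurable]: "f \<in> borel_measurable borel"
    and f: "\<And>x. 0 \<le> f x" "\<And>x. f x \<le> C"
    and D: "real_distribution (lborel_density f)"
    and p: "\<And>x. p x = L * exp (- (t * x)) * f x" and L: "0 \<le> L"
    and I: "finite I" "2 \<le> card I"
  defines "F \<equiv> fourier_density (\<lambda>u. char (lborel_density f) u ^ card I)"
  shows "distributed M lborel (\<lambda>\<omega>. \<Sum>i\<in>I. X i \<omega>) (\<lambda>x. ennreal (L ^ card I * exp (- (t * x)) * F x))"
proof -
  let ?M = "lborel_density f"
  let ?P = "PiM I (\<lambda>_. ?M)" and ?B = "PiM I (\<lambda>_. lborel :: real measure)"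
  have I0: "I \<noteq> {}" using I by auto
  have F: "continuous_on A F" for A
    unfolding F_def by (intro continuous_fourier_density integrable_char_power_card[OF _ f D I]) simp
  have [measurable]: "F \<in> borel_measurable borel"
    by (intro borel_measurable_continuous_onI F)
  have F0: "0 \<le> F x" for x
    unfolding F_def by (intro fourier_density_char_power_nonneg[OF _ f D I]) simp
  have [measurable]: "X i \<in> borel_measurable M" if "i \<in> I" for i
    using X[OF that] by (auto simp: distributed_def)
  have m[measurable]: "(\<lambda>\<omega>. \<omega> i) \<in> borel_measurable ?P" "(\<lambda>\<omega>. \<omega> i) \<in> borel_measurable ?B" if "i \<in> I" for i
    using measurable_component_singleton[OF that, of "\<lambda>_. ?M"]
      measurable_component_singleton[OF that, of "\<lambda>_. lborel"] by simp_all
  have p0: "0 \<le> p x" for x using p L f by simp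
  have [measurable]: "p \<in> borel_measurable borel" unfolding p by measurable
  have W: "distributed M ?B (\<lambda>\<omega>. \<lambda>i\<in>I. X i \<omega>) (\<lambda>y. ennreal (\<Prod>i\<in>I. p (y i)))"
    using I I0 ind X p0 by (intro distributed_PiM_iid)
  have "distr M lborel (\<lambda>\<omega>. \<Sum>i\<in>I. X i \<omega>) = density lborel (\<lambda>x. ennreal (L ^ card I * exp (- (t * x)) * F x))"
  proof (rule measure_eqI)
    fix A assume "A \<in> sets (distr M lborel (\<lambda>\<omega>. \<Sum>i\<in>I. X i \<omega>))"
    then have [measurable]: "A \<in> sets borel" by simp
    let ?w = "\<lambda>x. ennreal (L ^ card I * exp (- (t * x)))"
    have prod: "(\<Prod>i\<in>I. p (y i)) = L ^ card I * exp (- (t * (\<Sum>i\<in>I. y i))) * (\<Prod>i\<in>I. f (y i))" for y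
      using I by (simp add: p prod.distrib exp_sum sum_distrib_left flip: sum_negf)
    have "emeasure (distr M lborel (\<lambda>\<omega>. \<Sum>i\<in>I. X i \<omega>)) A = (\<integral>\<^sup>+\<omega>. indicator A (\<Sum>i\<in>I. X i \<omega>) \<partial>M)"
      by (subst nn_integral_indicator[symmetric], simp, subst nn_integral_distr) auto
    also have "\<dots> = (\<integral>\<^sup>+\<omega>. indicator A (\<Sum>i\<in>I. (\<lambda>i\<in>I. X i \<omega>) i) \<partial>M)"
      by simp
    also have "\<dots> = (\<integral>\<^sup>+y. ennreal (\<Prod>i\<in>I. p (y i)) * indicator A (\<Sum>i\<in>I. y i) \<partial>?B)"
      by (subst distributed_nn_integral[OF W]) auto
    also have "\<dots> = (\<integral>\<^sup>+y. ennreal (\<Prod>i\<in>I. f (y i)) * (?w (\<Sum>i\<in>I. y i) * indicator A (\<Sum>i\<in>I. y i)) \<partial>?B)"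
      using f L by (intro nn_integral_cong) (simp add: prod ennreal_mult prod_nonneg mult_ac)
    also have "\<dots> = (\<integral>\<^sup>+y. ?w (\<Sum>i\<in>I. y i) * indicator A (\<Sum>i\<in>I. y i) \<partial>?P)"
      unfolding PiM_density_lborel[OF \<open>f \<in> borel_measurable borel\<close> f(1) D I(1) I0]
      by (subst nn_integral_density) auto
    also have "\<dots> = (\<integral>\<^sup>+x. ?w x * indicator A x \<partial>distr ?P borel (\<lambda>\<omega>. \<Sum>i\<in>I. \<omega> i))"
      by (subst nn_integral_distr) auto
    also have "\<dots> = (\<integral>\<^sup>+x. ennreal (F x) * (?w x * indicator A x) \<partial>lborel)"
      unfolding distr_PiM_sum_eq_fourier_density[OF \<open>f \<in> borel_measurable borel\<close> f D I] F_def[symmetric]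
      by (subst nn_integral_density) auto
    also have "\<dots> = (\<integral>\<^sup>+x. ennreal (L ^ card I * exp (- (t * x)) * F x) * indicator A x \<partial>lborel)"
      using L F0 by (intro nn_integral_cong) (simp add: ennreal_mult mult_ac)
    also have "\<dots> = emeasure (density lborel (\<lambda>x. ennreal (L ^ card I * exp (- (t * x)) * F x))) A"
      by (rule emeasure_density[symmetric]) auto
    finally show "emeasure (distr M lborel (\<lambda>\<omega>. \<Sum>i\<in>I. X i \<omega>)) A
      = emeasure (density lborel (\<lambda>x. ennreal (L ^ card I * exp (- (t * x)) * F x))) A" .
  qed simp
  then show ?thesis by (simp add: distributed_def)
qed

text \<open>The Fourier integral is continuous, hence the density computed from it is the version
  that \<open>continuous_density\<close> selects. Numerator and denominator of
  \<open>cond_density\<close> are both evaluated in this way, with the same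
  \<open>t\<close>.\<close>

lemma (in prob_space) continuous_density_sum_iid_tilted:
  fixes X :: "nat \<Rightarrow> 'a \<Rightarrow> real" and p f :: "real \<Rightarrow> real" and I :: "nat set"
  assumes ind: "indep_vars (\<lambda>_. borel) X I"
    and X: "\<And>i. i \<in> I \<Longrightarrow> distributed M lborel (X i) (\<lambda>x. ennreal (p x))"
    and fm: "f \<in> borel_measurable borel"
    and f: "\<And>x. 0 \<le> f x" "\<And>x. f x \<le> C"
    and D: "real_distribution (lborel_density f)"
    and p: "\<And>x. p x = L * exp (- (t * x)) * f x" and L: "0 \<le> L"
    and I: "finite I" "2 \<le> card I"
  shows "continuous_density M (\<lambda>\<omega>. \<Sum>i\<in>I. X i \<omega>) = (\<lambda>x. L ^ card I * exp (- (t * x)) *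
    fourier_density (\<lambda>u. char (lborel_density f) u ^ card I) x)"
proof (rule continuous_density_eqI)
  show "continuous_on UNIV (\<lambda>x. L ^ card I * exp (- (t * x)) *
    fourier_density (\<lambda>u. char (lborel_density f) u ^ card I) x)"
    by (intro continuous_intros continuous_fourier_density integrable_char_power_card[OF fm f D I])
  show "0 \<le> L ^ card I * exp (- (t * x)) *
    fourier_density (\<lambda>u. char (lborel_density f) u ^ card I) x" for x
    using L fourier_density_char_power_nonneg[OF fm f D I] by simp
qed (use distributed_sum_iid_tilted[OF ind X fm f D p L I] prob_space_axioms in auto)

text \<open>Standardization of the sum: if \<open>Z\<close> has density
  \<open>s * f (m + s * z)\<close>, then \<open>m + s * Z\<close> has density \<open>f\<close>. The
  shift \<open>N * m\<close> appears as a phase, and the scaling as a substitution in the Fourier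
  integral. Here \<open>\<psi>\<close> is a characteristic function, not the inverse of
  \<open>h\<close>.\<close>

lemma fourier_density_char_affine:
  fixes f :: "real \<Rightarrow> real" and m s x :: real and N :: nat
  assumes [measurable]: "f \<in> borel_measurable borel" and f: "\<And>x. 0 \<le> f x" and s: "s > 0"
  defines "\<phi> \<equiv> char (lborel_density f)"
    and "\<psi> \<equiv> char (density lborel (\<lambda>z. ennreal (s * f (m + s * z))))"
  shows "fourier_density (\<lambda>u. \<phi> u ^ N) x = fourier_density (\<lambda>v. \<psi> v ^ N) ((x - N * m) / s) / s"
proof -
  have \<phi>: "\<phi> u = iexp (u * m) * \<psi> (s * u)" for u
  proof -
    have "\<phi> u = (CLBINT x. f x *\<^sub>R iexp (u * x))"
      unfolding \<phi>_def char_def using f by (subst integral_density) auto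
    also have "\<dots> = \<bar>s\<bar> *\<^sub>R (CLBINT z. f (m + s * z) *\<^sub>R iexp (u * (m + s * z)))"
      using s by (intro lborel_integral_real_affine) auto
    also have "\<dots> = (CLBINT z. iexp (u * m) * ((s * f (m + s * z)) *\<^sub>R iexp (s * u * z)))"
      unfolding integral_scaleR_right[symmetric] using s
      by (intro Bochner_Integration.integral_cong refl)
         (simp add: scaleR_conv_of_real algebra_simps exp_add)
    also have "\<dots> = iexp (u * m) * \<psi> (s * u)"
      unfolding \<psi>_def char_def integral_mult_right_zero using f s by (subst integral_density) auto
    finally show ?thesis .
  qed
  let ?y = "(x - N * m) / s"
  have "(CLBINT v. iexp (- (v * ?y)) * \<psi> v ^ N) = \<bar>s\<bar> *\<^sub>R (CLBINT u. iexp (- ((0 + s * u) * ?y)) * \<psi> (0 + s * u) ^ N)"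
    using s by (intro lborel_integral_real_affine) auto
  also have "(\<lambda>u. iexp (- ((0 + s * u) * ?y)) * \<psi> (0 + s * u) ^ N) = (\<lambda>u. iexp (- (u * x)) * \<phi> u ^ N)"
  proof
    fix u
    have e: "iexp (u * m) ^ N = iexp (u * (N * m))"
      by (simp add: exp_of_nat_mult[symmetric] algebra_simps)
    have "iexp (- (u * x)) * iexp (u * (N * m)) = iexp (- (u * x) + u * (N * m))"
      by (simp add: distrib_left right_diff_distrib flip: exp_add)
    also have "- (u * x) + u * (N * m) = - ((0 + s * u) * ?y)"
      using s by (simp add: field_simps)
    finally show "iexp (- ((0 + s * u) * ?y)) * \<psi> (0 + s * u) ^ N = iexp (- (u * x)) * \<phi> u ^ N"
      unfolding \<phi> power_mult_distrib e by (simp add: mult.assoc[symmetric])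
  qed
  finally show ?thesis
    using s unfolding fourier_density_def by simp
qed

section \<open>Laplace approximation of the tilted density\<close>

lemma integrable_power_exp_abs:
  assumes "l > 0"
  shows "integrable lborel (\<lambda>z::real. \<bar>z\<bar> ^ k * exp (- \<bar>z\<bar> / l))"
proof -
  have "has_bochner_integral lborel (\<lambda>x::real. indicator {0..} x *\<^sub>R (\<bar>x\<bar> ^ k * exp (- \<bar>x\<bar>))) (fact k)"
  proof (rule has_bochner_integral_nn_integral)
    have "(\<integral>\<^sup>+ x. ennreal (x ^ k * exp (- x)) * indicator {0 ..} x \<partial>lborel) = ennreal (fact k)"
      using nn_intergal_power_times_exp_Ici[of k] by (simp add: ennreal_of_nat_eq_real_of_nat)
    also have "(\<integral>\<^sup>+ x. ennreal (x ^ k * exp (- x)) * indicator {0 ..} x \<partial>lborel)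
        = (\<integral>\<^sup>+ x. ennreal (indicator {0..} x *\<^sub>R (\<bar>x\<bar> ^ k * exp (- \<bar>x\<bar>))) \<partial>lborel)"
      by (intro nn_integral_cong) (auto simp: indicator_def)
    finally show "(\<integral>\<^sup>+ x. ennreal (indicator {0..} x *\<^sub>R (\<bar>x\<bar> ^ k * exp (- \<bar>x\<bar>))) \<partial>lborel) = ennreal (fact k)" .
  qed auto
  then have "has_bochner_integral lborel (\<lambda>x::real. \<bar>x\<bar> ^ k * exp (- \<bar>x\<bar>)) (2 *\<^sub>R fact k)"
    by (rule has_bochner_integral_even_function) simp
  then have "integrable lborel (\<lambda>x::real. \<bar>x\<bar> ^ k * exp (- \<bar>x\<bar>))" by (rule integrable.intros)
  then have "integrable lborel (\<lambda>x::real. \<bar>0 + 1 / l * x\<bar> ^ k * exp (- \<bar>0 + 1 / l * x\<bar>))"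
    by (rule lborel_integrable_real_affine) (use assms in auto)
  then have "integrable lborel (\<lambda>x::real. l ^ k * (\<bar>0 + 1 / l * x\<bar> ^ k * exp (- \<bar>0 + 1 / l * x\<bar>)))"
    by (rule integrable_mult_right)
  then show ?thesis using assms by (simp add: abs_mult power_mult_distrib power_divide)
qed

text \<open>Pointwise convergence of the derivatives suffices because they are monotone: their
  values at the end points, which converge, bound them on the whole interval, so dominated
  convergence applies to the integral of \<open>d n\<close>.\<close>

lemma integral_limit_quadratic:
  fixes G d :: "nat \<Rightarrow> real \<Rightarrow> real"
  assumes ab: "a \<le> b"
    and G: "\<forall>\<^sub>F n in sequentially. \<forall>w\<in>{a..b}. (G n has_real_derivative d n w) (at w within {a..b})"
    and mono: "\<forall>\<^sub>F n in sequentially. mono_on {a..b} (d n)"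
    and d: "\<And>w. w \<in> {a..b} \<Longrightarrow> (\<lambda>n. d n w) \<longlonglongrightarrow> w"
  shows "(\<lambda>n. G n b - G n a) \<longlonglongrightarrow> (b\<^sup>2 - a\<^sup>2) / 2"
proof -
  have "\<forall>\<^sub>F n in sequentially. d n b < b + 1" "\<forall>\<^sub>F n in sequentially. a - 1 < d n a"
    using d[of b] d[of a] ab by (auto intro: order_tendstoD)
  with G mono have "\<forall>\<^sub>F n in sequentially. (\<forall>w\<in>{a..b}. (G n has_real_derivative d n w) (at w within {a..b}))
      \<and> mono_on {a..b} (d n) \<and> d n b < b + 1 \<and> a - 1 < d n a"
    by eventually_elim auto
  then obtain m where m: "\<And>n. n \<ge> m \<Longrightarrow> (\<forall>w\<in>{a..b}. (G n has_real_derivative d n w) (at w within {a..b}))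
      \<and> mono_on {a..b} (d n) \<and> d n b < b + 1 \<and> a - 1 < d n a"
    unfolding eventually_sequentially by blast
  have int: "(d (k + m) has_integral G (k + m) b - G (k + m) a) {a..b}" for k
    using ab m[of "k + m"] by (intro fundamental_theorem_of_calculus) (auto simp: has_real_derivative_iff_has_vector_derivative)
  have "(\<lambda>k. integral {a..b} (d (k + m))) \<longlonglongrightarrow> integral {a..b} (\<lambda>w. w)"
  proof (rule dominated_convergence(2)[where h="\<lambda>_. \<bar>a\<bar> + \<bar>b\<bar> + 1"])
    show "norm (d (k + m) w) \<le> \<bar>a\<bar> + \<bar>b\<bar> + 1" if w: "w \<in> {a..b}" for k w
    proof -
      have "d (k + m) a \<le> d (k + m) w" "d (k + m) w \<le> d (k + m) b"
        using m[of "k + m"] w ab by (auto intro: mono_onD[of "{a..b}" "d (k + m)"])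
      then show ?thesis using m[of "k + m"] by auto
    qed
    show "(\<lambda>k. d (k + m) w) \<longlonglongrightarrow> w" if "w \<in> {a..b}" for w
      using d[OF that] by (rule LIMSEQ_ignore_initial_segment)
  qed (use int in \<open>auto simp: has_integral_iff\<close>)
  also have "integral {a..b} (\<lambda>w. w) = (b\<^sup>2 - a\<^sup>2) / 2"
    using ident_has_integral[OF ab] by (simp add: has_integral_iff)
  finally have "(\<lambda>k. G (k + m) b - G (k + m) a) \<longlonglongrightarrow> (b\<^sup>2 - a\<^sup>2) / 2"
    using int by (simp add: has_integral_iff)
  then show ?thesis by (rule LIMSEQ_offset)
qed

text \<open>The bound on \<open>|z| < 1\<close> is obtained by reflection in \<open>0\<close>.\<close>

lemma convex_lower_bound:
  fixes F :: "real \<Rightarrow> real"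
  assumes F: "convex_on S F" and S: "{-1..1} \<subseteq> S" and F0: "F 0 = 0"
    and F1: "1 / 4 \<le> F 1" "F 1 \<le> 3 / 4" "1 / 4 \<le> F (- 1)" "F (- 1) \<le> 3 / 4" and z: "z \<in> S"
  shows "\<bar>z\<bar> / 4 - 5 / 4 \<le> F z"
proof -
  have cv: "F (t * y) \<le> t * F y" if "0 \<le> t" "t \<le> 1" "y \<in> S" for t y
  proof -
    have "0 \<in> S" using S by auto
    then show ?thesis using convex_onD[OF F, of t 0 y] that F0 by auto
  qed
  \<comment> \<open>Outside the unit interval, convexity through the origin gives
    \<open>F z \<ge> \<bar>z\<bar> / 4\<close>; inside, the offset \<open>5 / 4\<close> leaves room
    for the value \<open>- 3 / 4\<close>. In the application \<open>F\<close> tends to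
    \<open>z^2 / 2\<close>, so the values at \<open>1\<close> and \<open>-1\<close> approach
    \<open>1 / 2\<close>, the middle of \<open>1 / 4\<close> and \<open>3 / 4\<close>.\<close>
  consider "z \<ge> 1" | "z \<le> -1" | "\<bar>z\<bar> < 1" by linarith
  then show ?thesis
  proof cases
    case 1
    then have "F 1 \<le> 1 / z * F z" using cv[of "1 / z" z] z by simp
    then have "z * F 1 \<le> F z" using 1 by (simp add: field_simps)
    moreover have "z * (1 / 4) \<le> z * F 1" using 1 F1 by (intro mult_left_mono) auto
    ultimately show ?thesis using 1 by linarith
  next
    case 2
    then have "1 / (-z) \<le> 1" by (subst divide_le_eq_1_pos) auto
    then have "F (-1) \<le> 1 / (-z) * F z" using cv[of "1 / (-z)" z] z 2 by simp
    then have "(-z) * F (-1) \<le> F z" using 2 by (simp add: field_simps)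
    moreover have "(-z) * (1 / 4) \<le> (-z) * F (-1)" using 2 F1 by (intro mult_left_mono) auto
    ultimately show ?thesis using 2 by linarith
  next
    case 3
    define e :: real where "e = (if z \<ge> 0 then -1 else 1)"
    have "F (- z) = F (\<bar>z\<bar> * e)" by (simp add: e_def)
    also have "\<dots> \<le> \<bar>z\<bar> * F e" using 3 S by (intro cv) (auto simp: e_def)
    also have "\<dots> \<le> 1 * (3 / 4)" using 3 F1 by (intro mult_mono) (auto simp: e_def)
    finally have "F (- z) \<le> 3 / 4" by simp
    moreover have "F ((1 - 1 / 2) *\<^sub>R z + (1 / 2) *\<^sub>R (- z)) \<le> (1 - 1 / 2) * F z + 1 / 2 * F (- z)"
      using 3 S by (intro convex_onD[OF F]) (auto simp: subset_iff abs_less_iff)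
    ultimately have "- (3 / 4) \<le> F z" using F0 by simp
    then show ?thesis using 3 by simp
  qed
qed

text \<open>\<open>x n\<close> is the position and \<open>\<sigma> n\<close> the width of the peak
  of \<open>exp (T n * v) * p v\<close>. The last assumption says that the rescaled derivative of
  the exponent \<open>g v - T n * v\<close> tends to that of \<open>z^2 / 2\<close>; this is the
  form in which both regularity classes enter. Above \<open>A\<close> the exponent
  \<open>g v - T n * v\<close> is convex; on the fixed interval below \<open>A\<close> the bound
  \<open>B\<close> has to do.\<close>

locale laplace_peak =
  fixes p g h q :: "real \<Rightarrow> real" and c A B :: real and T x \<sigma> :: "nat \<Rightarrow> real"
  assumes p_measurable [measurable]: "p \<in> borel_measurable borel"
    and c: "c > 0"
    and p_pos: "\<And>v. v \<ge> 0 \<Longrightarrow> p v = c * exp (- (g v - q v))"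
    and p_neg: "\<And>v. v < 0 \<Longrightarrow> p v = 0"
    and p_le: "\<And>v. p v \<le> B"
    and g: "\<And>v. v \<ge> 0 \<Longrightarrow> (g has_real_derivative h v) (at v within {0..})"
    and A: "A > 0" and h_mono: "mono_on {A..} h" and q_le: "\<And>v. v \<ge> A \<Longrightarrow> q v \<le> 1"
    and q_lim: "(q \<longlongrightarrow> 0) at_top"
    and T: "\<forall>\<^sub>F n in sequentially. 0 \<le> T n"
    and x: "filterlim x at_top sequentially"
    and \<sigma>: "\<forall>\<^sub>F n in sequentially. 0 < \<sigma> n"
    and \<sigma>x: "(\<lambda>n. \<sigma> n / x n) \<longlonglongrightarrow> 0"
    and h_lim: "\<And>z. (\<lambda>n. \<sigma> n * (h (x n + \<sigma> n * z) - T n)) \<longlonglongrightarrow> z"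
begin

text \<open>The tilted density in the coordinate \<open>z\<close>, divided by its height at the peak
  without the perturbation \<open>q\<close>; thus \<open>w n 0 = exp (q (x n))\<close> if
  \<open>x n \<ge> 0\<close>.\<close>

definition w :: "nat \<Rightarrow> real \<Rightarrow> real" where
  "w n z = exp (g (x n) - T n * x n) / c * (exp (T n * (x n + \<sigma> n * z)) * p (x n + \<sigma> n * z))"

definition F :: "nat \<Rightarrow> real \<Rightarrow> real" where
  "F n z = g (x n + \<sigma> n * z) - g (x n) - T n * (\<sigma> n * z)"

lemma p_nonneg: "0 \<le> p v"
  using p_pos[of v] p_neg[of v] c by (cases "v \<ge> 0") auto

lemma w_measurable [measurable]: "w n \<in> borel_measurable borel"
  unfolding w_def by measurable

lemma w_nonneg: "0 \<le> w n z"
  unfolding w_def using c p_nonneg by simp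

lemma eventually_large: "\<forall>\<^sub>F n in sequentially. C \<le> x n - \<sigma> n * K"
proof -
  have "(\<lambda>n. 1 - \<sigma> n / x n * K) \<longlonglongrightarrow> 1 - 0 * K" by (intro tendsto_intros \<sigma>x)
  then have "filterlim (\<lambda>n. (1 - \<sigma> n / x n * K) * x n) at_top sequentially"
    by (intro filterlim_tendsto_pos_mult_at_top[OF _ _ x]) auto
  then have "\<forall>\<^sub>F n in sequentially. C \<le> (1 - \<sigma> n / x n * K) * x n"
    by (simp add: filterlim_at_top)
  moreover have "\<forall>\<^sub>F n in sequentially. 0 < x n" using x by (simp add: filterlim_at_top_dense)
  ultimately show ?thesis 
  proof eventually_elim
    case (elim n)
    then have "(1 - \<sigma> n / x n * K) * x n = x n - \<sigma> n * K" by (simp add: left_diff_distrib)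
    with elim show ?case by simp
  qed
qed

lemma F_deriv:
  assumes "x n + \<sigma> n * z > 0"
  shows "(F n has_real_derivative \<sigma> n * (h (x n + \<sigma> n * z) - T n)) (at z within S)"
proof -
  have "(g has_real_derivative h (x n + \<sigma> n * z)) (at (x n + \<sigma> n * z))"
    using g[of "x n + \<sigma> n * z"] assms at_within_interior[of "x n + \<sigma> n * z" "{0..}"] by simp
  then have "((\<lambda>z. g (x n + \<sigma> n * z)) has_real_derivative h (x n + \<sigma> n * z) * \<sigma> n) (at z within S)"
    by (rule DERIV_chain2) (auto intro!: derivative_eq_intros)
  then show ?thesis
    unfolding F_def by (auto intro!: derivative_eq_intros simp: algebra_simps)
qed

text \<open>Since \<open>\<sigma> n / x n\<close> tends to \<open>0\<close>, a bounded range of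
  \<open>z\<close> is eventually mapped beyond \<open>A\<close>, where \<open>h\<close> and hence
  the derivative of \<open>F n\<close> is monotone. The normalization \<open>F n 0 = 0\<close> fixes
  the constant.\<close>

lemma F_lim: "(\<lambda>n. F n z) \<longlonglongrightarrow> z\<^sup>2 / 2"
proof -
  have "(\<lambda>n. F n b - F n a) \<longlonglongrightarrow> (b\<^sup>2 - a\<^sup>2) / 2" if ab: "a \<le> b" for a b
  proof (rule integral_limit_quadratic[OF ab])
    let ?K = "\<bar>a\<bar> + \<bar>b\<bar>"
    have ev: "\<forall>\<^sub>F n in sequentially. \<sigma> n > 0 \<and> (\<forall>w\<in>{a..b}. A \<le> x n + \<sigma> n * w)"
      using \<sigma> eventually_large[of A ?K]
    proof eventually_elim
      case (elim n)
      have "A \<le> x n + \<sigma> n * w" if "w \<in> {a..b}" for w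
      proof -
        have "\<sigma> n * (- ?K) \<le> \<sigma> n * w" using elim(1) that by (intro mult_left_mono) auto
        then show ?thesis using elim(2) by (simp add: algebra_simps)
      qed
      with elim show ?case by auto
    qed
    then show "\<forall>\<^sub>F n in sequentially. \<forall>w\<in>{a..b}. (F n has_real_derivative \<sigma> n * (h (x n + \<sigma> n * w) - T n)) (at w within {a..b})"
      by eventually_elim (use A in \<open>auto intro!: F_deriv dest!: bspec\<close>)
    from ev show "\<forall>\<^sub>F n in sequentially. mono_on {a..b} (\<lambda>w. \<sigma> n * (h (x n + \<sigma> n * w) - T n))"
      by eventually_elim (auto intro!: mono_onI mult_left_mono mono_onD[OF h_mono])
  qed (rule h_lim)
  from this[of 0 z] this[of z 0] have "(\<lambda>n. F n z - F n 0) \<longlonglongrightarrow> z\<^sup>2 / 2"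
    by (cases "0 \<le> z") (auto dest: tendsto_minus)
  then show ?thesis by (simp add: F_def)
qed

lemma w_eq:
  assumes "x n + \<sigma> n * z \<ge> 0"
  shows "w n z = exp (- F n z) * exp (q (x n + \<sigma> n * z))"
proof -
  have "w n z = exp (g (x n) - T n * x n) * exp (T n * (x n + \<sigma> n * z)) * exp (- (g (x n + \<sigma> n * z) - q (x n + \<sigma> n * z)))"
    using c p_pos[OF assms] by (simp add: w_def)
  also have "\<dots> = exp (- F n z) * exp (q (x n + \<sigma> n * z))"
    unfolding exp_add[symmetric] by (simp add: F_def algebra_simps)
  finally show ?thesis .
qed

lemma w_lim: "(\<lambda>n. w n z) \<longlonglongrightarrow> exp (- z\<^sup>2 / 2)"
proof -
  have "filterlim (\<lambda>n. x n + \<sigma> n * z) at_top sequentially"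
    unfolding filterlim_at_top
  proof
    fix Z show "\<forall>\<^sub>F n in sequentially. Z \<le> x n + \<sigma> n * z"
      using eventually_large[of Z "- z"] by simp
  qed
  then have "(\<lambda>n. q (x n + \<sigma> n * z)) \<longlonglongrightarrow> 0" by (rule filterlim_compose[OF q_lim])
  then have "(\<lambda>n. exp (- F n z) * exp (q (x n + \<sigma> n * z))) \<longlonglongrightarrow> exp (- (z\<^sup>2 / 2)) * exp 0"
    by (intro tendsto_intros F_lim)
  moreover have "\<forall>\<^sub>F n in sequentially. exp (- F n z) * exp (q (x n + \<sigma> n * z)) = w n z"
    using eventually_large[of 0 "- z"] by eventually_elim (simp add: w_eq)
  ultimately show ?thesis by (auto elim: Lim_transform_eventually)
qed

text \<open>Beyond \<open>A\<close>, convexity turns the convergence of \<open>F n\<close> at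
  \<open>1\<close> and \<open>-1\<close> into linear growth of rate \<open>1 / 4\<close>, and
  \<open>q \<le> 1\<close> costs a factor \<open>exp 1\<close>. On \<open>0 \<le> v < A\<close> the
  crude estimate \<open>exp (T n * A) * B\<close> compares \<open>w n z\<close> with the exponent at
  \<open>A\<close>. As \<open>x n \<ge> 2 * A\<close>, the point \<open>A\<close> is at least half
  as far from the peak as \<open>v\<close>; this halves the rate to \<open>1 / 8\<close>.\<close>

lemma w_bound: "\<exists>D. \<forall>\<^sub>F n in sequentially. \<forall>z. w n z \<le> D * exp (- \<bar>z\<bar> / 8)"
proof (intro exI)
  have B: "0 \<le> B" using p_nonneg[of 0] p_le[of 0] by simp
  have "\<forall>\<^sub>F n in sequentially. 1 / 4 < F n 1" "\<forall>\<^sub>F n in sequentially. F n 1 < 3 / 4"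
    "\<forall>\<^sub>F n in sequentially. 1 / 4 < F n (-1)" "\<forall>\<^sub>F n in sequentially. F n (-1) < 3 / 4"
    using order_tendstoD[OF F_lim[of 1], of "1 / 4"] order_tendstoD[OF F_lim[of 1], of "3 / 4"]
      order_tendstoD[OF F_lim[of "-1"], of "1 / 4"] order_tendstoD[OF F_lim[of "-1"], of "3 / 4"] by simp_all
  moreover have "\<forall>\<^sub>F n in sequentially. 2 * A \<le> x n" using eventually_large[of "2 * A" 0] by simp
  ultimately show "\<forall>\<^sub>F n in sequentially. \<forall>z. w n z \<le> (exp (9 / 4) + exp (g A + 5 / 4) * B / c) * exp (- \<bar>z\<bar> / 8)"
    using eventually_large[of A 1] \<sigma> T
  proof eventually_elim
    case (elim n)
    let ?S = "{z. A \<le> x n + \<sigma> n * z}"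
    have conv: "convex ?S"
    proof -
      have "?S = {(A - x n) / \<sigma> n ..}" using elim by (auto simp: field_simps)
      then show ?thesis by simp
    qed
    have cvx: "convex_on ?S (F n)"
    proof (rule convex_on_realI)
      show "connected ?S" using conv by (rule convex_connected)
      show "(F n has_real_derivative \<sigma> n * (h (x n + \<sigma> n * z) - T n)) (at z)" if "z \<in> ?S" for z
        using that A by (intro F_deriv) auto
      show "\<sigma> n * (h (x n + \<sigma> n * y) - T n) \<le> \<sigma> n * (h (x n + \<sigma> n * z) - T n)" if "y \<in> ?S" "z \<in> ?S" "y \<le> z" for y z
        using that elim by (auto intro!: mult_left_mono mono_onD[OF h_mono])
    qed
    have lower: "\<bar>z\<bar> / 4 - 5 / 4 \<le> F n z" if "z \<in> ?S" for z
    proof (rule convex_lower_bound[OF cvx _ _ _ _ _ _ that])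
      show "{- 1..1} \<subseteq> ?S"
      proof
        fix y :: real assume "y \<in> {-1..1}"
        then have "\<sigma> n * (-1) \<le> \<sigma> n * y" using elim by (intro mult_left_mono) auto
        then show "y \<in> ?S" using elim by simp
      qed
    qed (use elim in \<open>auto simp: F_def\<close>)
    show ?case
    proof
      fix z
      let ?D = "exp (9 / 4) + exp (g A + 5 / 4) * B / c"
      have D0: "0 \<le> exp (g A + 5 / 4) * B / c" using B c by simp
      consider "x n + \<sigma> n * z \<ge> A" | "x n + \<sigma> n * z < 0" | "0 \<le> x n + \<sigma> n * z" "x n + \<sigma> n * z < A"
        by linarith
      then show "w n z \<le> ?D * exp (- \<bar>z\<bar> / 8)"
      proof cases
        case 1
        then have "w n z = exp (- F n z) * exp (q (x n + \<sigma> n * z))" using A by (intro w_eq) auto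
        also have "\<dots> = exp (- F n z + q (x n + \<sigma> n * z))" by (rule exp_add[symmetric])
        also have "\<dots> \<le> exp (9 / 4 + (- \<bar>z\<bar> / 8))" using lower[of z] q_le[OF 1] 1 by simp
        also have "\<dots> = exp (9 / 4) * exp (- \<bar>z\<bar> / 8)" by (rule exp_add)
        also have "\<dots> \<le> ?D * exp (- \<bar>z\<bar> / 8)"
          using D0 by (intro mult_right_mono) auto
        finally show ?thesis .
      next
        case 2
        then show ?thesis using D0 by (simp add: w_def p_neg add_nonneg_nonneg)
      next
        case 3
        \<comment> \<open>The rescaled coordinate of \<open>A\<close>, the leftmost point at which
          the convexity bound is available.\<close>
        let ?y = "(A - x n) / \<sigma> n"
        have y: "x n + \<sigma> n * ?y = A" using elim by simp
        have "\<sigma> n * z < 0" using 3 elim A by linarith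
        then have z: "z < 0" using elim by (simp add: mult_less_0_iff)
        have "\<bar>z\<bar> \<le> x n / \<sigma> n" using 3 elim z by (simp add: field_simps)
        also have "\<dots> \<le> 2 * ((x n - A) / \<sigma> n)" using elim by (simp add: field_simps)
        also have "\<dots> = 2 * \<bar>?y\<bar>" using elim A by simp
        finally have zy: "\<bar>z\<bar> \<le> 2 * \<bar>?y\<bar>" .
        have "w n z \<le> exp (g (x n) - T n * x n) / c * (exp (T n * A) * B)"
          unfolding w_def using 3 elim c B p_le p_nonneg
          by (intro mult_left_mono mult_mono) (auto intro: mult_left_mono)
        also have "\<dots> = exp (g A - F n ?y) * B / c"
        proof -
          have s: "\<sigma> n * ?y = A - x n" using y by linarith
          have "F n ?y = g A - g (x n) - T n * (A - x n)" unfolding F_def y unfolding s ..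
          then have "g A - F n ?y = (g (x n) - T n * x n) + T n * A" by (simp add: algebra_simps)
          then show ?thesis by (simp add: exp_add)
        qed
        also have "\<dots> \<le> exp (g A + 5 / 4 + (- \<bar>z\<bar> / 8)) * B / c"
          using lower[of ?y] y zy B c by (intro divide_right_mono mult_right_mono) auto
        also have "\<dots> = (exp (g A + 5 / 4) * B / c) * exp (- \<bar>z\<bar> / 8)"
          unfolding exp_add by simp
        also have "\<dots> \<le> ?D * exp (- \<bar>z\<bar> / 8)"
          by (intro mult_right_mono) auto
        finally show ?thesis .
      qed
    qed
  qed
qed

end

section \<open>Moments and standardization of densities with a Gaussian limit\<close>

lemma gaussian_moments:
  "(\<integral>z. (z::real) ^ 0 * exp (- z\<^sup>2 / 2) \<partial>lborel) = sqrt (2 * pi)"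
  "(\<integral>z. (z::real) ^ 1 * exp (- z\<^sup>2 / 2) \<partial>lborel) = 0"
  "(\<integral>z. (z::real) ^ 2 * exp (- z\<^sup>2 / 2) \<partial>lborel) = sqrt (2 * pi)"
proof -
  have eq: "(\<integral>z. z ^ k * exp (- z\<^sup>2 / 2) \<partial>lborel) = sqrt (2 * pi) * (\<integral>z. std_normal_density z * z ^ k \<partial>lborel)" for k
    unfolding integral_mult_right_zero[symmetric] by (simp add: std_normal_density_def mult_ac)
  show "(\<integral>z. (z::real) ^ 0 * exp (- z\<^sup>2 / 2) \<partial>lborel) = sqrt (2 * pi)"
    "(\<integral>z. (z::real) ^ 1 * exp (- z\<^sup>2 / 2) \<partial>lborel) = 0"
    "(\<integral>z. (z::real) ^ 2 * exp (- z\<^sup>2 / 2) \<partial>lborel) = sqrt (2 * pi)"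
    unfolding eq using integral_std_normal_moment_even[of 0] integral_std_normal_moment_even[of 1]
      integral_std_normal_moment_odd[of 0] by simp_all
qed


locale gaussian_limit =
  fixes w :: "nat \<Rightarrow> real \<Rightarrow> real" and D :: real
  assumes w_measurable [measurable]: "\<And>n. w n \<in> borel_measurable borel"
    and w_nonneg: "\<And>n z. 0 \<le> w n z"
    and w_lim: "\<And>z. (\<lambda>n. w n z) \<longlonglongrightarrow> exp (- z\<^sup>2 / 2)"
    and w_bound: "\<forall>\<^sub>F n in sequentially. \<forall>z. w n z \<le> D * exp (- \<bar>z\<bar> / 8)"
begin

definition moment :: "nat \<Rightarrow> nat \<Rightarrow> real" where
  "moment k n = (\<integral>z. z ^ k * w n z \<partial>lborel)"

lemma eventually_integrable_moments: "\<forall>\<^sub>F n in sequentially. \<forall>k. integrable lborel (\<lambda>z. z ^ k * w n z)"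
  and moment_lim: "moment k \<longlonglongrightarrow> (\<integral>z. z ^ k * exp (- z\<^sup>2 / 2) \<partial>lborel)"
proof -
  have I: "integrable lborel (\<lambda>z. D * (\<bar>z\<bar> ^ k * exp (- \<bar>z\<bar> / 8)))" for k
    by (intro integrable_mult_right integrable_power_exp_abs) simp
  have le: "norm (z ^ k * w n z) \<le> D * (\<bar>z\<bar> ^ k * exp (- \<bar>z\<bar> / 8))" if "\<forall>z. w n z \<le> D * exp (- \<bar>z\<bar> / 8)" for n k z
  proof -
    have "norm (z ^ k * w n z) = \<bar>z\<bar> ^ k * w n z" using w_nonneg by (simp add: abs_mult power_abs)
    also have "\<dots> \<le> \<bar>z\<bar> ^ k * (D * exp (- \<bar>z\<bar> / 8))" using that by (intro mult_left_mono) auto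
    finally show ?thesis by (simp only: mult_ac)
  qed
  show "\<forall>\<^sub>F n in sequentially. \<forall>k. integrable lborel (\<lambda>z. z ^ k * w n z)"
    using w_bound
  proof eventually_elim
    case (elim n)
    have "integrable lborel (\<lambda>z. z ^ k * w n z)" for k
    proof (rule Bochner_Integration.integrable_bound[OF I[of k]])
      show "AE z in lborel. norm (z ^ k * w n z) \<le> norm (D * (\<bar>z\<bar> ^ k * exp (- \<bar>z\<bar> / 8)))"
        using order_trans[OF le[OF elim] abs_ge_self] by (intro AE_I2) (simp only: real_norm_def)
    qed simp
    then show ?case by blast
  qed
  from w_bound obtain m where m: "\<And>n. n \<ge> m \<Longrightarrow> \<forall>z. w n z \<le> D * exp (- \<bar>z\<bar> / 8)"
    unfolding eventually_sequentially by blast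
  have "(\<lambda>n. \<integral>z. z ^ k * w (n + m) z \<partial>lborel) \<longlonglongrightarrow> (\<integral>z. z ^ k * exp (- z\<^sup>2 / 2) \<partial>lborel)"
  proof (rule integral_dominated_convergence[OF _ _ I[of k]])
    show "AE z in lborel. (\<lambda>n. z ^ k * w (n + m) z) \<longlonglongrightarrow> z ^ k * exp (- z\<^sup>2 / 2)"
      by (intro AE_I2 tendsto_intros LIMSEQ_ignore_initial_segment w_lim)
    show "AE z in lborel. norm (z ^ k * w (n + m) z) \<le> D * (\<bar>z\<bar> ^ k * exp (- \<bar>z\<bar> / 8))" for n
      by (intro AE_I2 le m) simp
  qed measurable
  then show "moment k \<longlonglongrightarrow> (\<integral>z. z ^ k * exp (- z\<^sup>2 / 2) \<partial>lborel)"
    unfolding moment_def[abs_def] by (rule LIMSEQ_offset)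
qed

definition mean :: "nat \<Rightarrow> real" where
  "mean n = moment 1 n / moment 0 n"

definition dev :: "nat \<Rightarrow> real" where
  "dev n = sqrt (moment 2 n / moment 0 n - (mean n)\<^sup>2)"

definition f :: "nat \<Rightarrow> real \<Rightarrow> real" where
  "f n z = dev n * (w n (mean n + dev n * z) / moment 0 n)"

definition \<kappa> :: "nat \<Rightarrow> real" where
  "\<kappa> n = (\<integral>x. (1 + \<bar>x\<bar> ^ 3) * \<bar>f n x - std_normal_density x\<bar> \<partial>lborel)"

lemma moment0_lim: "moment 0 \<longlonglongrightarrow> sqrt (2 * pi)"
  using moment_lim[of 0] gaussian_moments(1) by simp

lemma mean_lim: "mean \<longlonglongrightarrow> 0"
proof -
  have "(\<lambda>n. moment 1 n / moment 0 n) \<longlonglongrightarrow> 0 / sqrt (2 * pi)"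
    using moment_lim[of 1] gaussian_moments(2) by (intro tendsto_divide moment0_lim) auto
  then show ?thesis unfolding mean_def[abs_def] by simp
qed

lemma dev_lim: "dev \<longlonglongrightarrow> 1"
proof -
  have "(\<lambda>n. sqrt (moment 2 n / moment 0 n - (mean n)\<^sup>2)) \<longlonglongrightarrow> sqrt (sqrt (2 * pi) / sqrt (2 * pi) - 0\<^sup>2)"
    using moment_lim[of 2] gaussian_moments(3)
    by (intro tendsto_real_sqrt tendsto_diff tendsto_divide tendsto_power moment0_lim mean_lim) auto
  then show ?thesis unfolding dev_def[abs_def] by simp
qed

text \<open>The limits \<open>sqrt (2 * pi)\<close>, \<open>0\<close> and \<open>1\<close> of mass,
  mean and deviation lie strictly inside the listed bounds. Fixed constants make the later majorants
  independent of \<open>n\<close>.\<close>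

lemma eventually_normalized:
  "\<forall>\<^sub>F n in sequentially. 1 \<le> moment 0 n \<and> \<bar>mean n\<bar> \<le> 1 \<and> 1 / 2 \<le> dev n \<and> dev n \<le> 2 \<and>
    (\<forall>k. integrable lborel (\<lambda>z. z ^ k * w n z)) \<and> (\<forall>z. w n z \<le> D * exp (- \<bar>z\<bar> / 8))"
proof -
  have "1 < sqrt (2 * pi)" using pi_ge_two by simp
  then have "\<forall>\<^sub>F n in sequentially. 1 < moment 0 n" by (rule order_tendstoD[OF moment0_lim])
  moreover have "\<forall>\<^sub>F n in sequentially. 1 / 2 < dev n" "\<forall>\<^sub>F n in sequentially. dev n < 2"
    by (rule order_tendstoD[OF dev_lim], simp)+
  moreover have "\<forall>\<^sub>F n in sequentially. - 1 < mean n" "\<forall>\<^sub>F n in sequentially. mean n < 1"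
    by (rule order_tendstoD[OF mean_lim], simp)+
  ultimately show ?thesis
    using eventually_integrable_moments w_bound by eventually_elim auto
qed

lemma f_nonneg:
  assumes "1 \<le> moment 0 n" "1 / 2 \<le> dev n"
  shows "0 \<le> f n z"
  using assms w_nonneg unfolding f_def by simp

lemma f_measurable [measurable]: "f n \<in> borel_measurable borel"
  unfolding f_def by measurable

lemma has_bochner_integral_f:
  assumes "1 / 2 \<le> dev n"
    and "has_bochner_integral lborel (\<lambda>y. w n y / moment 0 n * \<phi> ((y - mean n) / dev n)) X"
  shows "has_bochner_integral lborel (\<lambda>z. f n z * \<phi> z) X"
proof -
  let ?G = "\<lambda>y. w n y / moment 0 n * \<phi> ((y - mean n) / dev n)"
  have "has_bochner_integral lborel (\<lambda>z. ?G (mean n + dev n * z)) (X /\<^sub>R \<bar>dev n\<bar>)"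
    using assms by (intro lborel_has_bochner_integral_real_affine_iff[THEN iffD1]) auto
  then have "has_bochner_integral lborel (\<lambda>z. dev n * ?G (mean n + dev n * z)) (dev n * (X /\<^sub>R \<bar>dev n\<bar>))"
    by (rule has_bochner_integral_mult_right)
  then show ?thesis using assms(1) by (simp add: f_def mult_ac)
qed

lemma f_moments:
  assumes m: "1 \<le> moment 0 n" "1 / 2 \<le> dev n" and I: "\<And>k. integrable lborel (\<lambda>z. z ^ k * w n z)"
  shows "has_bochner_integral lborel (f n) 1"
    and "has_bochner_integral lborel (\<lambda>z. f n z * z) 0"
    and "has_bochner_integral lborel (\<lambda>z. f n z * z\<^sup>2) 1"
proof -
  let ?m = "moment 0 n" and ?b = "mean n" and ?r = "dev n"
  have H: "has_bochner_integral lborel (\<lambda>z. z ^ k * w n z) (moment k n)" for k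
    using I[of k] by (simp add: moment_def has_bochner_integral_iff)
  have H0: "has_bochner_integral lborel (w n) ?m" using H[of 0] by simp
  have H1: "has_bochner_integral lborel (\<lambda>z. z * w n z) (?b * ?m)" using H[of 1] m by (simp add: mean_def)
  \<comment> \<open>Since \<open>sqrt\<close> keeps the sign of its argument, positivity of
    \<open>dev n\<close> forces a positive radicand, and the root can be squared away.\<close>
  have "moment 2 n / ?m - ?b\<^sup>2 = ?r\<^sup>2"
  proof -
    have "sqrt (moment 2 n / ?m - ?b\<^sup>2) > 0" using m(2) unfolding dev_def by linarith
    then show ?thesis unfolding dev_def by simp
  qed
  then have m2: "moment 2 n = (?r\<^sup>2 + ?b\<^sup>2) * ?m" using m by (simp add: field_simps)
  have H2: "has_bochner_integral lborel (\<lambda>z. z\<^sup>2 * w n z) ((?r\<^sup>2 + ?b\<^sup>2) * ?m)" using H[of 2] m2 by simp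
  have "has_bochner_integral lborel (\<lambda>y. w n y / ?m * 1) 1"
    using has_bochner_integral_divide_zero[OF H0, of ?m] m by simp
  then show "has_bochner_integral lborel (f n) 1"
    using has_bochner_integral_f[OF m(2), of "\<lambda>_. 1"] by simp
  have "has_bochner_integral lborel (\<lambda>y. (y * w n y - ?b * w n y) / (?m * ?r)) ((?b * ?m - ?b * ?m) / (?m * ?r))"
    by (intro has_bochner_integral_divide_zero has_bochner_integral_diff has_bochner_integral_mult_right H0 H1)
  also have "(\<lambda>y. (y * w n y - ?b * w n y) / (?m * ?r)) = (\<lambda>y. w n y / ?m * ((y - ?b) / ?r))"
    by (simp add: fun_eq_iff field_simps)
  finally show "has_bochner_integral lborel (\<lambda>z. f n z * z) 0"
    using has_bochner_integral_f[OF m(2), of "\<lambda>z. z"] by simp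
  have "has_bochner_integral lborel (\<lambda>y. (y\<^sup>2 * w n y - 2 * ?b * (y * w n y) + ?b\<^sup>2 * w n y) / (?m * ?r\<^sup>2))
      (((?r\<^sup>2 + ?b\<^sup>2) * ?m - 2 * ?b * (?b * ?m) + ?b\<^sup>2 * ?m) / (?m * ?r\<^sup>2))"
    by (intro has_bochner_integral_divide_zero has_bochner_integral_diff has_bochner_integral_add
        has_bochner_integral_mult_right H0 H1 H2)
  also have "(\<lambda>y. (y\<^sup>2 * w n y - 2 * ?b * (y * w n y) + ?b\<^sup>2 * w n y) / (?m * ?r\<^sup>2)) = (\<lambda>y. w n y / ?m * ((y - ?b) / ?r)\<^sup>2)"
    using m by (auto simp: fun_eq_iff power2_eq_square field_simps)
  also have "((?r\<^sup>2 + ?b\<^sup>2) * ?m - 2 * ?b * (?b * ?m) + ?b\<^sup>2 * ?m) / (?m * ?r\<^sup>2) = 1"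
  proof -
    have "(?r\<^sup>2 + ?b\<^sup>2) * ?m - 2 * ?b * (?b * ?m) + ?b\<^sup>2 * ?m = ?m * ?r\<^sup>2" by (simp add: power2_eq_square algebra_simps)
    then show ?thesis using m by simp
  qed
  finally show "has_bochner_integral lborel (\<lambda>z. f n z * z\<^sup>2) 1"
    using has_bochner_integral_f[OF m(2), of "\<lambda>z. z\<^sup>2"] by simp
qed

lemma D_nonneg: "0 \<le> D"
proof -
  obtain n where "\<forall>z. w n z \<le> D * exp (- \<bar>z\<bar> / 8)"
    using w_bound by (auto simp: eventually_sequentially)
  then have "0 \<le> D * exp (- \<bar>0\<bar> / 8)" using w_nonneg order_trans by blast
  then show ?thesis by simp
qed

lemma f_le:
  assumes "1 \<le> moment 0 n" "dev n \<le> 2" "1 / 2 \<le> dev n" "\<And>z. w n z \<le> D * exp (- \<bar>z\<bar> / 8)"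
  shows "f n z \<le> 2 * D"
proof -
  let ?y = "mean n + dev n * z"
  have "w n ?y \<le> D * 1"
    by (rule order_trans[OF assms(4)]) (use D_nonneg in \<open>intro mult_left_mono, auto\<close>)
  then have "w n ?y / moment 0 n \<le> D / 1"
    using assms D_nonneg by (intro frac_le) auto
  then show ?thesis
    unfolding f_def using assms w_nonneg D_nonneg by (intro mult_mono) auto
qed

text \<open>After the substitution \<open>y = mean n + dev n * z\<close> the affine map acts on the normal density only, so
  that pointwise convergence of \<open>w\<close> suffices.\<close>

lemma
  shows eventually_integrable_\<kappa>: "\<forall>\<^sub>F n in sequentially. integrable lborel (\<lambda>x. (1 + \<bar>x\<bar> ^ 3) * \<bar>f n x - std_normal_density x\<bar>)"
    and \<kappa>_lim: "\<kappa> \<longlonglongrightarrow> 0"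
proof -
  define K where "K n y = (1 + \<bar>(y - mean n) / dev n\<bar> ^ 3) * \<bar>w n y / moment 0 n - std_normal_density ((y - mean n) / dev n) / dev n\<bar>" for n y
  \<comment> \<open>\<open>D\<close> accounts for \<open>w n\<close>, and \<open>2 * exp 1\<close>
    for the rescaled normal density, the \<open>2\<close> coming from
    \<open>dev n \<ge> 1 / 2\<close>.\<close>
  define E where "E = D + 2 * exp 1"
  let ?H = "\<lambda>y. 33 * E * (\<bar>y\<bar> ^ 0 * exp (- \<bar>y\<bar> / 8)) + 32 * E * (\<bar>y\<bar> ^ 3 * exp (- \<bar>y\<bar> / 8))"
  have H: "integrable lborel ?H"
    by (intro Bochner_Integration.integrable_add integrable_mult_right integrable_power_exp_abs) auto
  have [measurable]: "K n \<in> borel_measurable borel" for n unfolding K_def by measurable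
  have bound: "\<bar>K n y\<bar> \<le> ?H y"
    if n: "1 \<le> moment 0 n" "\<bar>mean n\<bar> \<le> 1" "1 / 2 \<le> dev n" "dev n \<le> 2" "\<forall>z. w n z \<le> D * exp (- \<bar>z\<bar> / 8)" for n y
  proof -
    let ?u = "(y - mean n) / dev n"
    have u1: "\<bar>?u\<bar> \<le> 2 * (\<bar>y\<bar> + 1)"
    proof -
      have "\<bar>y - mean n\<bar> / dev n \<le> (\<bar>y\<bar> + 1) / (1 / 2)" using n by (intro frac_le) auto
      then show ?thesis using n by simp
    qed
    have u2: "(\<bar>y\<bar> - 1) / 2 \<le> \<bar>?u\<bar>"
    proof -
      have "(\<bar>y\<bar> - 1) / 2 \<le> \<bar>y - mean n\<bar> / 2" using n(2) abs_triangle_ineq2[of y "mean n"] by simp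
      also have "\<dots> \<le> \<bar>y - mean n\<bar> / dev n" using n by (intro divide_left_mono) auto
      finally show ?thesis using n by simp
    qed
    have "\<bar>u\<bar> - 1 / 2 \<le> u\<^sup>2 / 2" for u :: real
      using zero_le_power2[of "\<bar>u\<bar> - 1"] by (simp add: power2_diff)
    \<comment> \<open>A tangent line to the parabola replaces Gaussian by exponential decay, which
      survives the moving affine map:
      \<open>1 / 2 - (\<bar>y\<bar> - 1) / 2 = 1 - \<bar>y\<bar> / 2\<close>.\<close>
    from this[of ?u] have "- ?u\<^sup>2 / 2 \<le> 1 + (- \<bar>y\<bar> / 8)" using u2 by simp
    then have ex: "exp (- ?u\<^sup>2 / 2) \<le> exp 1 * exp (- \<bar>y\<bar> / 8)" unfolding exp_add[symmetric] by simp
    have "std_normal_density ?u \<le> exp (- ?u\<^sup>2 / 2)"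
    proof -
      have "1 \<le> sqrt (2 * pi)" using pi_ge_two by simp
      then have "1 / sqrt (2 * pi) * exp (- ?u\<^sup>2 / 2) \<le> 1 * exp (- ?u\<^sup>2 / 2)"
        by (intro mult_right_mono) auto
      then show ?thesis unfolding std_normal_density_def by simp
    qed
    with ex have "std_normal_density ?u / dev n \<le> exp 1 * exp (- \<bar>y\<bar> / 8) / (1 / 2)"
      using n by (intro frac_le) auto
    then have g: "std_normal_density ?u / dev n \<le> 2 * exp 1 * exp (- \<bar>y\<bar> / 8)" by simp
    have "w n y / moment 0 n \<le> D * exp (- \<bar>y\<bar> / 8) / 1"
      using n D_nonneg by (intro frac_le) auto
    with g have d: "\<bar>w n y / moment 0 n - std_normal_density ?u / dev n\<bar> \<le> E * exp (- \<bar>y\<bar> / 8)"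
    proof -
      have "0 \<le> w n y / moment 0 n" "0 \<le> std_normal_density ?u / dev n" using n w_nonneg by simp_all
      then show ?thesis using g \<open>w n y / moment 0 n \<le> D * exp (- \<bar>y\<bar> / 8) / 1\<close>
        unfolding E_def distrib_right by linarith
    qed
    have "\<bar>?u\<bar> ^ 3 \<le> (2 * (\<bar>y\<bar> + 1)) ^ 3" by (rule power_mono[OF u1]) simp
    also have "\<dots> \<le> 32 * (\<bar>y\<bar> ^ 3 + 1)"
    proof -
      \<comment> \<open>With \<open>b = \<bar>y\<bar>\<close> one has
        \<open>4 * (b^3 + 1) - (b + 1)^3 = 3 * (b - 1)^2 * (b + 1)\<close>; multiplied by
        \<open>2^3\<close> this gives the constant \<open>32\<close>.\<close>
      have "0 \<le> (\<bar>y\<bar> - 1)\<^sup>2 * (\<bar>y\<bar> + 1)" by simp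
      then show ?thesis by (simp add: power2_eq_square power3_eq_cube algebra_simps)
    qed
    finally have c: "1 + \<bar>?u\<bar> ^ 3 \<le> 33 + 32 * \<bar>y\<bar> ^ 3" by simp
    have "\<bar>K n y\<bar> = (1 + \<bar>?u\<bar> ^ 3) * \<bar>w n y / moment 0 n - std_normal_density ?u / dev n\<bar>"
      unfolding K_def by (simp only: abs_mult abs_idempotent) simp
    also have "\<dots> \<le> (33 + 32 * \<bar>y\<bar> ^ 3) * (E * exp (- \<bar>y\<bar> / 8))"
      by (intro mult_mono c d) auto
    also have "\<dots> = ?H y" by (simp add: algebra_simps)
    finally show ?thesis .
  qed
  have lim: "(\<lambda>n. K n y) \<longlonglongrightarrow> 0" for y
  proof -
    have "(\<lambda>n. K n y) \<longlonglongrightarrow> (1 + \<bar>(y - 0) / 1\<bar> ^ 3) * \<bar>exp (- y\<^sup>2 / 2) / sqrt (2 * pi) - std_normal_density ((y - 0) / 1) / 1\<bar>"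
      unfolding K_def std_normal_density_def
      by (intro tendsto_intros mean_lim dev_lim w_lim moment0_lim) auto
    then show ?thesis by (simp add: std_normal_density_def)
  qed
  have fK: "(1 + \<bar>x\<bar> ^ 3) * \<bar>f n x - std_normal_density x\<bar> = dev n * K n (mean n + dev n * x)" if "1 / 2 \<le> dev n" for n x
  proof -
    have r: "dev n > 0" using that by simp
    have "dev n * \<bar>w n (mean n + dev n * x) / moment 0 n - std_normal_density x / dev n\<bar> = \<bar>f n x - std_normal_density x\<bar>"
    proof -
      have "r * \<bar>a - b / r\<bar> = \<bar>r * a - b\<bar>" if "r > 0" for r a b :: real
      proof -
        have "r * a - b = r * (a - b / r)" using that by (simp add: field_simps)
        then show ?thesis using that by (simp only: abs_mult abs_of_pos)
      qed
      then show ?thesis using r unfolding f_def by blast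
    qed
    moreover have "(mean n + dev n * x - mean n) / dev n = x" using r by simp
    ultimately show ?thesis unfolding K_def by (metis mult.left_commute)
  qed
  have ev: "\<forall>\<^sub>F n in sequentially. integrable lborel (K n) \<and> 1 / 2 \<le> dev n \<and> (\<forall>y. \<bar>K n y\<bar> \<le> ?H y)"
    using eventually_normalized
  proof eventually_elim
    case (elim n)
    then have b: "\<forall>y. \<bar>K n y\<bar> \<le> ?H y" using bound by blast
    have "integrable lborel (K n)"
    proof (rule Bochner_Integration.integrable_bound[OF H])
      show "AE y in lborel. norm (K n y) \<le> norm (?H y)"
        using order_trans[OF b[rule_format] abs_ge_self] by (intro AE_I2) (simp only: real_norm_def)
    qed simp
    with elim b show ?case by blast
  qed
  show "\<forall>\<^sub>F n in sequentially. integrable lborel (\<lambda>x. (1 + \<bar>x\<bar> ^ 3) * \<bar>f n x - std_normal_density x\<bar>)"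
    using ev
  proof eventually_elim
    case (elim n)
    then have "integrable lborel (\<lambda>x. dev n * K n (mean n + dev n * x))"
      by (intro integrable_mult_right lborel_integrable_real_affine) auto
    then show ?case using fK[of n] elim by simp
  qed
  from ev have \<kappa>: "\<forall>\<^sub>F n in sequentially. (\<integral>y. K n y \<partial>lborel) = \<kappa> n"
  proof eventually_elim
    case (elim n)
    then have "\<kappa> n = dev n * (\<integral>x. K n (mean n + dev n * x) \<partial>lborel)"
      unfolding \<kappa>_def using fK[of n] by simp
    also have "\<dots> = (\<integral>y. K n y \<partial>lborel)"
      using elim lborel_integral_real_affine[of "dev n" "K n" "mean n"] by simp
    finally show ?case by simp
  qed
  obtain m where m: "\<And>n. n \<ge> m \<Longrightarrow> \<forall>y. \<bar>K n y\<bar> \<le> ?H y"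
    using ev unfolding eventually_sequentially by blast
  have "(\<lambda>n. \<integral>y. K (n + m) y \<partial>lborel) \<longlonglongrightarrow> (\<integral>y. 0 \<partial>(lborel :: real measure))"
  proof (rule integral_dominated_convergence[OF _ _ H])
    show "AE y in lborel. (\<lambda>n. K (n + m) y) \<longlonglongrightarrow> 0"
      by (intro AE_I2 LIMSEQ_ignore_initial_segment lim)
    show "AE y in lborel. norm (K (n + m) y) \<le> ?H y" for n
      using m[of "n + m"] by (intro AE_I2) simp
  qed measurable
  then have "(\<lambda>n. \<integral>y. K n y \<partial>lborel) \<longlonglongrightarrow> 0"
    using LIMSEQ_offset[of "\<lambda>n. \<integral>y. K n y \<partial>lborel" m 0] by simp
  then show "\<kappa> \<longlonglongrightarrow> 0" using \<kappa> by (rule Lim_transform_eventually)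
qed

end

section \<open>Regularly and rapidly varying functions\<close>

lemma mvt_between:
  fixes F F' :: "real \<Rightarrow> real"
  assumes "\<And>y. \<bar>y - u\<bar> \<le> \<bar>\<delta>\<bar> \<Longrightarrow> (F has_real_derivative F' y) (at y)"
  shows "\<exists>\<xi>. \<bar>\<xi> - u\<bar> \<le> \<bar>\<delta>\<bar> \<and> F (u + \<delta>) - F u = \<delta> * F' \<xi>"
proof -
  consider "\<delta> = 0" | "\<delta> > 0" | "\<delta> < 0" by linarith
  then show ?thesis
  proof cases
    case 1
    then show ?thesis by (intro exI[of _ u]) auto
  next
    case 2
    then obtain \<xi> where "u < \<xi>" "\<xi> < u + \<delta>" "F (u + \<delta>) - F u = (u + \<delta> - u) * F' \<xi>"
      using MVT2[of u "u + \<delta>" F F'] assms by auto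
    then show ?thesis by (intro exI[of _ \<xi>]) auto
  next
    case 3
    then obtain \<xi> where "u + \<delta> < \<xi>" "\<xi> < u" "F u - F (u + \<delta>) = (u - (u + \<delta>)) * F' \<xi>"
      using MVT2[of "u + \<delta>" u F F'] assms by auto
    then show ?thesis by (intro exI[of _ \<xi>]) auto
  qed
qed

text \<open>The logarithmic derivative of \<open>F\<close> is at most \<open>C / y\<close>. Once
  \<open>v n\<close> is within \<open>u n / 2\<close> of \<open>u n\<close>, all intermediate points
  exceed \<open>u n / 2\<close>, so \<open>ln F\<close> changes by at most
  \<open>2 * C * \<bar>v n / u n - 1\<bar>\<close>.\<close>

lemma slowly_varying_ratio:
  fixes F F' :: "real \<Rightarrow> real" and u v :: "nat \<Rightarrow> real"
  assumes F: "\<And>y. y > X \<Longrightarrow> (F has_real_derivative F' y) (at y)"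
    and pos: "\<And>y. y > X \<Longrightarrow> F y > 0"
    and F': "\<And>y. y > X \<Longrightarrow> \<bar>y * F' y\<bar> \<le> C * F y"
    and u: "filterlim u at_top sequentially" and v: "(\<lambda>n. v n / u n) \<longlonglongrightarrow> 1"
  shows "(\<lambda>n. F (v n) / F (u n)) \<longlonglongrightarrow> 1"
proof -
  have large: "\<forall>\<^sub>F n in sequentially. 2 * \<bar>X\<bar> + 2 < u n" using u by (simp add: filterlim_at_top_dense)
  have near: "\<forall>\<^sub>F n in sequentially. \<bar>v n / u n - 1\<bar> < 1 / 2"
    using tendstoD[OF v, of "1 / 2"] by (simp add: dist_real_def)
  have "(\<lambda>n. ln (F (v n)) - ln (F (u n))) \<longlonglongrightarrow> 0"
  proof (rule Lim_null_comparison)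
    have "(\<lambda>n. 2 * C * \<bar>v n / u n - 1\<bar>) \<longlonglongrightarrow> 2 * C * \<bar>1 - 1\<bar>" by (intro tendsto_intros v)
    then show "(\<lambda>n. 2 * C * \<bar>v n / u n - 1\<bar>) \<longlonglongrightarrow> 0" by simp
    show "\<forall>\<^sub>F n in sequentially. norm (ln (F (v n)) - ln (F (u n))) \<le> 2 * C * \<bar>v n / u n - 1\<bar>"
      using large near
    proof eventually_elim
      case (elim n)
      let ?d = "v n - u n"
      have u0: "u n > 0" using elim by auto
      have d: "\<bar>?d\<bar> = u n * \<bar>v n / u n - 1\<bar>" 
      proof -
        have "?d = u n * (v n / u n - 1)" using u0 by (simp add: right_diff_distrib)
        then show ?thesis using u0 by (simp only: abs_mult abs_of_pos)
      qed
      have "u n * \<bar>v n / u n - 1\<bar> \<le> u n * (1 / 2)" using elim u0 by (intro mult_left_mono) auto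
      then have d2: "\<bar>?d\<bar> \<le> u n / 2" using d by simp
      have big: "y \<ge> u n / 2 \<and> y > X" if "\<bar>y - u n\<bar> \<le> \<bar>?d\<bar>" for y
      proof -
        have "- (y - u n) \<le> u n / 2" by (rule abs_le_D2[OF order_trans[OF that d2]])
        moreover have "X \<le> \<bar>X\<bar>" by simp
        ultimately show ?thesis using elim(1) by simp
      qed
      have "((\<lambda>y. ln (F y)) has_real_derivative F' y / F y) (at y)" if "\<bar>y - u n\<bar> \<le> \<bar>?d\<bar>" for y
        using big[OF that] by (auto intro!: derivative_eq_intros F pos)
      from mvt_between[of "u n" ?d, OF this] obtain \<xi> where \<xi>: "\<bar>\<xi> - u n\<bar> \<le> \<bar>?d\<bar>"
        "ln (F (v n)) - ln (F (u n)) = ?d * (F' \<xi> / F \<xi>)" by auto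
      have \<xi>X: "\<xi> > X" "\<xi> \<ge> u n / 2" using big[OF \<xi>(1)] by auto
      have "\<bar>F' \<xi> / F \<xi>\<bar> \<le> C / \<xi>"
        using F'[OF \<xi>X(1)] pos[OF \<xi>X(1)] \<xi>X u0 by (simp add: field_simps abs_mult)
      moreover have "0 \<le> C"
        using order_trans[OF abs_ge_zero F'[OF \<xi>X(1)]] pos[OF \<xi>X(1)] by (simp add: zero_le_mult_iff)
      ultimately have "\<bar>F' \<xi> / F \<xi>\<bar> \<le> C / (u n / 2)"
        using \<xi>X u0 by (elim order_trans) (intro divide_left_mono, auto)
      then have "\<bar>?d * (F' \<xi> / F \<xi>)\<bar> \<le> \<bar>?d\<bar> * (C / (u n / 2))" unfolding abs_mult by (intro mult_left_mono) auto
      also have "\<dots> = 2 * C * \<bar>v n / u n - 1\<bar>" unfolding d using u0 by simp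
      finally show ?case using \<xi> by simp
    qed
  qed
  then have "(\<lambda>n. exp (ln (F (v n)) - ln (F (u n)))) \<longlonglongrightarrow> exp 0" by (intro tendsto_intros)
  moreover have "\<forall>\<^sub>F n in sequentially. exp (ln (F (v n)) - ln (F (u n))) = F (v n) / F (u n)"
    using large near
  proof eventually_elim
    case (elim n)
    have "u n > X" using elim by auto
    have "u n > 0" using elim by auto
    moreover have "1 / 2 < v n / u n" using elim(2) unfolding abs_less_iff by linarith
    ultimately have "u n * (1 / 2) < u n * (v n / u n)" by (intro mult_strict_left_mono)
    then have "u n / 2 < v n" using \<open>u n > 0\<close> by simp
    then have "v n > X" using elim by auto
    then show ?case using pos[of "u n"] pos[of "v n"] \<open>u n > X\<close> by (simp add: exp_diff)
  qed
  ultimately show ?thesis by (auto elim: Lim_transform_eventually)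
qed

text \<open>By the mean value theorem the increment is \<open>\<delta> n\<close> times the
  derivative at an intermediate point. That point is asymptotic to \<open>u n\<close> because
  \<open>\<delta> n\<close> is of smaller order, so \<open>ratio\<close> replaces it by
  \<open>u n\<close>.\<close>

lemma increment_asymp:
  fixes F F' :: "real \<Rightarrow> real" and u \<delta> :: "nat \<Rightarrow> real"
  assumes F: "\<And>y. y > X \<Longrightarrow> (F has_real_derivative F' y) (at y)"
    and u: "filterlim u at_top sequentially" and \<delta>: "(\<lambda>n. \<delta> n / u n) \<longlonglongrightarrow> 0"
    and ratio: "\<And>v. (\<lambda>n. v n / u n) \<longlonglongrightarrow> 1 \<Longrightarrow> (\<lambda>n. F' (v n) / F' (u n)) \<longlonglongrightarrow> 1"
    and F'0: "\<forall>\<^sub>F n in sequentially. F' (u n) \<noteq> 0"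
  obtains \<rho> where "\<rho> \<longlonglongrightarrow> 1" "\<forall>\<^sub>F n in sequentially. F (u n + \<delta> n) - F (u n) = \<delta> n * F' (u n) * \<rho> n"
proof -
  have ev: "\<forall>\<^sub>F n in sequentially. \<exists>\<xi>. \<bar>\<xi> - u n\<bar> \<le> \<bar>\<delta> n\<bar> \<and> F (u n + \<delta> n) - F (u n) = \<delta> n * F' \<xi>"
  proof -
    have "\<forall>\<^sub>F n in sequentially. 2 * \<bar>X\<bar> + 2 < u n" using u by (simp add: filterlim_at_top_dense)
    moreover have "\<forall>\<^sub>F n in sequentially. \<bar>\<delta> n / u n\<bar> < 1 / 2"
      using tendstoD[OF \<delta>, of "1 / 2"] by simp
    ultimately show ?thesis
    proof eventually_elim
      case (elim n)
      then have "\<bar>\<delta> n\<bar> < u n / 2" by (simp add: abs_divide field_simps)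
      then have "y > X" if "\<bar>y - u n\<bar> \<le> \<bar>\<delta> n\<bar>" for y
      proof -
        have "- (y - u n) \<le> \<bar>\<delta> n\<bar>" by (rule abs_le_D2[OF that])
        moreover have "X \<le> \<bar>X\<bar>" by simp
        ultimately show ?thesis using elim(1) \<open>\<bar>\<delta> n\<bar> < u n / 2\<close> by simp
      qed
      then show ?case by (intro mvt_between F)
    qed
  qed
  then obtain \<xi> where \<xi>: "\<forall>\<^sub>F n in sequentially. \<bar>\<xi> n - u n\<bar> \<le> \<bar>\<delta> n\<bar> \<and> F (u n + \<delta> n) - F (u n) = \<delta> n * F' (\<xi> n)"
    unfolding eventually_ex by blast
  show thesis
  proof
    show "(\<lambda>n. F' (\<xi> n) / F' (u n)) \<longlonglongrightarrow> 1"
    proof (rule ratio)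
      have "(\<lambda>n. \<xi> n / u n - 1) \<longlonglongrightarrow> 0"
      proof (rule Lim_null_comparison)
        show "(\<lambda>n. \<bar>\<delta> n / u n\<bar>) \<longlonglongrightarrow> 0" using tendsto_rabs[OF \<delta>] by simp
        have "\<forall>\<^sub>F n in sequentially. 0 < u n" using u by (simp add: filterlim_at_top_dense)
        with \<xi> show "\<forall>\<^sub>F n in sequentially. norm (\<xi> n / u n - 1) \<le> \<bar>\<delta> n / u n\<bar>"
        proof eventually_elim
          case (elim n)
          have "\<xi> n / u n - 1 = (\<xi> n - u n) / u n" using elim by (simp add: diff_divide_distrib)
          then show ?case using elim by (simp add: abs_divide divide_right_mono)
        qed
      qed
      then show "(\<lambda>n. \<xi> n / u n) \<longlonglongrightarrow> 1" by (simp add: LIM_zero_iff)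
    qed
    show "\<forall>\<^sub>F n in sequentially. F (u n + \<delta> n) - F (u n) = \<delta> n * F' (u n) * (F' (\<xi> n) / F' (u n))"
      using \<xi> F'0 by eventually_elim auto
  qed
qed

lemma filterlim_powr_at_top:
  fixes a :: real
  assumes "a > 0"
  shows "filterlim (\<lambda>x. x powr a) at_top at_top"
proof -
  have "filterlim (\<lambda>x. exp (a * ln x)) at_top at_top"
    by (intro filterlim_compose[OF exp_at_top] filterlim_tendsto_pos_mult_at_top[OF tendsto_const assms] ln_at_top)
  moreover have "\<forall>\<^sub>F x in at_top. exp (a * ln x) = x powr a"
    using eventually_gt_at_top[of 0] by eventually_elim (simp add: powr_def)
  ultimately show ?thesis by (simp add: filterlim_cong)
qed

text \<open>In Karamata's representation \<open>e\<close> is the derivative of \<open>ln l\<close>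
  with respect to \<open>ln x\<close>. Derivatives are taken at \<open>x > 1\<close>, where the
  one-sided derivatives of the representation are two-sided.\<close>

lemma R0_rep_deriv:
  assumes "R0_rep l e e1 e2"
  shows "x > 1 \<Longrightarrow> (e has_real_derivative e1 x) (at x)"
    and "x > 1 \<Longrightarrow> (l has_real_derivative l x * e x / x) (at x)"
    and "x \<ge> 1 \<Longrightarrow> l x > 0"
    and "(e \<longlongrightarrow> 0) at_top"
proof -
  have e: "\<And>x. x \<ge> 1 \<Longrightarrow> (e has_real_derivative e1 x) (at x within {1..})"
    and l: "\<And>x. x \<ge> 1 \<Longrightarrow> l x = exp (integral {1..x} (\<lambda>u. e u / u))"
    using assms by (auto simp: R0_rep_def)
  show "(e \<longlongrightarrow> 0) at_top" using assms by (simp add: R0_rep_def)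
  show "l x > 0" if "x \<ge> 1" using l[OF that] by simp
  have win: "at x within {1..} = at x" if "x > 1" for x :: real
    using that by (intro at_within_interior) simp
  show "(e has_real_derivative e1 x) (at x)" if "x > 1" using e[of x] that by (simp add: win)
  show "(l has_real_derivative l x * e x / x) (at x)" if x: "x > 1"
  proof -
    have "continuous_on {1..} e"
      by (rule DERIV_continuous_on) (use e in auto)
    then have "continuous_on {1..x + 1} (\<lambda>u. e u / u)"
      by (intro continuous_intros) (auto elim: continuous_on_subset)
    then have "((\<lambda>x. integral {1..x} (\<lambda>u. e u / u)) has_real_derivative e x / x) (at x within {1..x + 1})"
      using x by (intro integral_has_real_derivative) auto
    moreover have "at x within {1..x + 1} = at x"
      using x by (intro at_within_interior) simp
    ultimately have "((\<lambda>x. exp (integral {1..x} (\<lambda>u. e u / u))) has_real_derivative l x * (e x / x)) (at x)"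
      using l[of x] x by (auto intro!: derivative_eq_intros)
    moreover have "\<forall>\<^sub>F y in nhds x. exp (integral {1..y} (\<lambda>u. e u / u)) = l y"
      using eventually_nhds_in_open[of "{1<..}" x] x by (auto elim!: eventually_mono simp: l)
    ultimately show ?thesis by (subst (asm) DERIV_cong_ev) auto
  qed
qed

section \<open>The generalized inverse at its argument \<open>T\<close> in the two regularity
  classes\<close>

lemma gen_inv_gt_imp_less:
  assumes "0 \<le> v" "v < gen_inv h u"
  shows "h v < u"
proof (rule ccontr)
  assume "\<not> h v < u"
  then have "gen_inv h u \<le> v"
    unfolding gen_inv_def using assms by (intro cInf_lower bdd_belowI[of _ 0]) auto
  with assms show False by simp
qed

text \<open>Here smoothness is given for the inverse: \<open>\<psi>' y = \<psi> y * e y / y\<close>.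
  So increments are computed for \<open>\<psi>\<close> first,
  \<open>\<psi> (T + w / \<sigma>) - \<psi> T ~ \<sigma> * w\<close>, and then carried over to
  \<open>h\<close> by comparing \<open>h\<close> with its generalized inverse.\<close>

lemma R_infty_gen_inv_asymp:
  fixes T :: "nat \<Rightarrow> real"
  assumes h: "h \<in> R_infty" and T: "filterlim T at_top sequentially"
  defines "x \<equiv> \<lambda>n. gen_inv h (T n)" and "\<sigma> \<equiv> \<lambda>n. sqrt (deriv (gen_inv h) (T n))"
  shows "mono_on {0..} h" "filterlim h at_top at_top"
    and "filterlim x at_top sequentially" "\<forall>\<^sub>F n in sequentially. 0 < \<sigma> n"
    and "(\<lambda>n. \<sigma> n / x n) \<longlonglongrightarrow> 0"
    and "\<And>z. (\<lambda>n. \<sigma> n * (h (x n + \<sigma> n * z) - T n)) \<longlonglongrightarrow> z"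
proof -
  let ?\<psi> = "gen_inv h"
  obtain e e1 e2 \<eta> where rep: "R0_rep ?\<psi> e e1 e2" and \<psi>_top: "filterlim ?\<psi> at_top at_top"
    and e1: "((\<lambda>x. x * e1 x / e x) \<longlongrightarrow> 0) at_top"
    and \<eta>: "0 < \<eta>" "\<eta> < 1 / 4" "Liminf at_top (\<lambda>x. ereal (x powr \<eta> * e x)) > 0"
    using h by (auto simp: R_infty_def R0_tilde_def)
  note D = R0_rep_deriv[OF rep]
  show mono: "mono_on {0..} h" using h by (auto simp: R_infty_def strict_mono_on_imp_mono_on)
  \<comment> \<open>If \<open>h\<close> stayed below \<open>u\<close>, all larger levels would have
    the unspecified but constant value \<open>Inf {}\<close> as inverse, contrary to the divergence
    of \<open>gen_inv h\<close>.\<close>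
  have ne: "\<exists>x\<ge>0. h x \<ge> u" for u
  proof (rule ccontr)
    assume "\<not> (\<exists>x\<ge>0. h x \<ge> u)"
    then have emp: "{x. x \<ge> 0 \<and> h x \<ge> s} = {}" if "s \<ge> u" for s using that by force
    have "\<forall>\<^sub>F s in at_top. ?\<psi> s = Inf {}"
      using eventually_ge_at_top[of u] by eventually_elim (simp only: gen_inv_def emp)
    moreover have "\<forall>\<^sub>F s in at_top. Inf {} < ?\<psi> s" using \<psi>_top by (simp add: filterlim_at_top_dense)
    ultimately have "\<forall>\<^sub>F s :: real in at_top. False" by eventually_elim simp
    then show False by simp
  qed
  have less_imp: "u \<le> h v" if uv: "?\<psi> u < v" for u v
  proof -
    have "{x. x \<ge> 0 \<and> h x \<ge> u} \<noteq> {}" using ne by auto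
    then obtain y where "0 \<le> y" "u \<le> h y" "y < v"
      using cInf_lessD[OF _ uv[unfolded gen_inv_def]] by blast
    then show ?thesis using mono_onD[OF mono, of y v] by simp
  qed
  show "filterlim h at_top at_top"
    unfolding filterlim_at_top
  proof
    fix Z show "\<forall>\<^sub>F v in at_top. Z \<le> h v"
      using eventually_gt_at_top[of "?\<psi> Z"] by eventually_elim (rule less_imp)
  qed
  show x: "filterlim x at_top sequentially"
    unfolding x_def by (rule filterlim_compose[OF \<psi>_top T])
  obtain c where c: "0 < c" "ereal c < Liminf at_top (\<lambda>x. ereal (x powr \<eta> * e x))"
    using ereal_dense2[OF \<eta>(3)] by auto
  have "\<forall>\<^sub>F y in at_top. c < y powr \<eta> * e y"
    using less_LiminfD[OF c(2)] by simp
  moreover have "\<forall>\<^sub>F y in at_top. \<bar>y * e1 y / e y\<bar> < 1"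
    using e1 by (auto simp: tendsto_iff dist_real_def)
  moreover have "\<forall>\<^sub>F y in at_top. \<bar>e y\<bar> < 1"
    using D(4) by (auto simp: tendsto_iff dist_real_def)
  ultimately have "\<forall>\<^sub>F y in at_top. 1 \<le> y \<and> c < y powr \<eta> * e y \<and> \<bar>y * e1 y / e y\<bar> < 1 \<and> \<bar>e y\<bar> < 1"
    using eventually_ge_at_top[of 1] by eventually_elim auto
  then obtain X where X: "\<And>y. y \<ge> X \<Longrightarrow> 1 \<le> y \<and> c < y powr \<eta> * e y \<and> \<bar>y * e1 y / e y\<bar> < 1 \<and> \<bar>e y\<bar> < 1"
    unfolding eventually_at_top_linorder by blast
  have X': "y > 1" if "y > X" for y using X[of X] that by auto
  have e0: "e y > 0" if "y > X" for y
  proof -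
    have "0 < y powr \<eta> * e y" using X[of y] c(1) that by auto
    then show ?thesis by (simp add: zero_less_mult_iff)
  qed
  have \<psi>0: "?\<psi> y > 0" if "y > X" for y using D(3)[of y] X'[OF that] by simp
  define \<psi>' where "\<psi>' y = ?\<psi> y * e y / y" for y
  have \<psi>': "(?\<psi> has_real_derivative \<psi>' y) (at y)" if "y > X" for y
    unfolding \<psi>'_def using X'[OF that] by (rule D(2))
  have \<psi>'0: "\<psi>' y > 0" if "y > X" for y
    unfolding \<psi>'_def using e0[OF that] \<psi>0[OF that] X'[OF that] by simp
  have TX: "\<forall>\<^sub>F n in sequentially. X < T n" using T by (simp add: filterlim_at_top_dense)
  have \<sigma>_eq: "\<forall>\<^sub>F n in sequentially. 0 < \<sigma> n \<and> (\<sigma> n)\<^sup>2 = \<psi>' (T n)"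
    using TX
  proof eventually_elim
    case (elim n)
    have "deriv ?\<psi> (T n) = \<psi>' (T n)" by (rule DERIV_imp_deriv[OF \<psi>'[OF elim]])
    then show ?case using \<psi>'0[OF elim] by (simp add: \<sigma>_def)
  qed
  then show \<sigma>: "\<forall>\<^sub>F n in sequentially. 0 < \<sigma> n" by eventually_elim auto
  have eT: "(\<lambda>n. e (T n)) \<longlonglongrightarrow> 0" by (rule filterlim_compose[OF D(4) T])
  have xT: "filterlim (\<lambda>n. T n * x n) at_top sequentially" by (rule filterlim_at_top_mult_at_top[OF T x])
  \<comment> \<open>This root is the relative width: \<open>(\<sigma> n / x n)^2\<close> is the
    derivative of the inverse at \<open>T n\<close> over its squared value.\<close>
  have "(\<lambda>n. sqrt (e (T n) / (T n * x n))) \<longlonglongrightarrow> sqrt 0"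
    by (intro tendsto_real_sqrt tendsto_divide_0[OF eT] filterlim_at_top_imp_at_infinity xT)
  moreover have "\<forall>\<^sub>F n in sequentially. sqrt (e (T n) / (T n * x n)) = \<sigma> n / x n"
    using \<sigma>_eq TX
  proof eventually_elim
    case (elim n)
    have x0: "x n > 0" using \<psi>0 elim by (simp add: x_def)
    have "(\<sigma> n / x n)\<^sup>2 = e (T n) / (T n * x n)"
      using elim x0 by (simp add: power_divide \<psi>'_def x_def power2_eq_square)
    then show ?case using elim x0 by (intro real_sqrt_unique) auto
  qed
  ultimately show "(\<lambda>n. \<sigma> n / x n) \<longlonglongrightarrow> 0" by (auto elim: Lim_transform_eventually)
  have ratio: "(\<lambda>n. \<psi>' (v n) / \<psi>' (T n)) \<longlonglongrightarrow> 1" if v: "(\<lambda>n. v n / T n) \<longlonglongrightarrow> 1" for v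
  proof -
    have "(\<lambda>n. ?\<psi> (v n) / ?\<psi> (T n)) \<longlonglongrightarrow> 1"
    proof (rule slowly_varying_ratio[OF \<psi>' \<psi>0 _ T v])
      show "\<bar>y * \<psi>' y\<bar> \<le> 1 * ?\<psi> y" if "y > X" for y
        using X[of y] \<psi>0[OF that] X'[OF that] that by (auto simp: \<psi>'_def abs_mult mult_left_le)
    qed
    moreover have "(\<lambda>n. e (v n) / e (T n)) \<longlonglongrightarrow> 1"
    proof (rule slowly_varying_ratio[OF D(1)[OF X'] e0 _ T v])
      show "\<bar>y * e1 y\<bar> \<le> 1 * e y" if "y > X" for y
        using X[of y] e0[OF that] that by (auto simp: abs_divide field_simps)
    qed
    moreover have "(\<lambda>n. inverse (v n / T n)) \<longlonglongrightarrow> inverse 1" by (intro tendsto_intros v) simp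
    ultimately have "(\<lambda>n. ?\<psi> (v n) / ?\<psi> (T n) * (e (v n) / e (T n)) * inverse (v n / T n)) \<longlonglongrightarrow> 1 * 1 * inverse 1"
      by (intro tendsto_mult)
    moreover have "?\<psi> (v n) / ?\<psi> (T n) * (e (v n) / e (T n)) * inverse (v n / T n) = \<psi>' (v n) / \<psi>' (T n)" for n
      by (simp add: \<psi>'_def divide_inverse mult_ac)
    ultimately show ?thesis by simp
  qed
  \<comment> \<open>The lower bound on \<open>e\<close> in \<open>R0_tilde\<close> acts here:
    \<open>(\<sigma> n * T n)^2 = x n * T n * e (T n) \<ge> c * x n * T n powr (1 - \<eta>)\<close>.
    Consequently the increment \<open>w / \<sigma> n\<close> of the argument is negligible compared
    with \<open>T n\<close>.\<close>
  have T\<sigma>: "(\<lambda>n. 1 / (\<sigma> n * T n)) \<longlonglongrightarrow> 0"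
  proof -
    have "filterlim (\<lambda>n. T n powr (1 - \<eta>)) at_top sequentially"
      using \<eta> by (intro filterlim_compose[OF filterlim_powr_at_top T]) auto
    then have "filterlim (\<lambda>n. c * (x n * T n powr (1 - \<eta>))) at_top sequentially"
      by (intro filterlim_tendsto_pos_mult_at_top[OF tendsto_const c(1)] filterlim_at_top_mult_at_top[OF x])
    then have "(\<lambda>n. sqrt (1 / (c * (x n * T n powr (1 - \<eta>))))) \<longlonglongrightarrow> sqrt 0"
      by (intro tendsto_real_sqrt tendsto_divide_0[OF tendsto_const] filterlim_at_top_imp_at_infinity)
    then have lim: "(\<lambda>n. sqrt (1 / (c * (x n * T n powr (1 - \<eta>))))) \<longlonglongrightarrow> 0" by simp
    show ?thesis
    proof (rule Lim_null_comparison[OF _ lim])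
      show "\<forall>\<^sub>F n in sequentially. norm (1 / (\<sigma> n * T n)) \<le> sqrt (1 / (c * (x n * T n powr (1 - \<eta>))))"
        using \<sigma>_eq TX
      proof eventually_elim
        case (elim n)
        have pos: "x n > 0" "T n > 1" using \<psi>0 X' elim by (auto simp: x_def)
        have "c * T n powr (1 - \<eta>) \<le> (T n powr \<eta> * e (T n)) * T n powr (1 - \<eta>)"
          using X[of "T n"] elim by (intro mult_right_mono) auto
        also have "\<dots> = T n * e (T n)" using pos by (simp add: powr_add[symmetric] mult_ac)
        finally have "x n * (c * T n powr (1 - \<eta>)) \<le> x n * (T n * e (T n))" using pos by (intro mult_left_mono) auto
        also have "\<dots> = (\<sigma> n * T n)\<^sup>2"
        proof -
          have "(\<sigma> n * T n)\<^sup>2 = \<psi>' (T n) * (T n)\<^sup>2" using elim by (simp add: power_mult_distrib)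
          also have "\<dots> = x n * (T n * e (T n))" using pos by (simp add: \<psi>'_def x_def power2_eq_square)
          finally show ?thesis ..
        qed
        finally have le: "c * (x n * T n powr (1 - \<eta>)) \<le> (\<sigma> n * T n)\<^sup>2" by (simp only: mult_ac)
        have "(1 / (\<sigma> n * T n))\<^sup>2 \<le> 1 / (c * (x n * T n powr (1 - \<eta>)))"
          unfolding power_divide using le pos c(1) elim by (auto intro!: frac_le)
        then show ?case using elim pos by (intro real_le_rsqrt) auto
      qed
    qed
  qed
  have incr: "(\<lambda>n. (?\<psi> (T n + w / \<sigma> n) - x n) / \<sigma> n) \<longlonglongrightarrow> w" for w
  proof -
    have "(\<lambda>n. w * (1 / (\<sigma> n * T n))) \<longlonglongrightarrow> w * 0" by (intro tendsto_intros T\<sigma>)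
    then have d: "(\<lambda>n. w / \<sigma> n / T n) \<longlonglongrightarrow> 0" by simp
    have nz: "\<forall>\<^sub>F n in sequentially. \<psi>' (T n) \<noteq> 0" using TX by eventually_elim (use \<psi>'0 in force)
    obtain \<rho> where \<rho>: "\<rho> \<longlonglongrightarrow> 1" "\<forall>\<^sub>F n in sequentially. ?\<psi> (T n + w / \<sigma> n) - ?\<psi> (T n) = w / \<sigma> n * \<psi>' (T n) * \<rho> n"
      using increment_asymp[OF \<psi>' T d ratio nz] by blast
    have "(\<lambda>n. w * \<rho> n) \<longlonglongrightarrow> w * 1" by (intro tendsto_intros \<rho>)
    moreover have "\<forall>\<^sub>F n in sequentially. w * \<rho> n = (?\<psi> (T n + w / \<sigma> n) - x n) / \<sigma> n"
      using \<rho>(2) \<sigma>_eq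
    proof eventually_elim
      case (elim n)
      then have "\<psi>' (T n) = \<sigma> n * \<sigma> n" by (simp add: power2_eq_square)
      then show ?case using elim by (simp add: x_def)
    qed
    ultimately show ?thesis by (auto elim: Lim_transform_eventually)
  qed
  show "(\<lambda>n. \<sigma> n * (h (x n + \<sigma> n * z) - T n)) \<longlonglongrightarrow> z" for z
    unfolding tendsto_iff
  proof safe
    fix \<epsilon> :: real assume \<epsilon>: "\<epsilon> > 0"
    \<comment> \<open>The point \<open>x n + \<sigma> n * z\<close> is enclosed between the inverses
      of two levels, which then enclose the value of \<open>h\<close> there.\<close>
    have up: "\<forall>\<^sub>F n in sequentially. z < (?\<psi> (T n + (z + \<epsilon> / 2) / \<sigma> n) - x n) / \<sigma> n"
      using incr[of "z + \<epsilon> / 2"] \<epsilon> by (intro order_tendstoD) auto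
    have lo: "\<forall>\<^sub>F n in sequentially. (?\<psi> (T n + (z - \<epsilon> / 2) / \<sigma> n) - x n) / \<sigma> n < z"
      using incr[of "z - \<epsilon> / 2"] \<epsilon> by (intro order_tendstoD) auto
    have "(\<lambda>n. 1 + \<sigma> n / x n * z) \<longlonglongrightarrow> 1 + 0 * z"
      by (intro tendsto_intros \<open>(\<lambda>n. \<sigma> n / x n) \<longlonglongrightarrow> 0\<close>)
    then have "\<forall>\<^sub>F n in sequentially. 0 < 1 + \<sigma> n / x n * z" by (intro order_tendstoD) auto
    moreover have "\<forall>\<^sub>F n in sequentially. 0 < x n" using x by (simp add: filterlim_at_top_dense)
    ultimately show "\<forall>\<^sub>F n in sequentially. dist (\<sigma> n * (h (x n + \<sigma> n * z) - T n)) z < \<epsilon>"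
      using up lo \<sigma>
    proof eventually_elim
      case (elim n)
      have "0 \<le> x n * (1 + \<sigma> n / x n * z)" using elim by simp
      then have nn: "0 \<le> x n + \<sigma> n * z" using elim by (simp add: distrib_left)
      have "x n + \<sigma> n * z < ?\<psi> (T n + (z + \<epsilon> / 2) / \<sigma> n)" using elim by (simp add: field_simps)
      then have "h (x n + \<sigma> n * z) < T n + (z + \<epsilon> / 2) / \<sigma> n" by (rule gen_inv_gt_imp_less[OF nn])
      then have 1: "\<sigma> n * (h (x n + \<sigma> n * z) - T n) < z + \<epsilon> / 2" using elim by (simp add: field_simps)
      have "?\<psi> (T n + (z - \<epsilon> / 2) / \<sigma> n) < x n + \<sigma> n * z" using elim by (simp add: field_simps)
      then have "T n + (z - \<epsilon> / 2) / \<sigma> n \<le> h (x n + \<sigma> n * z)" by (rule less_imp)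
      then have 2: "z - \<epsilon> / 2 \<le> \<sigma> n * (h (x n + \<sigma> n * z) - T n)" using elim by (simp add: field_simps)
      show ?case using 1 2 \<epsilon> by (simp add: dist_real_def abs_if)
    qed
  qed
qed

text \<open>Here \<open>h\<close> itself is smooth and strictly increasing, but only far out.
  Boundedness on compact intervals guarantees that high levels are attained only far out, so
  \<open>gen_inv h\<close> is a genuine inverse there with derivative \<open>1 / h'\<close>. Then
  \<open>\<sigma>^2 * h' x = 1\<close>, and the last claim is the increment of \<open>h\<close> at
  \<open>x\<close>.\<close>

lemma R_beta_gen_inv_asymp:
  fixes T :: "nat \<Rightarrow> real"
  assumes h: "h \<in> R_beta \<beta>" and \<beta>: "\<beta> > 0" and bdd: "\<And>A. bdd_above (h ` {0..A})"
    and T: "filterlim T at_top sequentially"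
  defines "x \<equiv> \<lambda>n. gen_inv h (T n)" and "\<sigma> \<equiv> \<lambda>n. sqrt (deriv (gen_inv h) (T n))"
  shows "\<exists>A. mono_on {A..} h" "filterlim h at_top at_top"
    and "filterlim x at_top sequentially" "\<forall>\<^sub>F n in sequentially. 0 < \<sigma> n"
    and "(\<lambda>n. \<sigma> n / x n) \<longlonglongrightarrow> 0"
    and "\<And>z. (\<lambda>n. \<sigma> n * (h (x n + \<sigma> n * z) - T n)) \<longlonglongrightarrow> z"
proof -
  let ?\<psi> = "gen_inv h"
  obtain l e e1 e2 where rep: "R0_rep l e e1 e2" and hl: "\<forall>\<^sub>F x in at_top. h x = x powr \<beta> * l x"
    using h by (auto simp: R_beta_def)
  note D = R0_rep_deriv[OF rep]
  have "\<forall>\<^sub>F y in at_top. \<bar>e y\<bar> < \<beta> / 2"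
    using tendstoD[OF D(4), of "\<beta> / 2"] \<beta> by simp
  with hl have "\<forall>\<^sub>F y in at_top. 1 \<le> y \<and> h y = y powr \<beta> * l y \<and> \<bar>e y\<bar> < \<beta> / 2"
    using eventually_ge_at_top[of 1] by eventually_elim auto
  then obtain X where X: "\<And>y. y \<ge> X \<Longrightarrow> 1 \<le> y \<and> h y = y powr \<beta> * l y \<and> \<bar>e y\<bar> < \<beta> / 2"
    unfolding eventually_at_top_linorder by blast
  have X1: "X \<ge> 1" using X[of X] by simp
  have h0: "h y > 0" if "y \<ge> X" for y using X[OF that] D(3)[of y] by simp
  define h' where "h' y = h y * (\<beta> + e y) / y" for y
  have h': "(h has_real_derivative h' y) (at y)" if y: "y > X" for y
  proof -
    have y1: "y > 1" using that X1 by simp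
    have "((\<lambda>y. y powr \<beta> * l y) has_real_derivative h' y) (at y)"
      using y1 X[of y] y by (auto intro!: derivative_eq_intros D(2) simp: h'_def powr_diff field_simps)
    moreover have "\<forall>\<^sub>F z in nhds y. z powr \<beta> * l z = h z"
      using eventually_nhds_in_open[of "{X<..}" y] y by (auto elim!: eventually_mono simp: X)
    ultimately show ?thesis by (subst (asm) DERIV_cong_ev) auto
  qed
  have be: "\<beta> / 2 < \<beta> + e y" "\<beta> + e y < 2 * \<beta>" if "y \<ge> X" for y
    using X[OF that] \<beta> by (auto simp: abs_less_iff)
  have h'0: "h' y > 0" if "y > X" for y
  proof -
    have "\<beta> + e y > 0" using be(1)[of y] that \<beta> by simp
    then show ?thesis unfolding h'_def using h0[of y] that X1 by simp
  qed
  have smono: "h y < h z" if "X < y" "y < z" for y z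
    using DERIV_pos_imp_increasing[of y z h] h' h'0 that by (metis dual_order.strict_trans1)
  show "\<exists>A. mono_on {A..} h"
  proof (intro exI mono_onI)
    fix r s assume "r \<in> {X + 1..}" "s \<in> {X + 1..}" "r \<le> s"
    then show "h r \<le> h s" using smono[of r s] by (cases "r = s") auto
  qed
  \<comment> \<open>Because \<open>\<bar>e y\<bar> < \<beta> / 2\<close>, the logarithmic derivative
    of \<open>h\<close> dominates that of \<open>y powr (\<beta> / 2)\<close>, so their quotient is
    nondecreasing.\<close>
  have lower: "h y \<ge> h (X + 1) / (X + 1) powr (\<beta> / 2) * y powr (\<beta> / 2)" if y: "y \<ge> X + 1" for y
  proof -
    have "h (X + 1) / (X + 1) powr (\<beta> / 2) \<le> h y / y powr (\<beta> / 2)"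
    proof (rule DERIV_nonneg_imp_nondecreasing[OF y])
      fix z assume z: "X + 1 \<le> z" "z \<le> y"
      have z0: "z > 0" "z > X" using z X1 by auto
      have "((\<lambda>y. h y / y powr (\<beta> / 2)) has_real_derivative h z * (\<beta> / 2 + e z) / z / z powr (\<beta> / 2)) (at z)"
      proof (rule DERIV_cong)
        show "((\<lambda>y. h y / y powr (\<beta> / 2)) has_real_derivative
          (h' z * z powr (\<beta> / 2) - h z * (\<beta> / 2 * z powr (\<beta> / 2 - 1))) / (z powr (\<beta> / 2) * z powr (\<beta> / 2))) (at z)"
          using z0 by (intro DERIV_divide h' has_real_derivative_powr) auto
        have pw: "z powr (\<beta> / 2 - 1) = z powr (\<beta> / 2) / z" using z0 by (simp add: powr_diff)
        show "(h' z * z powr (\<beta> / 2) - h z * (\<beta> / 2 * z powr (\<beta> / 2 - 1))) / (z powr (\<beta> / 2) * z powr (\<beta> / 2))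
            = h z * (\<beta> / 2 + e z) / z / z powr (\<beta> / 2)"
          unfolding pw h'_def using z0 by (simp add: field_simps)
      qed
      moreover have "0 \<le> h z * (\<beta> / 2 + e z) / z / z powr (\<beta> / 2)"
      proof -
        have "0 \<le> \<beta> / 2 + e z" using X[of z] z0 by (auto simp: abs_less_iff)
        then show ?thesis using h0[of z] z0 by (intro divide_nonneg_nonneg mult_nonneg_nonneg) auto
      qed
      ultimately show "\<exists>d. ((\<lambda>y. h y / y powr (\<beta> / 2)) has_real_derivative d) (at z) \<and> 0 \<le> d" by blast
    qed
    then show ?thesis using y X1 by (simp add: field_simps)
  qed
  show h_top: "filterlim h at_top at_top"
  proof (rule filterlim_at_top_mono)
    show "filterlim (\<lambda>y. h (X + 1) / (X + 1) powr (\<beta> / 2) * y powr (\<beta> / 2)) at_top at_top"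
      using h0[of "X + 1"] X1 \<beta>
      by (intro filterlim_tendsto_pos_mult_at_top[OF tendsto_const] filterlim_powr_at_top) auto
    show "\<forall>\<^sub>F y in at_top. h (X + 1) / (X + 1) powr (\<beta> / 2) * y powr (\<beta> / 2) \<le> h y"
      using eventually_ge_at_top[of "X + 1"] by eventually_elim (rule lower)
  qed
  \<comment> \<open>Levels above \<open>M\<close> are not attained on \<open>{0..X + 1}\<close>,
    where \<open>h\<close> need not be monotone.\<close>
  obtain M where "\<forall>y\<in>{0..X + 1}. h y \<le> M"
    using bdd[of "X + 1"] by (auto simp: bdd_above_def)
  then have M: "h y \<le> M" if "0 \<le> y" "y \<le> X + 1" for y using that by simp
  have \<psi>_h: "?\<psi> (h y) = y" if y: "y > X" "h y > M" for y
  proof -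
    have "{x. 0 \<le> x \<and> h y \<le> h x} = {y..}"
    proof (intro set_eqI iffI)
      fix z assume "z \<in> {x. 0 \<le> x \<and> h y \<le> h x}"
      then have "z > X" "\<not> z < y" using M[of z] y smono[of z y] by force+
      then show "z \<in> {y..}" by simp
    next
      fix z assume "z \<in> {y..}"
      then show "z \<in> {x. 0 \<le> x \<and> h y \<le> h x}" using smono[of y z] y X1 by (cases "y = z") auto
    qed
    then show ?thesis unfolding gen_inv_def by simp
  qed
  have cont: "isCont h y" if "y > X" for y using h'[OF that] by (rule DERIV_isCont)
  have surj: "\<exists>y>X. h y = u" if u: "u > M" for u
  proof -
    have "\<forall>\<^sub>F y in at_top. u \<le> h y \<and> X + 1 \<le> y"
      using h_top eventually_ge_at_top[of "X + 1"] by (auto simp: filterlim_at_top intro: eventually_conj)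
    then obtain y where y: "u \<le> h y" "X + 1 \<le> y" by (auto simp: eventually_at_top_linorder)
    have "h (X + 1) \<le> u" using M[of "X + 1"] u X1 by simp
    then obtain z where "X + 1 \<le> z" "h z = u"
      using IVT[of h "X + 1" u y] y cont by (metis add_strict_increasing2 less_le_trans less_add_one zero_less_one order.strict_trans1)
    then show ?thesis by (intro exI[of _ z]) auto
  qed
  have \<psi>: "h (?\<psi> u) = u" "?\<psi> u > X" if "u > M" for u
    using surj[OF that] \<psi>_h that by auto
  have \<psi>_ge: "K \<le> ?\<psi> u" if "u > M" "h K < u" "K > X" for K u
    using \<psi>[OF that(1)] smono[of "?\<psi> u" K] that by force
  have \<psi>_top: "filterlim ?\<psi> at_top at_top"
    unfolding filterlim_at_top
  proof
    fix Z
    show "\<forall>\<^sub>F u in at_top. Z \<le> ?\<psi> u"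
      using eventually_gt_at_top[of M] eventually_gt_at_top[of "h (max Z (X + 1))"]
    proof eventually_elim
      case (elim u)
      then have "max Z (X + 1) \<le> ?\<psi> u" by (intro \<psi>_ge) auto
      then show ?case by simp
    qed
  qed
  show x: "filterlim x at_top sequentially"
    unfolding x_def by (rule filterlim_compose[OF \<psi>_top T])
  have d\<psi>: "(?\<psi> has_real_derivative inverse (h' (?\<psi> u))) (at u)" if u: "u > M + 1" for u
  proof -
    have uM: "u > M" using u by simp
    note pu = \<psi>[OF uM]
    have "?\<psi> (M + 1) < ?\<psi> u"
    proof (rule ccontr)
      assume "\<not> ?\<psi> (M + 1) < ?\<psi> u"
      then have "h (?\<psi> u) \<le> h (?\<psi> (M + 1))" using smono[of "?\<psi> u" "?\<psi> (M + 1)"] pu by force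
      then show False using pu \<psi>[of "M + 1"] u by simp
    qed
    \<comment> \<open>Half the distance to the inverse of \<open>M + 1\<close>: a neighbourhood of
      this radius stays where \<open>h\<close> is strictly increasing and exceeds
      \<open>M\<close>.\<close>
    then have d: "0 < (?\<psi> u - ?\<psi> (M + 1)) / 2" by simp
    have near: "z > ?\<psi> (M + 1)" if "\<bar>z - ?\<psi> u\<bar> \<le> (?\<psi> u - ?\<psi> (M + 1)) / 2" for z
      using abs_le_D2[OF that] d by (simp add: field_simps)
    have "isCont ?\<psi> (h (?\<psi> u))"
    proof (rule isCont_inverse_function[where f=h and g="?\<psi>" and x="?\<psi> u", OF d])
      fix z assume "\<bar>z - ?\<psi> u\<bar> \<le> (?\<psi> u - ?\<psi> (M + 1)) / 2"
      then have z: "z > ?\<psi> (M + 1)" by (rule near)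
      moreover have "?\<psi> (M + 1) > X" by (rule \<psi>) simp
      ultimately have "z > X" "h (?\<psi> (M + 1)) < h z" using smono by auto
      then show "?\<psi> (h z) = z" "isCont h z" using \<psi>_h cont \<psi>[of "M + 1"] by auto
    qed
    then have ic: "isCont ?\<psi> u" using pu by simp
    show ?thesis
    proof (rule DERIV_inverse_function[where a=M and b="u + 1", OF h'[OF pu(2)] _ _ _ _ ic])
      show "h' (?\<psi> u) \<noteq> 0" using h'0[OF pu(2)] by simp
      show "M < u" by fact
      show "u < u + 1" by simp
      show "h (?\<psi> y) = y" if "M < y" "y < u + 1" for y using \<psi> that by simp
    qed
  qed
  have TM: "\<forall>\<^sub>F n in sequentially. max (M + 1) 1 < T n" using T unfolding filterlim_at_top_dense by blast
  have \<sigma>_eq: "\<forall>\<^sub>F n in sequentially. 0 < \<sigma> n \<and> (\<sigma> n)\<^sup>2 * h' (x n) = 1 \<and> x n > X \<and> h (x n) = T n \<and> 1 < T n"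
    using TM
  proof eventually_elim
    case (elim n)
    have *: "x n > X" "h (x n) = T n" using \<psi>[of "T n"] elim by (auto simp: x_def)
    have "deriv ?\<psi> (T n) = inverse (h' (x n))" unfolding x_def using elim by (intro DERIV_imp_deriv d\<psi>) simp
    then show ?case using h'0[OF *(1)] * elim by (simp add: \<sigma>_def)
  qed
  then show \<sigma>: "\<forall>\<^sub>F n in sequentially. 0 < \<sigma> n" by eventually_elim auto
  have eX: "(\<lambda>n. e (x n)) \<longlonglongrightarrow> 0" by (rule filterlim_compose[OF D(4) x])
  \<comment> \<open>The reciprocal of this expression is \<open>(\<sigma> n / x n)^2\<close>,
    because \<open>h' (x n) = T n * (\<beta> + e (x n)) / x n\<close>.\<close>
  have "filterlim (\<lambda>n. (\<beta> + e (x n)) * (T n * x n)) at_top sequentially"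
    by (rule filterlim_tendsto_pos_mult_at_top[OF _ \<beta> filterlim_at_top_mult_at_top[OF T x]])
       (use tendsto_add[OF tendsto_const eX] in simp)
  then have "(\<lambda>n. sqrt (1 / ((\<beta> + e (x n)) * (T n * x n)))) \<longlonglongrightarrow> sqrt 0"
    by (intro tendsto_real_sqrt tendsto_divide_0[OF tendsto_const] filterlim_at_top_imp_at_infinity)
  moreover have "\<forall>\<^sub>F n in sequentially. sqrt (1 / ((\<beta> + e (x n)) * (T n * x n))) = \<sigma> n / x n"
    using \<sigma>_eq
  proof eventually_elim
    case (elim n)
    have x0: "x n > 0" using X1 elim by simp
    have b0: "\<beta> + e (x n) > 0" using be(1)[of "x n"] elim \<beta> by simp
    have "(\<sigma> n)\<^sup>2 = x n / (T n * (\<beta> + e (x n)))"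
    proof -
      have "T n * (\<beta> + e (x n)) \<noteq> 0" using elim b0 by simp
      moreover have "(\<sigma> n)\<^sup>2 * (T n * (\<beta> + e (x n))) = x n"
      proof -
        have "(\<sigma> n)\<^sup>2 * (T n * (\<beta> + e (x n))) = (\<sigma> n)\<^sup>2 * h' (x n) * x n"
          using elim x0 by (simp add: h'_def)
        then show ?thesis using elim by simp
      qed
      ultimately show ?thesis by (subst eq_divide_eq) simp
    qed
    then have "(\<sigma> n / x n)\<^sup>2 = 1 / ((\<beta> + e (x n)) * (T n * x n))"
      using x0 by (simp add: power_divide) (simp add: power2_eq_square mult_ac)
    then show ?case using elim x0 by (intro real_sqrt_unique) auto
  qed
  ultimately show \<sigma>x: "(\<lambda>n. \<sigma> n / x n) \<longlonglongrightarrow> 0" by (auto elim: Lim_transform_eventually)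
  have ratio: "(\<lambda>n. h' (v n) / h' (x n)) \<longlonglongrightarrow> 1" if v: "(\<lambda>n. v n / x n) \<longlonglongrightarrow> 1" for v
  proof -
    have "filterlim (\<lambda>n. v n / x n * x n) at_top sequentially"
      by (rule filterlim_tendsto_pos_mult_at_top[OF v _ x]) simp
    moreover have "\<forall>\<^sub>F n in sequentially. v n / x n * x n = v n"
      using \<sigma>_eq by eventually_elim (use X1 in auto)
    ultimately have vt: "filterlim v at_top sequentially" by (simp add: filterlim_cong)
    have "(\<lambda>n. h (v n) / h (x n)) \<longlonglongrightarrow> 1"
    proof (rule slowly_varying_ratio[OF h' _ _ x v])
      show "\<bar>y * h' y\<bar> \<le> 2 * \<beta> * h y" if "y > X" for y
      proof -
        have "y * h' y = (\<beta> + e y) * h y" using that X1 by (simp add: h'_def)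
        moreover have "(\<beta> + e y) * h y \<le> 2 * \<beta> * h y" "0 \<le> (\<beta> + e y) * h y"
          using be[of y] h0[of y] that \<beta> by (auto intro!: mult_right_mono)
        ultimately show ?thesis by simp
      qed
    qed (use h0 in auto)
    moreover have "(\<lambda>n. (\<beta> + e (v n)) / (\<beta> + e (x n))) \<longlonglongrightarrow> (\<beta> + 0) / (\<beta> + 0)"
      using \<beta> by (intro tendsto_divide tendsto_add tendsto_const eX filterlim_compose[OF D(4) vt]) auto
    moreover have "(\<lambda>n. inverse (v n / x n)) \<longlonglongrightarrow> inverse 1" by (intro tendsto_intros v) simp
    ultimately have "(\<lambda>n. h (v n) / h (x n) * ((\<beta> + e (v n)) / (\<beta> + e (x n))) * inverse (v n / x n))
        \<longlonglongrightarrow> 1 * ((\<beta> + 0) / (\<beta> + 0)) * inverse 1"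
      by (intro tendsto_mult)
    moreover have "h (v n) / h (x n) * ((\<beta> + e (v n)) / (\<beta> + e (x n))) * inverse (v n / x n) = h' (v n) / h' (x n)" for n
      by (simp add: h'_def divide_inverse mult_ac)
    ultimately show ?thesis using \<beta> by simp
  qed
  show "(\<lambda>n. \<sigma> n * (h (x n + \<sigma> n * z) - T n)) \<longlonglongrightarrow> z" for z
  proof -
    have "(\<lambda>n. \<sigma> n / x n * z) \<longlonglongrightarrow> 0 * z" by (intro tendsto_intros \<sigma>x)
    then have d: "(\<lambda>n. \<sigma> n * z / x n) \<longlonglongrightarrow> 0" by simp
    have nz: "\<forall>\<^sub>F n in sequentially. h' (x n) \<noteq> 0" using \<sigma>_eq by eventually_elim auto
    obtain \<rho> where \<rho>: "\<rho> \<longlonglongrightarrow> 1" "\<forall>\<^sub>F n in sequentially. h (x n + \<sigma> n * z) - h (x n) = \<sigma> n * z * h' (x n) * \<rho> n"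
      using increment_asymp[OF h' x d ratio nz] by blast
    have "(\<lambda>n. z * \<rho> n) \<longlonglongrightarrow> z * 1" by (intro tendsto_intros \<rho>)
    moreover have "\<forall>\<^sub>F n in sequentially. z * \<rho> n = \<sigma> n * (h (x n + \<sigma> n * z) - T n)"
      using \<rho>(2) \<sigma>_eq
    proof eventually_elim
      case (elim n)
      have "\<sigma> n * (h (x n + \<sigma> n * z) - T n) = ((\<sigma> n)\<^sup>2 * h' (x n)) * (z * \<rho> n)"
        using elim by (simp add: power2_eq_square)
      then show ?case using elim by simp
    qed
    ultimately show ?thesis by (auto elim: Lim_transform_eventually)
  qed
qed

section \<open>Exponential families\<close>

lemma power_le_fact_exp:
  fixes x :: real
  assumes "x \<ge> 0"
  shows "x ^ k \<le> fact k * exp x"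
proof -
  have "(\<Sum>i\<in>{k}. x ^ i /\<^sub>R fact i) \<le> exp x"
    unfolding exp_def using assms by (intro sum_le_suminf summable_exp_generic) auto
  then show ?thesis by (simp add: field_simps)
qed

locale exp_density =
  fixes p :: "real \<Rightarrow> real"
  assumes p_measurable [measurable]: "p \<in> borel_measurable borel"
    and p_nonneg: "\<And>x. 0 \<le> p x" and p_neg: "\<And>x. x < 0 \<Longrightarrow> p x = 0"
    and p_mass: "has_bochner_integral lborel p 1"
    and exp_integrable: "\<And>t. integrable lborel (\<lambda>x. exp (t * x) * p x)"
begin

definition Mom :: "nat \<Rightarrow> real \<Rightarrow> real" where
  "Mom k t = (\<integral>x. x ^ k * exp (t * x) * p x \<partial>lborel)"

lemma Mom_integrable: "integrable lborel (\<lambda>x. x ^ k * exp (t * x) * p x)"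
proof (rule Bochner_Integration.integrable_bound)
  show "integrable lborel (\<lambda>x. fact k * (exp ((t + 1) * x) * p x))"
    by (intro integrable_mult_right exp_integrable)
  show "AE x in lborel. norm (x ^ k * exp (t * x) * p x) \<le> norm (fact k * (exp ((t + 1) * x) * p x))"
  proof (rule AE_I2)
    fix x :: real
    show "norm (x ^ k * exp (t * x) * p x) \<le> norm (fact k * (exp ((t + 1) * x) * p x))"
    proof (cases "x < 0")
      case False
      then have "x ^ k * (exp (t * x) * p x) \<le> fact k * exp x * (exp (t * x) * p x)"
        using p_nonneg by (intro mult_right_mono power_le_fact_exp) auto
      moreover have "exp ((t + 1) * x) = exp x * exp (t * x)" by (simp add: distrib_right exp_add)
      ultimately show ?thesis using False p_nonneg[of x] by (simp add: abs_mult mult.assoc)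
    qed (simp add: p_neg)
  qed
qed measurable

text \<open>Differentiation under the integral along sequences. By the mean value theorem the
  difference quotients of \<open>exp (s * x)\<close> for \<open>\<bar>s - t\<bar> < 1\<close> and
  \<open>x \<ge> 0\<close> are at most \<open>x * exp ((\<bar>t\<bar> + 1) * x)\<close>, so the next
  moment at \<open>\<bar>t\<bar> + 1\<close> supplies the majorant.\<close>

lemma Mom_deriv: "(Mom k has_real_derivative Mom (Suc k) t) (at t)"
  unfolding has_field_derivative_iff tendsto_at_iff_sequentially
proof (intro allI impI)
  fix X assume X: "\<forall>i. X i \<in> UNIV - {t}" "X \<longlonglongrightarrow> t"
  have "\<forall>\<^sub>F i in sequentially. \<bar>X i - t\<bar> < 1" using tendstoD[OF X(2), of 1] by (simp add: dist_real_def)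
  then obtain m where m: "\<And>i. i \<ge> m \<Longrightarrow> \<bar>X i - t\<bar> < 1" unfolding eventually_sequentially by blast
  let ?D = "\<lambda>i x. x ^ k * ((exp (X i * x) - exp (t * x)) / (X i - t)) * p x"
  have eq: "(Mom k (X i) - Mom k t) / (X i - t) = (\<integral>x. ?D i x \<partial>lborel)" for i
  proof -
    have "Mom k (X i) - Mom k t = (\<integral>x. x ^ k * exp (X i * x) * p x - x ^ k * exp (t * x) * p x \<partial>lborel)"
      unfolding Mom_def by (intro Bochner_Integration.integral_diff[symmetric] Mom_integrable)
    then have "(Mom k (X i) - Mom k t) / (X i - t)
        = (\<integral>x. (x ^ k * exp (X i * x) * p x - x ^ k * exp (t * x) * p x) / (X i - t) \<partial>lborel)"
      by simp
    then show ?thesis by (simp add: diff_divide_distrib algebra_simps)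
  qed
  have "(\<lambda>i. \<integral>x. ?D (i + m) x \<partial>lborel) \<longlonglongrightarrow> Mom (Suc k) t"
    unfolding Mom_def
  proof (rule integral_dominated_convergence[where w="\<lambda>x. x ^ Suc k * exp ((\<bar>t\<bar> + 1) * x) * p x"])
    show "integrable lborel (\<lambda>x. x ^ Suc k * exp ((\<bar>t\<bar> + 1) * x) * p x)" by (rule Mom_integrable)
    show "AE x in lborel. (\<lambda>i. ?D (i + m) x) \<longlonglongrightarrow> x ^ Suc k * exp (t * x) * p x"
    proof (rule AE_I2)
      fix x :: real
      have "((\<lambda>s. exp (s * x)) has_real_derivative x * exp (t * x)) (at t)"
        by (auto intro!: derivative_eq_intros)
      then have "(\<lambda>i. (exp (X i * x) - exp (t * x)) / (X i - t)) \<longlonglongrightarrow> x * exp (t * x)"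
        using X unfolding has_field_derivative_iff tendsto_at_iff_sequentially by (auto simp: comp_def)
      then have "(\<lambda>i. x ^ k * ((exp (X (i + m) * x) - exp (t * x)) / (X (i + m) - t)) * p x)
          \<longlonglongrightarrow> x ^ k * (x * exp (t * x)) * p x"
        by (intro tendsto_mult tendsto_const LIMSEQ_ignore_initial_segment)
      then show "(\<lambda>i. ?D (i + m) x) \<longlonglongrightarrow> x ^ Suc k * exp (t * x) * p x" by (simp add: mult_ac)
    qed
    show "AE x in lborel. norm (?D (i + m) x) \<le> x ^ Suc k * exp ((\<bar>t\<bar> + 1) * x) * p x" for i
    proof (rule AE_I2)
      fix x :: real
      show "norm (?D (i + m) x) \<le> x ^ Suc k * exp ((\<bar>t\<bar> + 1) * x) * p x"
      proof (cases "x < 0")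
        case False
        let ?d = "X (i + m) - t"
        have d: "?d \<noteq> 0" "\<bar>?d\<bar> < 1" using X m[of "i + m"] by auto
        have der: "((\<lambda>s. exp (s * x)) has_real_derivative x * exp (y * x)) (at y)" for y
          by (auto intro!: derivative_eq_intros)
        obtain s where s: "\<bar>s - t\<bar> \<le> \<bar>?d\<bar>" "exp ((t + ?d) * x) - exp (t * x) = ?d * (x * exp (s * x))"
          using mvt_between[of t ?d "\<lambda>s. exp (s * x)" "\<lambda>s. x * exp (s * x)", OF der] by blast
        have "s \<le> \<bar>t\<bar> + 1" using s(1) d(2) by linarith
        then have "s * x \<le> (\<bar>t\<bar> + 1) * x" using False by (intro mult_right_mono) auto
        then have le: "x * exp (s * x) \<le> x * exp ((\<bar>t\<bar> + 1) * x)" using False by (intro mult_left_mono) auto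
        have "(exp (X (i + m) * x) - exp (t * x)) / ?d = x * exp (s * x)" using s(2) d(1) by simp
        then have "norm (?D (i + m) x) = x ^ k * (x * exp (s * x)) * p x"
          using False p_nonneg by (simp add: abs_mult)
        also have "\<dots> \<le> x ^ k * (x * exp ((\<bar>t\<bar> + 1) * x)) * p x"
          using False p_nonneg by (intro mult_right_mono mult_left_mono le) auto
        finally show ?thesis by (simp add: mult_ac)
      qed (simp add: p_neg)
    qed
  qed measurable
  then have "(\<lambda>i. \<integral>x. ?D i x \<partial>lborel) \<longlonglongrightarrow> Mom (Suc k) t"
    using LIMSEQ_offset[of "\<lambda>i. \<integral>x. ?D i x \<partial>lborel" m] by blast
  then show "((\<lambda>s. (Mom k s - Mom k t) / (s - t)) \<circ> X) \<longlonglongrightarrow> Mom (Suc k) t"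
    by (simp add: comp_def eq)
qed

lemma AE_p_contradiction: "\<not> (AE x in lborel. p x = 0)"
proof
  assume "AE x in lborel. p x = 0"
  then have "(\<integral>x. p x \<partial>lborel) = (\<integral>x. 0 \<partial>(lborel :: real measure))" by (intro integral_cong_AE) auto
  then show False using p_mass by (simp add: has_bochner_integral_iff)
qed

lemma Mom0_pos: "Mom 0 t > 0"
proof -
  have nn: "0 \<le> Mom 0 t" unfolding Mom_def using p_nonneg by (intro Bochner_Integration.integral_nonneg) simp
  moreover have "Mom 0 t \<noteq> 0"
  proof
    assume "Mom 0 t = 0"
    then have "AE x in lborel. exp (t * x) * p x = 0"
      using integral_nonneg_eq_0_iff_AE[OF exp_integrable[of t]] p_nonneg by (auto simp: Mom_def)
    then have "AE x in lborel. p x = 0" by eventually_elim simp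
    then show False using AE_p_contradiction by blast
  qed
  ultimately show ?thesis by simp
qed

lemma Phi_eq: "Phi p t = Mom 0 t"
  unfolding Phi_def Mom_def set_lebesgue_integral_def
  by (intro Bochner_Integration.integral_cong) (auto simp: indicator_def p_neg)

lemma mean_fun_eq: "mean_fun p t = Mom 1 t / Mom 0 t"
proof -
  have "((\<lambda>s. ln (Phi p s)) has_real_derivative Mom 1 t / Mom 0 t) (at t)"
    unfolding Phi_eq[abs_def] using Mom0_pos[of t] Mom_deriv[of 0 t]
    by (auto intro!: derivative_eq_intros)
  then show ?thesis unfolding mean_fun_def by (rule DERIV_imp_deriv)
qed

lemma mean_fun_cont: "isCont (mean_fun p) t"
  unfolding mean_fun_eq[abs_def]
  using Mom0_pos[of t] by (intro continuous_intros DERIV_isCont[OF Mom_deriv]) simp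

text \<open>With \<open>m\<close> the mean at \<open>t\<close>, the factors \<open>x - m\<close> and
  \<open>exp ((s - t) * x) - exp ((s - t) * m)\<close> have the same sign, so their product is
  nonnegative and vanishes only at \<open>m\<close>. Integrated against
  \<open>exp (t * x) * p x\<close>, the second exponential contributes \<open>0\<close> by the
  choice of \<open>m\<close>, and what remains is \<open>Mom 1 s - m * Mom 0 s\<close>.\<close>

lemma mean_fun_strict_mono:
  assumes "t < s"
  shows "mean_fun p t < mean_fun p s"
proof -
  let ?m = "mean_fun p t" and ?\<delta> = "s - t"
  let ?f = "\<lambda>x. (x - ?m) * (exp (s * x) - exp (?\<delta> * ?m) * exp (t * x)) * p x"
  have fac: "exp (s * x) - exp (?\<delta> * ?m) * exp (t * x) = exp (t * x) * (exp (?\<delta> * x) - exp (?\<delta> * ?m))" for x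
    by (simp add: right_diff_distrib mult_ac exp_add[symmetric])
  have sgn: "0 \<le> (x - ?m) * (exp (?\<delta> * x) - exp (?\<delta> * ?m))" for x
    using assms by (cases "x \<ge> ?m") (auto intro!: mult_nonneg_nonneg mult_nonpos_nonpos mult_left_mono)
  have nn: "0 \<le> ?f x" for x
  proof -
    have "?f x = exp (t * x) * ((x - ?m) * (exp (?\<delta> * x) - exp (?\<delta> * ?m))) * p x" unfolding fac by (simp only: mult_ac)
    also have "0 \<le> \<dots>" by (intro mult_nonneg_nonneg sgn p_nonneg) auto
    finally show ?thesis .
  qed
  have H: "has_bochner_integral lborel (\<lambda>x. x ^ k * exp (u * x) * p x) (Mom k u)" for k u
    using Mom_integrable by (simp add: Mom_def has_bochner_integral_iff)
  have "has_bochner_integral lborel (\<lambda>x. (x ^ 1 * exp (s * x) * p x - ?m * (x ^ 0 * exp (s * x) * p x))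
      - exp (?\<delta> * ?m) * (x ^ 1 * exp (t * x) * p x - ?m * (x ^ 0 * exp (t * x) * p x)))
      ((Mom 1 s - ?m * Mom 0 s) - exp (?\<delta> * ?m) * (Mom 1 t - ?m * Mom 0 t))"
    by (intro has_bochner_integral_diff has_bochner_integral_mult_right H)
  also have "(\<lambda>x. (x ^ 1 * exp (s * x) * p x - ?m * (x ^ 0 * exp (s * x) * p x))
      - exp (?\<delta> * ?m) * (x ^ 1 * exp (t * x) * p x - ?m * (x ^ 0 * exp (t * x) * p x))) = ?f"
    by (simp add: fun_eq_iff algebra_simps)
  also have "Mom 1 t - ?m * Mom 0 t = 0" using Mom0_pos[of t] by (simp add: mean_fun_eq)
  finally have I: "has_bochner_integral lborel ?f (Mom 1 s - ?m * Mom 0 s)" by simp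
  have "(\<integral>x. ?f x \<partial>lborel) \<noteq> 0"
  proof
    assume "(\<integral>x. ?f x \<partial>lborel) = 0"
    then have "AE x in lborel. ?f x = 0"
      using integral_nonneg_eq_0_iff_AE[of lborel ?f] I nn by (auto simp: has_bochner_integral_iff)
    then have "AE x in lborel. p x = 0"
      using AE_lborel_singleton[of ?m]
    proof eventually_elim
      case (elim x)
      then have "exp (?\<delta> * x) \<noteq> exp (?\<delta> * ?m)" using assms by simp
      then show ?case using elim unfolding fac by simp
    qed
    then show False using AE_p_contradiction by blast
  qed
  moreover have "0 \<le> (\<integral>x. ?f x \<partial>lborel)" using nn by (intro Bochner_Integration.integral_nonneg)
  ultimately have "0 < Mom 1 s - ?m * Mom 0 s" using I by (simp add: has_bochner_integral_iff)
  then show ?thesis using Mom0_pos[of s] by (simp add: mean_fun_eq[of s] field_simps)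
qed

text \<open>The mean is continuous and strictly increasing and unbounded along the naturals, so
  every value above \<open>mean_fun p 0\<close> is attained exactly once and the description in
  \<open>tilt_param\<close> is proper for large \<open>a n\<close>. A bounded parameter would bound
  the mean.\<close>

lemma tilt_param_limit:
  assumes m: "filterlim (\<lambda>n::nat. mean_fun p (real n)) at_top sequentially"
    and a: "filterlim a at_top sequentially"
  shows "\<forall>\<^sub>F n in sequentially. mean_fun p (tilt_param p (a n)) = a n"
    and "filterlim (\<lambda>n. tilt_param p (a n)) at_top sequentially"
proof -
  have ex: "mean_fun p (tilt_param p b) = b" if b: "b \<ge> mean_fun p 0" for b
  proof -
    have "\<forall>\<^sub>F n in sequentially. b \<le> mean_fun p (real n)" using m by (simp add: filterlim_at_top)
    then obtain n :: nat where n: "b \<le> mean_fun p (real n)" by (auto simp: eventually_sequentially)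
    obtain t where t: "mean_fun p t = b"
      using IVT[of "mean_fun p" 0 b "real n"] b n mean_fun_cont by auto
    have "tilt_param p b = t"
      unfolding tilt_param_def
    proof (rule the_equality)
      show "mean_fun p t = b" by (rule t)
      fix s assume "mean_fun p s = b"
      then show "s = t" using t mean_fun_strict_mono[of s t] mean_fun_strict_mono[of t s] by (cases s t rule: linorder_cases) auto
    qed
    with t show ?thesis by simp
  qed
  have "\<forall>\<^sub>F n in sequentially. mean_fun p 0 \<le> a n" using a by (simp add: filterlim_at_top)
  then show *: "\<forall>\<^sub>F n in sequentially. mean_fun p (tilt_param p (a n)) = a n" by eventually_elim (rule ex)
  show "filterlim (\<lambda>n. tilt_param p (a n)) at_top sequentially"
    unfolding filterlim_at_top_dense
  proof
    fix Z
    have "\<forall>\<^sub>F n in sequentially. mean_fun p Z < a n" using a by (simp add: filterlim_at_top_dense)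
    with * show "\<forall>\<^sub>F n in sequentially. Z < tilt_param p (a n)"
    proof eventually_elim
      case (elim n)
      show ?case
      proof (rule ccontr)
        assume "\<not> Z < tilt_param p (a n)"
        then have "mean_fun p (tilt_param p (a n)) \<le> mean_fun p Z"
          using mean_fun_strict_mono[of "tilt_param p (a n)" Z] by (cases "tilt_param p (a n) = Z") auto
        then show False using elim by simp
      qed
    qed
  qed
qed

end

section \<open>Conditional density\<close>

text \<open>The substitution \<open>v = x n + \<sigma> n * z\<close> expresses mean and deviation of
  the tilted density through the moments of \<open>w n\<close>. The local estimate uses the exact
  mean and the exact deviation \<open>s n\<close>, so the standardized moments match the normal
  ones; that these are close to \<open>x n\<close> and \<open>\<sigma> n\<close> is stated
  separately.\<close>

lemma (in laplace_peak) tilted_local_limit: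
  assumes "exp_density p"
  defines "\<pi> \<equiv> \<lambda>n x. exp (T n * x) * p x / Phi p (T n)"
  obtains s \<kappa> :: "nat \<Rightarrow> real" and C :: real
  where "\<kappa> \<longlonglongrightarrow> 0" "(\<lambda>n. s n / \<sigma> n) \<longlonglongrightarrow> 1" "(\<lambda>n. (mean_fun p (T n) - x n) / \<sigma> n) \<longlonglongrightarrow> 0"
    and "\<forall>\<^sub>F n in sequentially. 0 < s n \<and> real_distribution (lborel_density (\<pi> n)) \<and>
      (\<forall>y. \<pi> n y \<le> C / s n) \<and>
      (\<forall>N\<ge>2. \<forall>y. \<bar>fourier_density (\<lambda>u. char (lborel_density (\<pi> n)) u ^ N) y * s n
        - normal_density 0 (sqrt N) ((y - N * mean_fun p (T n)) / s n)\<bar>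
        \<le> \<kappa> n * cube_gaussian / N + (3 / 4) ^ (N - 2) * (C + 1))"
proof -
  interpret E: exp_density p by fact
  obtain D where D: "\<forall>\<^sub>F n in sequentially. \<forall>z. w n z \<le> D * exp (- \<bar>z\<bar> / 8)"
    using w_bound by blast
  interpret gl: gaussian_limit w D
    by unfold_locales (use w_nonneg w_lim D in auto)
  \<comment> \<open>The height by which \<open>w n\<close> was normalized. It cancels in the tilted
    density, which divides by \<open>Phi\<close>.\<close>
  define R where "R n = c * exp (T n * x n - g (x n))" for n
  have R0: "R n > 0" for n using c by (simp add: R_def)
  have w_R: "exp (T n * (x n + \<sigma> n * z)) * p (x n + \<sigma> n * z) = R n * w n z" for n z
    using c by (simp add: w_def R_def exp_diff)
  have Mom0: "\<forall>\<^sub>F n in sequentially. E.Mom 0 (T n) = R n * \<sigma> n * gl.moment 0 n"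
    using \<sigma>
  proof eventually_elim
    case (elim n)
    have "E.Mom 0 (T n) = \<bar>\<sigma> n\<bar> *\<^sub>R (\<integral>z. (x n + \<sigma> n * z) ^ 0 * exp (T n * (x n + \<sigma> n * z)) * p (x n + \<sigma> n * z) \<partial>lborel)"
      unfolding E.Mom_def using elim by (intro lborel_integral_real_affine) auto
    also have "\<dots> = \<sigma> n * (\<integral>z. R n * (z ^ 0 * w n z) \<partial>lborel)"
      using elim by (simp add: w_R)
    finally show ?case by (simp add: gl.moment_def)
  qed
  have Mom1: "\<forall>\<^sub>F n in sequentially. E.Mom 1 (T n) = R n * \<sigma> n * (x n * gl.moment 0 n + \<sigma> n * gl.moment 1 n)"
    using \<sigma> gl.eventually_integrable_moments
  proof eventually_elim
    case (elim n)
    have "E.Mom 1 (T n) = \<bar>\<sigma> n\<bar> *\<^sub>R (\<integral>z. (x n + \<sigma> n * z) ^ 1 * exp (T n * (x n + \<sigma> n * z)) * p (x n + \<sigma> n * z) \<partial>lborel)"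
      unfolding E.Mom_def using elim by (intro lborel_integral_real_affine) auto
    also have "(\<lambda>z. (x n + \<sigma> n * z) ^ 1 * exp (T n * (x n + \<sigma> n * z)) * p (x n + \<sigma> n * z))
        = (\<lambda>z. R n * (x n * (z ^ 0 * w n z) + \<sigma> n * (z ^ 1 * w n z)))"
      unfolding mult.assoc w_R by (simp add: fun_eq_iff algebra_simps)
    also have "(\<integral>z. R n * (x n * (z ^ 0 * w n z) + \<sigma> n * (z ^ 1 * w n z)) \<partial>lborel)
        = R n * (x n * gl.moment 0 n + \<sigma> n * gl.moment 1 n)"
    proof -
      have i: "integrable lborel (\<lambda>z. d * (z ^ k * w n z))" for d :: real and k
        using elim(2) by (intro integrable_mult_right) auto
      show ?thesis
        unfolding gl.moment_def integral_mult_right_zero Bochner_Integration.integral_add[OF i i] ..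
    qed
    finally show ?case using elim by simp
  qed
  have mean: "\<forall>\<^sub>F n in sequentially. mean_fun p (T n) = x n + \<sigma> n * gl.mean n"
    using Mom0 Mom1 \<sigma> gl.eventually_normalized
  proof eventually_elim
    case (elim n)
    have "mean_fun p (T n) = (R n * \<sigma> n) * (x n * gl.moment 0 n + \<sigma> n * gl.moment 1 n) / ((R n * \<sigma> n) * gl.moment 0 n)"
      unfolding E.mean_fun_eq using elim by simp
    also have "\<dots> = (x n * gl.moment 0 n + \<sigma> n * gl.moment 1 n) / gl.moment 0 n"
      using R0[of n] elim by (intro mult_divide_mult_cancel_left) auto
    also have "\<dots> = x n + \<sigma> n * gl.mean n"
      using elim by (simp add: gl.mean_def add_divide_distrib)
    finally show ?case .
  qed
  define s where "s n = \<sigma> n * gl.dev n" for n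
  have f_eq: "\<forall>\<^sub>F n in sequentially. \<forall>z. s n * \<pi> n (mean_fun p (T n) + s n * z) = gl.f n z"
    using Mom0 mean \<sigma> gl.eventually_normalized
  proof eventually_elim
    case (elim n)
    show ?case
    proof
      fix z
      have arg: "mean_fun p (T n) + s n * z = x n + \<sigma> n * (gl.mean n + gl.dev n * z)"
        using elim by (simp add: s_def algebra_simps)
      show "s n * \<pi> n (mean_fun p (T n) + s n * z) = gl.f n z"
        unfolding arg \<pi>_def w_R E.Phi_eq using elim R0[of n] by (simp add: gl.f_def s_def)
    qed
  qed
  have \<pi>m [measurable]: "\<pi> n \<in> borel_measurable borel" for n unfolding \<pi>_def by measurable
  have \<pi>0: "0 \<le> \<pi> n y" for n y
    unfolding \<pi>_def E.Phi_eq using E.Mom0_pos[of "T n"] p_nonneg by simp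
  have \<pi>dist: "real_distribution (lborel_density (\<pi> n))" for n
  proof (intro real_distribution.intro real_distribution_axioms.intro prob_spaceI)
    have "has_bochner_integral lborel (\<pi> n) (E.Mom 0 (T n) / Phi p (T n))"
      unfolding \<pi>_def using E.exp_integrable[of "T n"]
      by (intro has_bochner_integral_divide_zero) (simp add: E.Mom_def has_bochner_integral_iff)
    then have "has_bochner_integral lborel (\<pi> n) 1"
      using E.Mom0_pos[of "T n"] by (simp add: E.Phi_eq)
    then show "emeasure (lborel_density (\<pi> n)) (space (lborel_density (\<pi> n))) = 1"
      using \<pi>0 by (simp add: emeasure_density nn_integral_eq_integral has_bochner_integral_iff)
  qed simp
  have \<kappa>le: "\<forall>\<^sub>F n in sequentially. gl.\<kappa> n < 1 / 8" by (rule order_tendstoD[OF gl.\<kappa>_lim]) simp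
  show thesis
  proof (rule that[of gl.\<kappa> s "2 * D"])
    show "gl.\<kappa> \<longlonglongrightarrow> 0" by (rule gl.\<kappa>_lim)
    have "\<forall>\<^sub>F n in sequentially. gl.dev n = s n / \<sigma> n"
      using \<sigma> by eventually_elim (simp add: s_def)
    with gl.dev_lim show "(\<lambda>n. s n / \<sigma> n) \<longlonglongrightarrow> 1" by (rule Lim_transform_eventually)
    have "\<forall>\<^sub>F n in sequentially. gl.mean n = (mean_fun p (T n) - x n) / \<sigma> n"
      using \<sigma> mean by eventually_elim simp
    with gl.mean_lim show "(\<lambda>n. (mean_fun p (T n) - x n) / \<sigma> n) \<longlonglongrightarrow> 0" by (rule Lim_transform_eventually)
    show "\<forall>\<^sub>F n in sequentially. 0 < s n \<and> real_distribution (lborel_density (\<pi> n)) \<and>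
      (\<forall>y. \<pi> n y \<le> 2 * D / s n) \<and>
      (\<forall>N\<ge>2. \<forall>y. \<bar>fourier_density (\<lambda>u. char (lborel_density (\<pi> n)) u ^ N) y * s n
        - normal_density 0 (sqrt N) ((y - N * mean_fun p (T n)) / s n)\<bar>
        \<le> gl.\<kappa> n * cube_gaussian / N + (3 / 4) ^ (N - 2) * (2 * D + 1))"
      using f_eq \<sigma> gl.eventually_normalized gl.eventually_integrable_\<kappa> \<kappa>le
    proof eventually_elim
      case (elim n)
      let ?m = "mean_fun p (T n)"
      have s: "s n > 0" using elim by (simp add: s_def)
      note nrm = elim(3)
      have fle: "gl.f n z \<le> 2 * D" for z using nrm by (intro gl.f_le) auto
      have le: "\<pi> n y \<le> 2 * D / s n" for y
      proof -
        have "s n * \<pi> n (?m + s n * ((y - ?m) / s n)) \<le> 2 * D"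
          unfolding elim(1)[rule_format] by (rule fle)
        then show ?thesis using s by (simp add: field_simps)
      qed
      have "\<bar>fourier_density (\<lambda>u. char (lborel_density (\<pi> n)) u ^ N) y * s n
        - normal_density 0 (sqrt N) ((y - N * ?m) / s n)\<bar>
        \<le> gl.\<kappa> n * cube_gaussian / N + (3 / 4) ^ (N - 2) * (2 * D + 1)" if N: "N \<ge> 2" for N :: nat and y
      proof -
        have "fourier_density (\<lambda>u. char (lborel_density (\<pi> n)) u ^ N) y
            = fourier_density (\<lambda>v. char (density lborel (\<lambda>z. ennreal (s n * \<pi> n (?m + s n * z)))) v ^ N) ((y - N * ?m) / s n) / s n"
          by (rule fourier_density_char_affine[OF \<pi>m \<pi>0 s])
        also have "(\<lambda>z. ennreal (s n * \<pi> n (?m + s n * z))) = (\<lambda>z. ennreal (gl.f n z))"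
          using elim(1) by simp
        finally have "fourier_density (\<lambda>u. char (lborel_density (\<pi> n)) u ^ N) y * s n
            = fourier_density (\<lambda>v. char (lborel_density (gl.f n)) v ^ N) ((y - N * ?m) / s n)"
          using s by simp
        moreover have "\<bar>fourier_density (\<lambda>v. char (lborel_density (gl.f n)) v ^ N) ((y - N * ?m) / s n)
            - normal_density 0 (sqrt N) ((y - N * ?m) / s n)\<bar> \<le> gl.\<kappa> n * cube_gaussian / N + (3 / 4) ^ (N - 2) * (2 * D + 1)"
        proof (rule local_limit_error[OF gl.f_measurable])
          show "0 \<le> gl.f n z" for z using nrm by (intro gl.f_nonneg) auto
          show "has_bochner_integral lborel (gl.f n) 1"
            "has_bochner_integral lborel (\<lambda>z. gl.f n z * z) 0"
            "has_bochner_integral lborel (\<lambda>z. gl.f n z * z\<^sup>2) 1"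
            using nrm by (auto intro!: gl.f_moments)
          show "(\<integral>x. (1 + \<bar>x\<bar> ^ 3) * \<bar>gl.f n x - std_normal_density x\<bar> \<partial>lborel) = gl.\<kappa> n"
            by (simp add: gl.\<kappa>_def)
        qed (use elim fle N in auto)
        ultimately show ?thesis by simp
      qed
      with s \<pi>dist le show ?case by blast
    qed
  qed
qed

lemma R_class_gen_inv_asymp:
  fixes T :: "nat \<Rightarrow> real"
  assumes h: "h \<in> R_class" and bdd: "\<And>A. bdd_above (h ` {0..A})"
    and T: "filterlim T at_top sequentially"
  defines "x \<equiv> \<lambda>n. gen_inv h (T n)" and "\<sigma> \<equiv> \<lambda>n. sqrt (deriv (gen_inv h) (T n))"
  shows "\<exists>A. mono_on {A..} h" "filterlim h at_top at_top"
    and "filterlim x at_top sequentially" "\<forall>\<^sub>F n in sequentially. 0 < \<sigma> n"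
    and "(\<lambda>n. \<sigma> n / x n) \<longlonglongrightarrow> 0"
    and "\<And>z. (\<lambda>n. \<sigma> n * (h (x n + \<sigma> n * z) - T n)) \<longlonglongrightarrow> z"
proof -
  consider "h \<in> R_infty" | \<beta> where "h \<in> R_beta \<beta>" "\<beta> > 0" using h by (auto simp: R_class_def)
  then have "(\<exists>A. mono_on {A..} h) \<and> filterlim h at_top at_top \<and> filterlim x at_top sequentially \<and>
    (\<forall>\<^sub>F n in sequentially. 0 < \<sigma> n) \<and> (\<lambda>n. \<sigma> n / x n) \<longlonglongrightarrow> 0 \<and>
    (\<forall>z. (\<lambda>n. \<sigma> n * (h (x n + \<sigma> n * z) - T n)) \<longlonglongrightarrow> z)"
  proof cases
    case 1
    then show ?thesis using R_infty_gen_inv_asymp[OF 1 T] unfolding x_def \<sigma>_def by blast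
  next
    case 2
    then show ?thesis using R_beta_gen_inv_asymp[OF 2 bdd T] unfolding x_def \<sigma>_def by blast
  qed
  then show "\<exists>A. mono_on {A..} h" "filterlim h at_top at_top"
    "filterlim x at_top sequentially" "\<forall>\<^sub>F n in sequentially. 0 < \<sigma> n"
    "(\<lambda>n. \<sigma> n / x n) \<longlonglongrightarrow> 0"
    "\<And>z. (\<lambda>n. \<sigma> n * (h (x n + \<sigma> n * z) - T n)) \<longlonglongrightarrow> z"
    by blast+
qed

text \<open>Beyond some \<open>Z\<close> the exponent satisfies
  \<open>g x \<ge> (\<bar>t\<bar> + 1) * x\<close>: the part \<open>\<bar>t\<bar>\<close> absorbs
  the tilting and the extra \<open>1\<close> leaves the majorant
  \<open>exp (- \<bar>x\<bar>)\<close>. Up to \<open>Z\<close> boundedness of \<open>p\<close>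
  suffices.\<close>

lemma exp_density_superlinear:
  fixes p g q :: "real \<Rightarrow> real" and c A B :: real
  assumes pm [measurable]: "p \<in> borel_measurable borel"
    and c: "c > 0" and p_pos: "\<And>v. v \<ge> 0 \<Longrightarrow> p v = c * exp (- (g v - q v))"
    and p_neg: "\<And>v. v < 0 \<Longrightarrow> p v = 0" and p_le: "\<And>v. p v \<le> B"
    and mass: "has_bochner_integral lborel p 1"
    and g: "filterlim (\<lambda>x. g x / x) at_top at_top" and q: "\<And>v. v \<ge> A \<Longrightarrow> q v \<le> 1"
  shows "exp_density p"
proof
  show p0: "0 \<le> p v" for v using p_pos[of v] p_neg[of v] c by (cases "v < 0") auto
  fix t :: real
  have "\<forall>\<^sub>F x in at_top. \<bar>t\<bar> + 1 \<le> g x / x \<and> max A 1 \<le> x"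
    using g eventually_ge_at_top[of "max A 1"] by (auto simp: filterlim_at_top intro: eventually_conj)
  then obtain Z where Z: "\<And>x. x \<ge> Z \<Longrightarrow> \<bar>t\<bar> + 1 \<le> g x / x \<and> max A 1 \<le> x"
    unfolding eventually_at_top_linorder by blast
  let ?K = "c * exp 1 + B * exp ((\<bar>t\<bar> + 1) * Z)"
  have B0: "0 \<le> B" using p0[of 0] p_le[of 0] by simp
  show "integrable lborel (\<lambda>x. exp (t * x) * p x)"
  proof (rule Bochner_Integration.integrable_bound)
    show "integrable lborel (\<lambda>x. ?K * (\<bar>x\<bar> ^ 0 * exp (- \<bar>x\<bar> / 1)))"
      by (intro integrable_mult_right integrable_power_exp_abs) simp
    show "AE x in lborel. norm (exp (t * x) * p x) \<le> norm (?K * (\<bar>x\<bar> ^ 0 * exp (- \<bar>x\<bar> / 1)))"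
    proof (rule AE_I2)
      fix x :: real
      have "exp (t * x) * p x \<le> ?K * exp (- \<bar>x\<bar>)"
      proof (cases "x < 0")
        case True
        then show ?thesis using c B0 by (simp add: p_neg)
      next
        case False
        show ?thesis
        proof (cases "x \<ge> Z")
          case True
          then have x: "x \<ge> 1" "x \<ge> A" "\<bar>t\<bar> + 1 \<le> g x / x" using Z[OF True] by auto
          then have "(\<bar>t\<bar> + 1) * x \<le> g x" by (simp add: pos_le_divide_eq)
          moreover have "t * x \<le> \<bar>t\<bar> * x" using x by (intro mult_right_mono) auto
          moreover have "\<bar>x\<bar> = x" using x by simp
          ultimately have "t * x + - (g x - q x) \<le> 1 + - \<bar>x\<bar>"
            using q[OF x(2)] unfolding distrib_right by linarith
          then have "exp (t * x) * exp (- (g x - q x)) \<le> exp 1 * exp (- \<bar>x\<bar>)"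
            unfolding exp_add[symmetric] by (simp only: exp_le_cancel_iff)
          then have "c * (exp (t * x) * exp (- (g x - q x))) \<le> c * (exp 1 * exp (- \<bar>x\<bar>))"
            using c by (intro mult_left_mono) auto
          then have "exp (t * x) * p x \<le> c * exp 1 * exp (- \<bar>x\<bar>)"
            using p_pos[of x] x by (simp add: mult_ac)
          also have "\<dots> \<le> ?K * exp (- \<bar>x\<bar>)" using B0 by (intro mult_right_mono) auto
          finally show ?thesis .
        next
          case F: False
          have "t * x \<le> \<bar>t\<bar> * x" using False by (intro mult_right_mono) auto
          moreover have "\<bar>t\<bar> * x \<le> \<bar>t\<bar> * Z" using F by (intro mult_left_mono) auto
          ultimately have "t * x \<le> (\<bar>t\<bar> + 1) * Z + - \<bar>x\<bar>"
            using F False unfolding distrib_right by linarith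
          then have "exp (t * x) \<le> exp ((\<bar>t\<bar> + 1) * Z) * exp (- \<bar>x\<bar>)"
            unfolding exp_add[symmetric] by (simp only: exp_le_cancel_iff)
          then have "exp (t * x) * p x \<le> (exp ((\<bar>t\<bar> + 1) * Z) * exp (- \<bar>x\<bar>)) * B"
            using p_le p0 by (intro mult_mono) auto
          also have "\<dots> = B * exp ((\<bar>t\<bar> + 1) * Z) * exp (- \<bar>x\<bar>)" by (simp only: mult_ac)
          also have "\<dots> \<le> ?K * exp (- \<bar>x\<bar>)" using c by (intro mult_right_mono) auto
          finally show ?thesis .
        qed
      qed
      also have "\<dots> \<le> norm (?K * (\<bar>x\<bar> ^ 0 * exp (- \<bar>x\<bar> / 1)))" by simp
      finally show "norm (exp (t * x) * p x) \<le> norm (?K * (\<bar>x\<bar> ^ 0 * exp (- \<bar>x\<bar> / 1)))"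
        using p0 by simp
    qed
  qed measurable
qed (use pm p_neg mass in auto)

section \<open>Calculus of relative errors \<open>o(1 / sqrt n)\<close>\<close>

lemma sqrt_error_imp_tendsto_1:
  fixes u :: "nat \<Rightarrow> real"
  assumes "(\<lambda>n. sqrt n * (u n - 1)) \<longlonglongrightarrow> 0"
  shows "u \<longlonglongrightarrow> 1"
proof -
  have "(\<lambda>n. 1 / sqrt (real n)) \<longlonglongrightarrow> 0"
    by (intro tendsto_divide_0[OF tendsto_const] filterlim_at_top_imp_at_infinity
        filterlim_compose[OF sqrt_at_top filterlim_real_sequentially])
  then have "(\<lambda>n. 1 / sqrt (real n) * (sqrt n * (u n - 1))) \<longlonglongrightarrow> 0 * 0" by (intro tendsto_mult assms)
  moreover have "\<forall>\<^sub>F n in sequentially. 1 / sqrt (real n) * (sqrt n * (u n - 1)) = u n - 1"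
    using eventually_gt_at_top[of 0] by eventually_elim simp
  ultimately have "(\<lambda>n. u n - 1) \<longlonglongrightarrow> 0" by (auto elim: Lim_transform_eventually)
  then show ?thesis by (simp add: LIM_zero_iff)
qed

lemma sqrt_error_mult:
  fixes u v :: "nat \<Rightarrow> real"
  assumes u: "(\<lambda>n. sqrt n * (u n - 1)) \<longlonglongrightarrow> 0" and v: "(\<lambda>n. sqrt n * (v n - 1)) \<longlonglongrightarrow> 0"
  shows "(\<lambda>n. sqrt n * (u n * v n - 1)) \<longlonglongrightarrow> 0"
proof -
  have "(\<lambda>n. sqrt n * (u n - 1) * v n + sqrt n * (v n - 1)) \<longlonglongrightarrow> 0 * 1 + 0"
    by (intro tendsto_intros u v sqrt_error_imp_tendsto_1[OF v])
  moreover have "sqrt n * (u n - 1) * v n + sqrt n * (v n - 1) = sqrt n * (u n * v n - 1)" for n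
    by (simp add: algebra_simps)
  ultimately show ?thesis by simp
qed

lemma sqrt_error_inverse:
  fixes u :: "nat \<Rightarrow> real"
  assumes u: "(\<lambda>n. sqrt n * (u n - 1)) \<longlonglongrightarrow> 0"
  shows "(\<lambda>n. sqrt n * (inverse (u n) - 1)) \<longlonglongrightarrow> 0"
proof -
  have u1: "u \<longlonglongrightarrow> 1" by (rule sqrt_error_imp_tendsto_1[OF u])
  then have "\<forall>\<^sub>F n in sequentially. 0 < u n" by (rule order_tendstoD) simp
  then have "\<forall>\<^sub>F n in sequentially. - (sqrt n * (u n - 1)) * inverse (u n) = sqrt n * (inverse (u n) - 1)"
    by eventually_elim (simp add: field_simps)
  moreover have "(\<lambda>n. - (sqrt n * (u n - 1)) * inverse (u n)) \<longlonglongrightarrow> - 0 * inverse 1"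
    by (intro tendsto_intros u u1) simp
  ultimately show ?thesis by (auto elim: Lim_transform_eventually)
qed

lemma inverse_sqrt_lim: "(\<lambda>n. C / sqrt (real n)) \<longlonglongrightarrow> 0"
  by (intro tendsto_divide_0[OF tendsto_const] filterlim_at_top_imp_at_infinity
      filterlim_compose[OF sqrt_at_top filterlim_real_sequentially])

text \<open>Compares the normalizations of sums with \<open>n\<close> and with \<open>n - k\<close>
  terms. As \<open>sqrt r \<le> r\<close> for \<open>r \<ge> 1\<close>, the error is at most
  \<open>k / (n - k) \<le> 2 * k / n\<close> for \<open>n > 2 * k\<close>.\<close>

lemma sqrt_error_shift: "(\<lambda>n. sqrt n * (sqrt (real n / real (n - k)) - 1)) \<longlonglongrightarrow> 0"
proof (rule Lim_null_comparison[OF _ inverse_sqrt_lim[of "2 * real k"]])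
  show "\<forall>\<^sub>F n in sequentially. norm (sqrt n * (sqrt (real n / real (n - k)) - 1)) \<le> 2 * real k / sqrt n"
    using eventually_gt_at_top[of "2 * k"]
  proof eventually_elim
    case (elim n)
    define N where "N = real n - real k"
    have N: "real (n - k) = N" "0 < N" "real n \<le> 2 * N" "N \<le> real n" using elim by (auto simp: N_def)
    have 1: "1 \<le> real n / N" using N by simp
    have "sqrt (real n / N) \<le> real n / N" using 1 real_le_lsqrt[of "real n / N" "real n / N"] by (simp add: self_le_power)
    also have "real n / N - 1 = real k / N" using N by (simp add: N_def field_simps)
    finally have "sqrt (real n / N) - 1 \<le> real k / N" using \<open>real n / N - 1 = real k / N\<close> by linarith
    also have "\<dots> \<le> real k / (real n / 2)" using N elim by (intro divide_left_mono) auto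
    finally have "sqrt n * (sqrt (real n / N) - 1) \<le> sqrt n * (real k / (real n / 2))" by (intro mult_left_mono) auto
    also have "\<dots> = 2 * real k / sqrt n" using elim by (simp add: real_div_sqrt field_simps)
    finally show ?case using 1 N by simp
  qed
qed

text \<open>Multiplication by \<open>sqrt (2 * pi * N)\<close> removes the height of the normal
  density. The error \<open>\<kappa> * K / N\<close> becomes \<open>O(\<kappa> / sqrt N)\<close>,
  hence \<open>o(1 / sqrt n)\<close> because \<open>n \<le> 2 * N\<close>; the remaining factor
  \<open>exp (- v^2 / (2 * N))\<close> differs from \<open>1\<close> by at most
  \<open>v^2 / (2 * N)\<close>.\<close>

lemma sqrt_error_of_local_limit:
  fixes \<kappa> v G :: "nat \<Rightarrow> real" and N :: "nat \<Rightarrow> nat"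
  assumes \<kappa>: "\<kappa> \<longlonglongrightarrow> 0" and N: "filterlim N at_top sequentially" "\<forall>\<^sub>F n in sequentially. n \<le> 2 * N n"
    and v: "(\<lambda>n. sqrt n * (v n)\<^sup>2 / N n) \<longlonglongrightarrow> 0"
    and G: "\<forall>\<^sub>F n in sequentially. \<bar>G n - normal_density 0 (sqrt (N n)) (v n)\<bar> \<le> \<kappa> n * K / N n + (3 / 4) ^ (N n - 2) * C"
  shows "(\<lambda>n. sqrt n * (sqrt (2 * pi * N n) * G n - 1)) \<longlonglongrightarrow> 0"
proof -
  have N2: "\<forall>\<^sub>F n in sequentially. 2 \<le> N n" using N(1) by (simp add: filterlim_at_top)
  have "(\<lambda>n. real n * (3 / 4) ^ n) \<longlonglongrightarrow> (0 :: real)" using powser_times_n_limit_0[of "3 / 4 :: real"] by simp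
  then have "(\<lambda>n. real (N n) * (3 / 4) ^ N n) \<longlonglongrightarrow> (0 :: real)" by (rule filterlim_compose[OF _ N(1)])
  \<comment> \<open>\<open>sqrt (4 * pi)\<close> stems from
    \<open>sqrt n * sqrt (2 * pi * N) \<le> sqrt (4 * pi) * N\<close>, and \<open>16 / 9\<close>
    restores the two missing factors of \<open>(3 / 4) ^ (N - 2)\<close>.\<close>
  then have "(\<lambda>n. sqrt (4 * pi) * (\<kappa> n * K + 16 / 9 * (real (N n) * (3 / 4) ^ N n) * C) + sqrt n * (v n)\<^sup>2 / N n)
      \<longlonglongrightarrow> sqrt (4 * pi) * (0 * K + 16 / 9 * 0 * C) + 0"
    by (intro tendsto_intros \<kappa> v)
  then have lim: "(\<lambda>n. sqrt (4 * pi) * (\<kappa> n * K + 16 / 9 * (real (N n) * (3 / 4) ^ N n) * C) + sqrt n * (v n)\<^sup>2 / N n) \<longlonglongrightarrow> 0"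
    by simp
  show ?thesis
  proof (rule Lim_null_comparison[OF _ lim])
    show "\<forall>\<^sub>F n in sequentially. norm (sqrt n * (sqrt (2 * pi * N n) * G n - 1))
        \<le> sqrt (4 * pi) * (\<kappa> n * K + 16 / 9 * (real (N n) * (3 / 4) ^ N n) * C) + sqrt n * (v n)\<^sup>2 / N n"
      using N(2) N2 G
    proof eventually_elim
      case (elim n)
      define M where "M = real (N n)"
      have M: "M > 0" "real n \<le> 2 * M" using elim by (auto simp: M_def)
      define E where "E = \<kappa> n * K / M + (3 / 4) ^ (N n - 2) * C"
      have E: "\<bar>G n - normal_density 0 (sqrt M) (v n)\<bar> \<le> E" using elim by (simp add: E_def M_def)
      then have E0: "0 \<le> E" by simp
      define d where "d = exp (- (v n)\<^sup>2 / (2 * M))"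
      have d: "sqrt (2 * pi * M) * normal_density 0 (sqrt M) (v n) = d"
        using M by (simp add: normal_density_def d_def)
      have "\<bar>sqrt (2 * pi * M) * G n - d\<bar> = sqrt (2 * pi * M) * \<bar>G n - normal_density 0 (sqrt M) (v n)\<bar>"
      proof -
        have "sqrt (2 * pi * M) * G n - d = sqrt (2 * pi * M) * (G n - normal_density 0 (sqrt M) (v n))"
          unfolding right_diff_distrib d ..
        then show ?thesis using M by (simp add: abs_mult)
      qed
      also have "\<dots> \<le> sqrt (2 * pi * M) * E" using M by (intro mult_left_mono E) auto
      finally have 1: "\<bar>sqrt (2 * pi * M) * G n - d\<bar> \<le> sqrt (2 * pi * M) * E" .
      have "1 + (- (v n)\<^sup>2 / (2 * M)) \<le> d" unfolding d_def by (rule exp_ge_add_one_self)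
      moreover have "d \<le> 1" unfolding d_def using M by simp
      ultimately have "\<bar>d - 1\<bar> \<le> (v n)\<^sup>2 / (2 * M)" by (simp add: abs_if)
      also have "\<dots> \<le> (v n)\<^sup>2 / M" using M by (intro divide_left_mono) auto
      finally have 2: "\<bar>d - 1\<bar> \<le> (v n)\<^sup>2 / M" .
      have "\<bar>sqrt (2 * pi * M) * G n - 1\<bar> \<le> sqrt (2 * pi * M) * E + (v n)\<^sup>2 / M"
        using 1 2 by linarith
      then have "sqrt n * \<bar>sqrt (2 * pi * M) * G n - 1\<bar> \<le> sqrt n * (sqrt (2 * pi * M) * E + (v n)\<^sup>2 / M)"
        by (intro mult_left_mono) auto
      also have "\<dots> = sqrt n * sqrt (2 * pi * M) * E + sqrt n * (v n)\<^sup>2 / M" by (simp add: distrib_left)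
      also have "sqrt n * sqrt (2 * pi * M) * E \<le> sqrt (4 * pi) * M * E"
      proof (rule mult_right_mono[OF _ E0])
        have "sqrt n * sqrt (2 * pi * M) \<le> sqrt (2 * M) * sqrt (2 * pi * M)" using M by (intro mult_right_mono) auto
        also have "\<dots> = sqrt (4 * pi * M\<^sup>2)" by (simp add: real_sqrt_mult[symmetric] power2_eq_square mult_ac)
        also have "\<dots> = sqrt (4 * pi) * M" using M by (simp add: real_sqrt_mult)
        finally show "sqrt n * sqrt (2 * pi * M) \<le> sqrt (4 * pi) * M" .
      qed
      also have "sqrt (4 * pi) * M * E = sqrt (4 * pi) * (\<kappa> n * K + 16 / 9 * (M * (3 / 4) ^ N n) * C)"
      proof -
        have "(3 / 4 :: real) ^ N n = (3 / 4) ^ (N n - 2) * (3 / 4) ^ 2"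
          using elim(2) power_add[of "3 / 4 :: real" "N n - 2" 2] by (simp only: le_add_diff_inverse2)
        then have *: "(3 / 4 :: real) ^ (N n - 2) = 16 / 9 * (3 / 4) ^ N n" by (simp add: power2_eq_square)
        have "M * E = \<kappa> n * K + 16 / 9 * (M * (3 / 4) ^ N n) * C"
          unfolding E_def * using M by (simp add: distrib_left)
        then show ?thesis by (simp only: mult.assoc)
      qed
      finally show ?case by (simp add: M_def abs_mult)
    qed
  qed
qed

theorem theorem5p2:
  fixes M :: "'a measure" and X :: "nat \<Rightarrow> 'a \<Rightarrow> real"
    and p g h q :: "real \<Rightarrow> real" and c \<theta> :: real
    and a :: "nat \<Rightarrow> real" and k :: nat and y :: "nat \<Rightarrow> real"
  assumes "prob_space M"
    and "prob_space.indep_vars M (\<lambda>_. borel) X {1..}"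
    and "\<And>i. i \<ge> 1 \<Longrightarrow> distributed M lborel (X i) (\<lambda>x. ennreal (p x))"
    and "\<exists>B. \<forall>x. p x \<le> B"
    and "c > 0"
    and "\<And>x. x \<ge> 0 \<Longrightarrow> p x = c * exp (- (g x - q x))"
    and "\<And>x. x < 0 \<Longrightarrow> p x = 0"
    and "\<And>x. x \<ge> 0 \<Longrightarrow> g x > 0"
    and "filterlim (\<lambda>x. g x / x) at_top at_top"
    and "\<And>x. x \<ge> 0 \<Longrightarrow> (g has_real_derivative h x) (at x within {0..})"
    and "\<And>A. bdd_above (h ` {0..A})"
    and "\<theta> > 0"
    and "\<forall>\<^sub>F x in at_top. \<forall>v\<ge>0. \<bar>v - x\<bar> < \<theta> * x \<longrightarrow> \<bar>q v\<bar> \<le> 1 / sqrt (x * h x)"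
    and "h \<in> R_class"
    and "filterlim a at_top sequentially"
    and "(\<lambda>n. (gen_inv h (tilt_param p (a n)))\<^sup>2 /
               (sqrt (real n) * deriv (gen_inv h) (tilt_param p (a n)))) \<longlonglongrightarrow> 0"
    and "k \<ge> 1"
  shows "\<exists>r :: nat \<Rightarrow> real. r \<in> o(\<lambda>n. 1 / sqrt (real n)) \<and>
           (\<forall>\<^sub>F n in sequentially.
              cond_density M X p k n y (real n * a n) =
              (\<Prod>i=1..k. tilted_density p (a n) (y i)) * (1 + r n))"
proof -
  interpret prob_space M by fact
  note ind = assms(2) and X = assms(3) and c = assms(5) and p_pos = assms(6) and p_neg = assms(7)
    and g = assms(9) and g_deriv = assms(10) and bdd = assms(11) and q_bound = assms(13)
    and h = assms(14) and a = assms(15) and peak = assms(16)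
  obtain B where B: "\<And>x. p x \<le> B" using assms(4) by blast
  have p0: "0 \<le> p x" for x using p_pos[of x] p_neg[of x] c by (cases "x < 0") auto
  have "(\<lambda>x. ennreal (p x)) \<in> borel_measurable borel" using X[of 1] by (simp add: distributed_def)
  then have "(\<lambda>x. enn2real (ennreal (p x))) \<in> borel_measurable borel" by measurable
  then have pm [measurable]: "p \<in> borel_measurable borel" using p0 by simp
  have mass: "has_bochner_integral lborel p 1"
  proof (rule has_bochner_integral_nn_integral)
    have "X 1 \<in> measurable M lborel" "distr M lborel (X 1) = lborel_density p"
      using X[of 1] by (simp_all add: distributed_def)
    then have "prob_space (lborel_density p)" by (metis prob_space_distr)
    then show "(\<integral>\<^sup>+x. ennreal (p x) \<partial>lborel) = ennreal 1"
      using prob_space.emeasure_space_1[of "lborel_density p"] by (simp add: emeasure_density)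
  qed (use p0 in auto)

  \<comment> \<open>Verification of the peak conditions\<close>
  note R = R_class_gen_inv_asymp[OF h bdd]
  \<comment> \<open>This conclusion does not mention the sequence \<open>T\<close>; the naturals
    serve as a specimen.\<close>
  have h_top: "filterlim h at_top at_top" by (rule R(2)[OF filterlim_real_sequentially])
  have q_lim: "(q \<longlongrightarrow> 0) at_top"
  proof (rule Lim_null_comparison)
    show "((\<lambda>x. 1 / sqrt (x * h x)) \<longlongrightarrow> 0) at_top"
      by (intro tendsto_divide_0[OF tendsto_const] filterlim_at_top_imp_at_infinity
          filterlim_compose[OF sqrt_at_top] filterlim_at_top_mult_at_top filterlim_ident h_top)
    \<comment> \<open>The bound on \<open>q\<close> is taken at the centre \<open>v = x\<close> of
      its window.\<close>
    show "\<forall>\<^sub>F x in at_top. norm (q x) \<le> 1 / sqrt (x * h x)"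
      using q_bound eventually_gt_at_top[of 0] by eventually_elim (use assms(12) in auto)
  qed
  obtain A where A: "A > 0" "mono_on {A..} h" "\<And>v. v \<ge> A \<Longrightarrow> q v \<le> 1"
  proof -
    obtain A1 where A1: "mono_on {A1..} h" using R(1)[OF filterlim_real_sequentially] by blast
    have "\<forall>\<^sub>F v in at_top. q v < 1" by (rule order_tendstoD[OF q_lim]) simp
    then obtain A2 where A2: "\<And>v. v \<ge> A2 \<Longrightarrow> q v < 1" unfolding eventually_at_top_linorder by blast
    show thesis
    proof
      show "max 1 (max A1 A2) > 0" by simp
      show "mono_on {max 1 (max A1 A2)..} h" using A1 by (rule mono_on_subset) auto
      show "q v \<le> 1" if "v \<ge> max 1 (max A1 A2)" for v using A2[of v] that by simp
    qed
  qed
  interpret E: exp_density p by (rule exp_density_superlinear[OF pm c p_pos p_neg B mass g A(3)])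
  have lap: "laplace_peak p g h q c A B T (\<lambda>n. gen_inv h (T n)) (\<lambda>n. sqrt (deriv (gen_inv h) (T n)))"
    if T: "filterlim T at_top sequentially" for T
  proof
    show "\<forall>\<^sub>F n in sequentially. 0 \<le> T n" using T by (simp add: filterlim_at_top)
  qed (use pm c p_pos p_neg B g_deriv A q_lim R(3-)[OF T] in auto)

  \<comment> \<open>Mean and peak of the tilted law, and the tilting parameter\<close>
  have mean_top: "filterlim (\<lambda>n. mean_fun p (T n)) at_top sequentially"
    and mean_ratio: "(\<lambda>n. mean_fun p (T n) / gen_inv h (T n)) \<longlonglongrightarrow> 1"
    if T: "filterlim T at_top sequentially" for T
  proof -
    let ?x = "\<lambda>n. gen_inv h (T n)" and ?\<sigma> = "\<lambda>n. sqrt (deriv (gen_inv h) (T n))"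
    obtain "(\<lambda>n. (mean_fun p (T n) - ?x n) / ?\<sigma> n) \<longlonglongrightarrow> 0"
      by (rule laplace_peak.tilted_local_limit[OF lap[OF T] E.exp_density_axioms]) (rule that)
    then have "(\<lambda>n. (mean_fun p (T n) - ?x n) / ?\<sigma> n * (?\<sigma> n / ?x n) + 1) \<longlonglongrightarrow> 0 * 0 + 1"
      by (intro tendsto_intros R(5)[OF T])
    moreover have "\<forall>\<^sub>F n in sequentially. 0 < ?x n" using R(3)[OF T] by (simp add: filterlim_at_top_dense)
    with R(4)[OF T] have "\<forall>\<^sub>F n in sequentially. (mean_fun p (T n) - ?x n) / ?\<sigma> n * (?\<sigma> n / ?x n) + 1 = mean_fun p (T n) / ?x n"
    proof eventually_elim
      case (elim n)
      have "(m - x) / \<sigma> * (\<sigma> / x) + 1 = m / x" if "0 < \<sigma>" "0 < x" for m x \<sigma> :: real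
        using that by (simp add: field_simps)
      then show ?case using elim by blast
    qed
    ultimately show lim: "(\<lambda>n. mean_fun p (T n) / ?x n) \<longlonglongrightarrow> 1" by (auto elim: Lim_transform_eventually)
    have "filterlim (\<lambda>n. mean_fun p (T n) / ?x n * ?x n) at_top sequentially"
      by (rule filterlim_tendsto_pos_mult_at_top[OF lim _ R(3)[OF T]]) simp
    moreover have "\<forall>\<^sub>F n in sequentially. mean_fun p (T n) / ?x n * ?x n = mean_fun p (T n)"
      using \<open>\<forall>\<^sub>F n in sequentially. 0 < ?x n\<close> by eventually_elim simp
    ultimately show "filterlim (\<lambda>n. mean_fun p (T n)) at_top sequentially" by (simp add: filterlim_cong)
  qed
  define T where "T n = tilt_param p (a n)" for n
  \<comment> \<open>The peak analysis is used twice: along the naturals it shows that the mean is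
    unbounded, so the parameters exist and diverge; then \<open>T\<close> itself is an admissible
    sequence.\<close>
  have meanT: "\<forall>\<^sub>F n in sequentially. mean_fun p (T n) = a n" and T: "filterlim T at_top sequentially"
    using E.tilt_param_limit[OF mean_top[OF filterlim_real_sequentially] a] by (simp_all add: T_def[abs_def])
  define x where "x n = gen_inv h (T n)" for n
  define \<sigma> where "\<sigma> n = sqrt (deriv (gen_inv h) (T n))" for n
  define \<pi> where "\<pi> n v = exp (T n * v) * p v / Phi p (T n)" for n v
  define F where "F n N v = fourier_density (\<lambda>u. char (lborel_density (\<pi> n)) u ^ N) v" for n N v
  obtain s \<kappa> :: "nat \<Rightarrow> real" and C where \<kappa>: "\<kappa> \<longlonglongrightarrow> 0" and s\<sigma>: "(\<lambda>n. s n / \<sigma> n) \<longlonglongrightarrow> 1"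
    and ev: "\<forall>\<^sub>F n in sequentially. 0 < s n \<and> real_distribution (lborel_density (\<pi> n)) \<and>
      (\<forall>v. \<pi> n v \<le> C / s n) \<and>
      (\<forall>N\<ge>2. \<forall>v. \<bar>F n N v * s n - normal_density 0 (sqrt N) ((v - N * mean_fun p (T n)) / s n)\<bar>
        \<le> \<kappa> n * cube_gaussian / N + (3 / 4) ^ (N - 2) * (C + 1))"
    by (rule laplace_peak.tilted_local_limit[OF lap[OF T] E.exp_density_axioms, folded \<pi>_def \<sigma>_def, folded F_def]) (rule that)
  have est: "\<forall>\<^sub>F n in sequentially. \<forall>N\<ge>2. \<forall>v. \<bar>F n N v * s n - normal_density 0 (sqrt N) ((v - N * a n) / s n)\<bar>
      \<le> \<kappa> n * cube_gaussian / N + (3 / 4) ^ (N - 2) * (C + 1)"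
    using ev meanT
  proof eventually_elim
    case (elim n)
    from elim(1)[unfolded elim(2)] show ?case by blast
  qed
  note xlim = R(3)[OF T, folded x_def] and \<sigma>pos = R(4)[OF T, folded \<sigma>_def]
  have x0: "\<forall>\<^sub>F n in sequentially. 0 < x n" using xlim by (simp add: filterlim_at_top_dense)
  define Y where "Y = (\<Sum>i=1..k. y i)"
  \<comment> \<open>This leaves \<open>n - k \<ge> 2\<close> summands, as needed for inversion, and
    ensures \<open>n \<le> 2 * (n - k)\<close>.\<close>
  have large: "\<forall>\<^sub>F n in sequentially. 2 * k + 2 \<le> n" by (rule eventually_ge_at_top)

  \<comment> \<open>Local limits for all \<open>n\<close> and for the last \<open>n - k\<close>
    summands\<close>
  define u1 where "u1 n = sqrt (2 * pi * real n) * (F n n (n * a n) * s n)" for n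
  define u2 where "u2 n = sqrt (2 * pi * real (n - k)) * (F n (n - k) (n * a n - Y) * s n)" for n
  have Q1: "(\<lambda>n. sqrt n * (u1 n - 1)) \<longlonglongrightarrow> 0"
    unfolding u1_def
  proof (rule sqrt_error_of_local_limit[OF \<kappa> filterlim_ident, of "\<lambda>_. 0" _ cube_gaussian "C + 1"])
    show "\<forall>\<^sub>F n in sequentially. \<bar>F n n (n * a n) * s n - normal_density 0 (sqrt n) 0\<bar>
        \<le> \<kappa> n * cube_gaussian / n + (3 / 4) ^ (n - 2) * (C + 1)"
      using est large
    proof eventually_elim
      case (elim n)
      then show ?case using elim(1)[rule_format, of n "n * a n"] by simp
    qed
  qed auto
  have Q2: "(\<lambda>n. sqrt n * (u2 n - 1)) \<longlonglongrightarrow> 0"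
    unfolding u2_def
  proof (rule sqrt_error_of_local_limit[OF \<kappa>, of "\<lambda>n. n - k" "\<lambda>n. (k * a n - Y) / s n" _ cube_gaussian "C + 1"])
    show "filterlim (\<lambda>n. n - k) at_top sequentially"
      by (rule filterlim_minus_const_nat_at_top)
    show "\<forall>\<^sub>F n in sequentially. n \<le> 2 * (n - k)" using large by eventually_elim auto
    show "\<forall>\<^sub>F n in sequentially. \<bar>F n (n - k) (n * a n - Y) * s n - normal_density 0 (sqrt (real (n - k))) ((k * a n - Y) / s n)\<bar>
        \<le> \<kappa> n * cube_gaussian / real (n - k) + (3 / 4) ^ (n - k - 2) * (C + 1)"
      using est large
    proof eventually_elim
      case (elim n)
      have eq: "n * a n - Y - real (n - k) * a n = k * a n - Y" using elim by (simp add: of_nat_diff algebra_simps)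
      have "2 \<le> n - k" using elim by simp
      then show ?case using elim(1)[rule_format, of "n - k" "n * a n - Y"] unfolding eq by blast
    qed
    \<comment> \<open>The squared offset from the mean, factored into quantities with known limits
      \<open>k^2\<close>, \<open>1\<close>, \<open>0\<close> and \<open>1\<close>; the third factor
      is the one in the growth condition.\<close>
    let ?P = "\<lambda>n. (k * (a n / x n) - Y / x n)\<^sup>2 * (inverse (s n / \<sigma> n))\<^sup>2 *
        ((x n)\<^sup>2 / (sqrt n * deriv (gen_inv h) (T n))) * (sqrt (real n / real (n - k)))\<^sup>2"
    have "(\<lambda>n. a n / x n) \<longlonglongrightarrow> 1"
    proof (rule Lim_transform_eventually[OF mean_ratio[OF T, folded x_def]])
      show "\<forall>\<^sub>F n in sequentially. mean_fun p (T n) / x n = a n / x n" using meanT by eventually_elim simp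
    qed
    moreover have "(\<lambda>n. Y / x n) \<longlonglongrightarrow> 0"
      by (intro tendsto_divide_0[OF tendsto_const] filterlim_at_top_imp_at_infinity xlim)
    moreover have "(\<lambda>n. (x n)\<^sup>2 / (sqrt n * deriv (gen_inv h) (T n))) \<longlonglongrightarrow> 0"
      using peak by (simp add: x_def T_def)
    moreover have "(\<lambda>n. sqrt (real n / real (n - k))) \<longlonglongrightarrow> 1"
      by (rule sqrt_error_imp_tendsto_1[OF sqrt_error_shift])
    ultimately have "?P \<longlonglongrightarrow> (real k * 1 - 0)\<^sup>2 * (inverse 1)\<^sup>2 * 0 * 1\<^sup>2"
      by (intro tendsto_mult tendsto_power tendsto_diff tendsto_const tendsto_inverse s\<sigma>) auto
    moreover have "\<forall>\<^sub>F n in sequentially. ?P n = sqrt n * ((k * a n - Y) / s n)\<^sup>2 / real (n - k)"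
      using x0 \<sigma>pos ev large
    proof eventually_elim
      case (elim n)
      have 1: "k * (a n / x n) - Y / x n = (k * a n - Y) / x n" by (simp add: diff_divide_distrib)
      have "deriv (gen_inv h) (T n) > 0" using elim(2) by (simp add: \<sigma>_def)
      then have 2: "deriv (gen_inv h) (T n) = (\<sigma> n)\<^sup>2" by (simp add: \<sigma>_def)
      have 3: "(sqrt (real n / real (n - k)))\<^sup>2 = real n / real (n - k)" by simp
      have 4: "real n = sqrt n * sqrt n" by simp
      have n0: "sqrt (real n) > 0" using elim by simp
      have "?P n = (k * a n - Y)\<^sup>2 / (x n)\<^sup>2 * ((\<sigma> n)\<^sup>2 / (s n)\<^sup>2) * ((x n)\<^sup>2 / (sqrt n * (\<sigma> n)\<^sup>2)) * (sqrt n * sqrt n / real (n - k))"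
        unfolding 1 2 3 using 4 by (simp add: power_divide)
      also have "\<dots> = sqrt n * ((k * a n - Y) / s n)\<^sup>2 / real (n - k)"
      proof -
        have "b\<^sup>2 / x\<^sup>2 * (\<sigma>\<^sup>2 / s\<^sup>2) * (x\<^sup>2 / (R * \<sigma>\<^sup>2)) * (R * R / m) = R * (b / s)\<^sup>2 / m"
          if "x \<noteq> 0" "\<sigma> \<noteq> 0" "R \<noteq> 0" for b x \<sigma> s R m :: real
          using that by (simp add: power_divide)
        then show ?thesis using elim n0 by (metis less_irrefl)
      qed
      finally show ?case .
    qed
    ultimately show "(\<lambda>n. sqrt n * ((k * a n - Y) / s n)\<^sup>2 / real (n - k)) \<longlonglongrightarrow> 0"
      by (auto elim: Lim_transform_eventually)
  qed

  \<comment> \<open>The conditional density as a quotient of local limits\<close>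
  define r where "r n = F n (n - k) (n * a n - Y) / F n n (n * a n) - 1" for n
  have "(\<lambda>n. sqrt n * (u2 n * sqrt (real n / real (n - k)) * inverse (u1 n) - 1)) \<longlonglongrightarrow> 0"
    by (intro sqrt_error_mult sqrt_error_inverse sqrt_error_shift Q1 Q2)
  moreover have "\<forall>\<^sub>F n in sequentially. sqrt n * (u2 n * sqrt (real n / real (n - k)) * inverse (u1 n) - 1) = sqrt n * r n"
    using ev large
  proof eventually_elim
    case (elim n)
    have pos: "s n > 0" "real (n - k) > 0" "real n > 0" using elim by auto
    have "sqrt (2 * pi * m) * (u * d) * sqrt (l / m) * inverse (sqrt (2 * pi * l) * (v * d)) = u / v"
      if "d > 0" "m > 0" "l > 0" for u v d l m :: real
      using that by (simp add: real_sqrt_mult real_sqrt_divide field_simps)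
    from this[OF pos] show ?case by (simp only: r_def u1_def u2_def)
  qed
  ultimately have r_lim: "(\<lambda>n. sqrt n * r n) \<longlonglongrightarrow> 0" by (auto elim: Lim_transform_eventually)
  have "r \<in> o(\<lambda>n. 1 / sqrt (real n))"
  proof (rule smalloI_tendsto)
    show "((\<lambda>n. r n / (1 / sqrt (real n))) \<longlongrightarrow> 0) sequentially" using r_lim by (simp add: mult.commute)
    show "\<forall>\<^sub>F n in sequentially. 1 / sqrt (real n) \<noteq> 0" using eventually_gt_at_top[of 0] by eventually_elim simp
  qed
  \<comment> \<open>With this \<open>r\<close> the identity is exact: the powers of
    \<open>Phi\<close> leave \<open>1 / Phi ^ k\<close>, the exponentials leave
    \<open>exp (T n * Y)\<close>, and together with the factors \<open>p (y i)\<close> they form the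
    product of the tilted densities.\<close>
  moreover have "\<forall>\<^sub>F n in sequentially. cond_density M X p k n y (real n * a n) =
      (\<Prod>i=1..k. tilted_density p (a n) (y i)) * (1 + r n)"
    using ev large
  proof eventually_elim
    case (elim n)
    let ?\<Phi> = "Phi p (T n)"
    have \<Phi>0: "?\<Phi> > 0" using E.Mom0_pos by (simp add: E.Phi_eq)
    have cd: "continuous_density M (\<lambda>\<omega>. \<Sum>i\<in>I. X i \<omega>) = (\<lambda>v. ?\<Phi> ^ card I * exp (- (T n * v)) * F n (card I) v)"
      if I: "finite I" "2 \<le> card I" "I \<subseteq> {1..}" for I
      unfolding F_def
    proof (rule continuous_density_sum_iid_tilted[OF _ _ _ _ _ _ _ _ I(1,2)])
      show "indep_vars (\<lambda>_. borel) X I" using ind I(3) by (rule indep_vars_subset)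
      show "distributed M lborel (X i) (\<lambda>x. ennreal (p x))" if "i \<in> I" for i using X that I by auto
      show "\<pi> n \<in> borel_measurable borel" unfolding \<pi>_def by measurable
      show "0 \<le> \<pi> n v" for v using p0 \<Phi>0 by (simp add: \<pi>_def)
      show "p v = ?\<Phi> * exp (- (T n * v)) * \<pi> n v" for v
        using \<Phi>0 by (simp add: \<pi>_def exp_minus)
    qed (use elim \<Phi>0 in auto)
    have cd1: "continuous_density M (\<lambda>\<omega>. \<Sum>i=1..n. X i \<omega>) (n * a n) = ?\<Phi> ^ n * exp (- (T n * (n * a n))) * F n n (n * a n)"
      using elim by (subst cd) auto
    have cd2: "continuous_density M (\<lambda>\<omega>. \<Sum>i=k+1..n. X i \<omega>) (n * a n - Y)
        = ?\<Phi> ^ (n - k) * exp (- (T n * (n * a n - Y))) * F n (n - k) (n * a n - Y)"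
      using elim by (subst cd) auto
    have "(\<Prod>i=1..k. tilted_density p (a n) (y i)) = exp (T n * Y) * (\<Prod>i=1..k. p (y i)) / ?\<Phi> ^ k"
      by (simp add: tilted_density_def T_def[symmetric] prod_dividef prod.distrib exp_sum[symmetric] Y_def sum_distrib_left)
    moreover have "?\<Phi> ^ n = ?\<Phi> ^ (n - k) * ?\<Phi> ^ k" using elim by (simp flip: power_add)
    moreover have "exp (- (T n * (n * a n - Y))) = exp (- (T n * (n * a n))) * exp (T n * Y)"
      by (simp add: algebra_simps flip: exp_add)
    ultimately show ?case
      unfolding cond_density_def joint_density_def Y_def[symmetric] cd1 cd2 r_def
      using \<Phi>0 by simp
  qed
  ultimately show ?thesis by blast
qed

end
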